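(* The problem of deciding whether a TSL formula is satisfiable in the theory of uninterpreted functions $T_U$ is (1) semi-decidable when restricted to formulas of the reachability fragment of TSL, (2) decidable when restricted to formulas consisting of only logical operators, predicate terms, updates, next operators, and at most one top-level eventually operator, and (3) semi-decidable when restricted to formulas with exactly one cell.
   Context: TSL formulas use finitely many function symbols, predicate symbols and cells. Function terms are built from cells by applying function symbols; predicate terms are $p(\tau_0,\dots,\tau_m)$. Formulas: $\mathit{true}\mid\neg\varphi\mid\varphi\wedge\psi\mid\mathsf{X}\varphi\mid\varphi\,\mathsf{U}\,\psi\mid\tau_p\mid[\mathsf{c}\leftarrow\tau_f]$; $\mathsf{F}\varphi=\mathit{true}\,\mathsf{U}\,\varphi$ (eventually), $\mathsf{X}$ is next. The reachability fragment is the fragment of TSL that permits only the next operator and the eventually operator as temporal operators. A top-level eventually operator means the formula has the form $\mathsf{F}\varphi'$ with $\varphi'$ free of eventually. An assignment $\langle\cdot\rangle$ over values $\mathcal{V}\supseteq\mathbb{B}$ interprets cells as values, function symbols as functions on $\mathcal{V}$, predicate symbols as Boolean-valued functions; $\chi_{\langle\cdot\rangle}$ evaluates terms. A computation $\varsigma$ is an infinite sequence of maps from cells to function terms; $\eta(\varsigma,0,\mathsf{c})=\mathsf{c}$, $\eta(\varsigma,t,\mathsf{c})=\eta(\varsigma,t-1,\varsigma_{t-1}(\mathsf{c}))$ ($t>0$), $\eta$ commutes with function symbols. At time $t$: $\neg,\wedge,\mathsf{X},\mathsf{U}$ as in LTL; $[\mathsf{c}\leftarrow\tau]$ holds iff $\varsigma_t(\mathsf{c})$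 is syntactically $\tau$; $\tau_p$ holds iff $\chi_{\langle\cdot\rangle}(\eta(\varsigma,t,\tau_p))=\mathit{true}$. $T_U$ has no axioms; $\varphi$ is satisfiable in $T_U$ if some execution $(\varsigma,\mathcal{V},\langle\cdot\rangle)$ satisfies $\varphi$ at time 0.
   Formalization: In (1), eventually may occur only under an even number of negations; otherwise ¬F¬ gives globally, which with two cells encodes non-halting of Turing machines, so (1) fails. Value sets are taken inside an arbitrary infinite universe, which does not change satisfiability. *)

theory Defs
  imports "HOL-Library.Nat_Bijection"
begin

datatype recf =
    Zero
  | Successor
  | Proj nat
  | Comp recf "recf list"
  | PrimRec recf recf
  | Minim recf

text \<open>
  \<open>rec_eval f xs y\<close>: the partial recursive function described by \<open>f\<close> is defined on the
  arguments \<open>xs\<close> and has value \<open>y\<close>. Recursion and minimisation act on the first argument.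
  Arities are not tracked: an application to too few arguments is simply undefined.
\<close>

inductive rec_eval :: "recf \<Rightarrow> nat list \<Rightarrow> nat \<Rightarrow> bool" where
  eval_Zero: "rec_eval Zero xs 0"
| eval_Succ: "rec_eval Successor (x # xs) (Suc x)"
| eval_Proj: "i < length xs \<Longrightarrow> rec_eval (Proj i) xs (xs ! i)"
| eval_Comp: "list_all2 (\<lambda>g y. rec_eval g xs y) gs ys \<Longrightarrow> rec_eval f ys z
    \<Longrightarrow> rec_eval (Comp f gs) xs z"
| eval_PrimRec_0: "rec_eval f xs y \<Longrightarrow> rec_eval (PrimRec f g) (0 # xs) y"
| eval_PrimRec_Suc: "rec_eval (PrimRec f g) (n # xs) y \<Longrightarrow> rec_eval g (n # y # xs) z
    \<Longrightarrow> rec_eval (PrimRec f g) (Suc n # xs) z"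
| eval_Minim: "rec_eval f (n # xs) 0 \<Longrightarrow> (\<forall>m<n. \<exists>y. rec_eval f (m # xs) (Suc y))
    \<Longrightarrow> rec_eval (Minim f) xs n"

inductive_cases rec_eval_ZeroE: "rec_eval Zero xs y"
inductive_cases rec_eval_SuccessorE: "rec_eval Successor xs y"
inductive_cases rec_eval_ProjE: "rec_eval (Proj i) xs y"
inductive_cases rec_eval_CompE: "rec_eval (Comp f gs) xs y"
inductive_cases rec_eval_PrimRec_0E: "rec_eval (PrimRec f g) (0 # xs) y"
inductive_cases rec_eval_PrimRec_SucE: "rec_eval (PrimRec f g) (Suc n # xs) y"
inductive_cases rec_eval_MinimE: "rec_eval (Minim f) xs y"

lemma rec_eval_deterministic:
  assumes "rec_eval f xs y" and "rec_eval f xs z"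
  shows "y = z"
  using assms
proof (induction arbitrary: z rule: rec_eval.induct)
  case (eval_Comp xs gs ys f w)
  from eval_Comp.prems obtain ys' where
    ys': "list_all2 (\<lambda>g y. rec_eval g xs y) gs ys'" and f: "rec_eval f ys' z"
    by (auto elim: rec_eval_CompE)
  have "ys = ys'"
    using eval_Comp.IH(1) ys'
    by (auto simp: list_all2_conv_all_nth intro!: nth_equalityI)
  with f eval_Comp.IH(2) show ?case by blast
next
  case (eval_Minim f n xs)
  from eval_Minim.prems have z: "rec_eval f (z # xs) 0"
    and less: "\<forall>m<z. \<exists>y. rec_eval f (m # xs) (Suc y)"
    by (auto elim: rec_eval_MinimE)
  have "\<not> z < n" using eval_Minim.IH(2) z by fastforce
  moreover have "\<not> n < z" using eval_Minim.IH(1) less by fastforce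
  ultimately show ?case by simp
qed (blast elim: rec_eval_ZeroE rec_eval_SuccessorE rec_eval_ProjE
       rec_eval_PrimRec_0E rec_eval_PrimRec_SucE)+

definition decidable :: "nat set \<Rightarrow> bool" where
  "decidable A \<longleftrightarrow> (\<exists>f. \<forall>n. rec_eval f [n] (if n \<in> A then 1 else 0))"

definition semi_decidable :: "nat set \<Rightarrow> bool" where
  "semi_decidable A \<longleftrightarrow> (\<exists>f. \<forall>n. n \<in> A \<longleftrightarrow> (\<exists>y. rec_eval f [n] y))"

text \<open>
  A signature has finitely many cells, function symbols and predicate symbols. Symbols of each
  kind are numbered from 0: cells by \<open>c < num_cells \<Sigma>\<close>, function (predicate) symbols by the
  positions in the list of their arities. Function symbols of arity 0 are constants; predicate
  terms \<open>p(\<tau>\<^sub>0, \<dots>, \<tau>\<^sub>m)\<close> have at least one argument.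
\<close>

datatype signature =
  Signature (num_cells: nat) (fun_arities: "nat list") (pred_arities: "nat list")

definition wf_signature :: "signature \<Rightarrow> bool" where
  "wf_signature \<Sigma> \<longleftrightarrow> (\<forall>n \<in> set (pred_arities \<Sigma>). 0 < n)"

datatype fterm =
    Cell nat
  | FApp nat "fterm list"

fun wf_term :: "signature \<Rightarrow> fterm \<Rightarrow> bool" where
  "wf_term \<Sigma> (Cell c) \<longleftrightarrow> c < num_cells \<Sigma>"
| "wf_term \<Sigma> (FApp f ts) \<longleftrightarrow>
     f < length (fun_arities \<Sigma>) \<and> length ts = fun_arities \<Sigma> ! f \<and> (\<forall>t \<in> set ts. wf_term \<Sigma> t)"

datatype formula =
    TrueF
  | Neg formula
  | Conj formula formula
  | Next formula
  | Until formula formula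
  | Pred nat "fterm list"
  | Update nat fterm

abbreviation Eventually :: "formula \<Rightarrow> formula" where
  "Eventually \<phi> \<equiv> Until TrueF \<phi>"

fun wf_formula :: "signature \<Rightarrow> formula \<Rightarrow> bool" where
  "wf_formula \<Sigma> TrueF \<longleftrightarrow> True"
| "wf_formula \<Sigma> (Neg \<phi>) \<longleftrightarrow> wf_formula \<Sigma> \<phi>"
| "wf_formula \<Sigma> (Conj \<phi> \<psi>) \<longleftrightarrow> wf_formula \<Sigma> \<phi> \<and> wf_formula \<Sigma> \<psi>"
| "wf_formula \<Sigma> (Next \<phi>) \<longleftrightarrow> wf_formula \<Sigma> \<phi>"
| "wf_formula \<Sigma> (Until \<phi> \<psi>) \<longleftrightarrow> wf_formula \<Sigma> \<phi> \<and> wf_formula \<Sigma> \<psi>"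
| "wf_formula \<Sigma> (Pred p ts) \<longleftrightarrow>
     p < length (pred_arities \<Sigma>) \<and> length ts = pred_arities \<Sigma> ! p \<and> (\<forall>t \<in> set ts. wf_term \<Sigma> t)"
| "wf_formula \<Sigma> (Update c t) \<longleftrightarrow> c < num_cells \<Sigma> \<and> wf_term \<Sigma> t"

text \<open>An instance of the satisfiability problem is a signature with a formula over it.\<close>

definition tsl_formulas :: "(signature \<times> formula) set" where
  "tsl_formulas = {(\<Sigma>, \<phi>). wf_signature \<Sigma> \<and> wf_formula \<Sigma> \<phi>}"

text \<open>Values: the Booleans are among the values; \<open>'u\<close> supplies all other ones.\<close>

datatype 'u val = BoolV bool | OtherV 'u

datatype 'u assignment = Assignment
  (cell_val: "nat \<Rightarrow> 'u val")
  (fun_val: "nat \<Rightarrow> 'u val list \<Rightarrow> 'u val")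
  (pred_val: "nat \<Rightarrow> 'u val list \<Rightarrow> bool")

definition assignment_over :: "signature \<Rightarrow> 'u val set \<Rightarrow> 'u assignment \<Rightarrow> bool" where
  "assignment_over \<Sigma> V I \<longleftrightarrow>
     range BoolV \<subseteq> V \<and>
     (\<forall>c < num_cells \<Sigma>. cell_val I c \<in> V) \<and>
     (\<forall>f < length (fun_arities \<Sigma>). \<forall>vs.
        length vs = fun_arities \<Sigma> ! f \<and> set vs \<subseteq> V \<longrightarrow> fun_val I f vs \<in> V)"

fun term_val :: "'u assignment \<Rightarrow> fterm \<Rightarrow> 'u val" where
  "term_val I (Cell c) = cell_val I c"
| "term_val I (FApp f ts) = fun_val I f (map (term_val I) ts)"

type_synonym computation = "nat \<Rightarrow> nat \<Rightarrow> fterm"  \<comment> \<open>time, cell\<close>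

definition computation_over :: "signature \<Rightarrow> computation \<Rightarrow> bool" where
  "computation_over \<Sigma> \<sigma> \<longleftrightarrow> (\<forall>t. \<forall>c < num_cells \<Sigma>. wf_term \<Sigma> (\<sigma> t c))"

fun unroll :: "computation \<Rightarrow> nat \<Rightarrow> fterm \<Rightarrow> fterm" where
  "unroll \<sigma> 0 (Cell c) = Cell c"
| "unroll \<sigma> (Suc t) (Cell c) = unroll \<sigma> t (\<sigma> t c)"
| "unroll \<sigma> t (FApp f ts) = FApp f (map (unroll \<sigma> t) ts)"

fun holds :: "computation \<Rightarrow> 'u assignment \<Rightarrow> nat \<Rightarrow> formula \<Rightarrow> bool" where
  "holds \<sigma> I t TrueF \<longleftrightarrow> True"
| "holds \<sigma> I t (Neg \<phi>) \<longleftrightarrow> \<not> holds \<sigma> I t \<phi>"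
| "holds \<sigma> I t (Conj \<phi> \<psi>) \<longleftrightarrow> holds \<sigma> I t \<phi> \<and> holds \<sigma> I t \<psi>"
| "holds \<sigma> I t (Next \<phi>) \<longleftrightarrow> holds \<sigma> I (Suc t) \<phi>"
| "holds \<sigma> I t (Until \<phi> \<psi>) \<longleftrightarrow>
     (\<exists>t'\<ge>t. holds \<sigma> I t' \<psi> \<and> (\<forall>s. t \<le> s \<and> s < t' \<longrightarrow> holds \<sigma> I s \<phi>))"
| "holds \<sigma> I t (Pred p ts) \<longleftrightarrow> pred_val I p (map (\<lambda>\<tau>. term_val I (unroll \<sigma> t \<tau>)) ts)"
| "holds \<sigma> I t (Update c \<tau>) \<longleftrightarrow> \<sigma> t c = \<tau>"

text \<open>
  Satisfiability in the theory of uninterpreted functions: there are no axioms, so all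
  assignments are admitted. HOL cannot quantify over types inside a formula, hence the value set
  \<open>V\<close> ranges over the subsets of \<open>'u val\<close> for a universe \<open>'u\<close> given as a parameter.
\<close>

definition satisfiable_TU :: "'u itself \<Rightarrow> signature \<Rightarrow> formula \<Rightarrow> bool" where
  "satisfiable_TU U \<Sigma> \<phi> \<longleftrightarrow>
     (\<exists>\<sigma> (V :: 'u val set) I.
        computation_over \<Sigma> \<sigma> \<and> assignment_over \<Sigma> V I \<and> holds \<sigma> I 0 \<phi>)"

fun next_fragment :: "formula \<Rightarrow> bool" where
  "next_fragment TrueF \<longleftrightarrow> True"
| "next_fragment (Neg \<phi>) \<longleftrightarrow> next_fragment \<phi>"
| "next_fragment (Conj \<phi> \<psi>) \<longleftrightarrow> next_fragment \<phi> \<and> next_fragment \<psi>"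
| "next_fragment (Next \<phi>) \<longleftrightarrow> next_fragment \<phi>"
| "next_fragment (Until \<phi> \<psi>) \<longleftrightarrow> False"
| "next_fragment (Pred p ts) \<longleftrightarrow> True"
| "next_fragment (Update c \<tau>) \<longleftrightarrow> True"

text \<open>
  An eventually operator below an odd number of negations is a globally operator
  (\<open>G \<phi> = \<not> F \<not> \<phi>\<close>), which is not a reachability operator. The Boolean argument is the polarity
  of the subformula; eventually may occur only positively. Polarities are needed, rather than
  negations of F-free formulas only, since \<open>\<or>\<close> and \<open>\<longrightarrow>\<close> are expressed by \<open>\<not>\<close> and \<open>\<and>\<close>.
\<close>

fun reach_pol :: "bool \<Rightarrow> formula \<Rightarrow> bool" where
  "reach_pol b TrueF \<longleftrightarrow> True"
| "reach_pol b (Neg \<phi>) \<longleftrightarrow> reach_pol (\<not> b) \<phi>"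
| "reach_pol b (Conj \<phi> \<psi>) \<longleftrightarrow> reach_pol b \<phi> \<and> reach_pol b \<psi>"
| "reach_pol b (Next \<phi>) \<longleftrightarrow> reach_pol b \<phi>"
| "reach_pol b (Until \<phi> \<psi>) \<longleftrightarrow> b \<and> \<phi> = TrueF \<and> reach_pol b \<psi>"
| "reach_pol b (Pred p ts) \<longleftrightarrow> True"
| "reach_pol b (Update c \<tau>) \<longleftrightarrow> True"

definition reachability_fragment :: "formula \<Rightarrow> bool" where
  "reachability_fragment \<phi> \<longleftrightarrow> reach_pol True \<phi>"

definition top_eventually_fragment :: "formula \<Rightarrow> bool" where
  "top_eventually_fragment \<phi> \<longleftrightarrow>
     next_fragment \<phi> \<or> (\<exists>\<psi>. \<phi> = Eventually \<psi> \<and> next_fragment \<psi>)"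

fun term_code :: "fterm \<Rightarrow> nat" where
  "term_code (Cell c) = prod_encode (0, c)"
| "term_code (FApp f ts) = prod_encode (Suc f, list_encode (map term_code ts))"

fun formula_code :: "formula \<Rightarrow> nat" where
  "formula_code TrueF = prod_encode (0, 0)"
| "formula_code (Neg \<phi>) = prod_encode (1, formula_code \<phi>)"
| "formula_code (Conj \<phi> \<psi>) = prod_encode (2, prod_encode (formula_code \<phi>, formula_code \<psi>))"
| "formula_code (Next \<phi>) = prod_encode (3, formula_code \<phi>)"
| "formula_code (Until \<phi> \<psi>) = prod_encode (4, prod_encode (formula_code \<phi>, formula_code \<psi>))"
| "formula_code (Pred p ts) = prod_encode (5, prod_encode (p, list_encode (map term_code ts)))"
| "formula_code (Update c \<tau>) = prod_encode (6, prod_encode (c, term_code \<tau>))"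

definition signature_code :: "signature \<Rightarrow> nat" where
  "signature_code \<Sigma> = prod_encode (num_cells \<Sigma>,
     prod_encode (list_encode (fun_arities \<Sigma>), list_encode (pred_arities \<Sigma>)))"

definition instance_code :: "signature \<times> formula \<Rightarrow> nat" where
  "instance_code x = prod_encode (signature_code (fst x), formula_code (snd x))"

lemma term_code_inject: "term_code s = term_code t \<Longrightarrow> s = t"
proof (induction s arbitrary: t rule: term_code.induct)
  case (1 c)
  then show ?case by (cases t) auto
next
  case (2 f ts)
  then obtain us where t: "t = FApp f us" and eq: "map term_code ts = map term_code us"
    by (cases t) (auto simp: list_encode_eq)
  have "ts = us"
  proof (rule nth_equalityI)
    show len: "length ts = length us" using eq by (rule map_eq_imp_length_eq)
    fix i assume i: "i < length ts"
    then have "term_code (ts ! i) = term_code (us ! i)"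
      using eq len by (metis nth_map)
    then show "ts ! i = us ! i" using "2.IH" i by simp
  qed
  then show ?case using t by simp
qed

lemma formula_code_inject: "formula_code \<phi> = formula_code \<psi> \<Longrightarrow> \<phi> = \<psi>"
proof (induction \<phi> arbitrary: \<psi>)
  case (Pred p ts)
  then show ?case
    by (cases \<psi>) (auto simp: list_encode_eq inj_def dest!: map_injective intro: term_code_inject)
qed (case_tac \<psi>; auto dest: term_code_inject)+

lemma inj_instance_code: "inj instance_code"
  by (rule injI)
    (auto simp: instance_code_def signature_code_def prod_eq_iff list_encode_eq
      intro: signature.expand formula_code_inject)

definition decidable_problem :: "(signature \<times> formula) set \<Rightarrow> bool" where
  "decidable_problem P \<longleftrightarrow> decidable (instance_code ` P)"

definition semi_decidable_problem :: "(signature \<times> formula) set \<Rightarrow> bool" where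
  "semi_decidable_problem P \<longleftrightarrow> semi_decidable (instance_code ` P)"

end

theory Submission
  imports Defs "HOL-Library.More_List"
begin

text \<open>
  Without axioms, syntactically different terms may denote different values, so a formula is
  satisfiable iff some computation together with an arbitrary set of true predicate terms satisfies
  it. All three parts are obtained by finding a finite, checkable certificate for satisfiability:
  an ultimately periodic sequence of updates (a lasso) with the observations made along it.

  (1) A reachability formula depends on a finite prefix only; afterwards the cells may be frozen.

  (2) For formulas with only next operators, each update not mentioned in the formula can be
  replaced by one of finitely many terms, chosen so deep that they create no new equalities between
  the terms that occur. A top-level eventually is removed by shifting the computation.

  (3) Let there be one cell. If its content recurs, the execution can be closed to a lasso. If
  updates not mentioned in the formula occur infinitely often, each round of a lasso can start with
  a fresh content. Otherwise, eventually all updates are mentioned ones and only enlarge the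
  content; a predicate term seen in two different rounds is then small relative to the content at
  the beginning of the later one, so it suffices that the two ends of the loop agree on the finitely
  many small predicate terms.
\<close>

section \<open>Total recursive functions\<close>

text \<open>Closing a word of observations into a lasso is the easy half: a temporal formula
  survives it once the same subformulas hold at both ends of the loop and every eventuality due
  there is fulfilled inside. The obstacle is that repeating the updates need not repeat the
  contents. A predicate term of a later round may then be syntactically equal to one seen before
  although the lasso records different truth values for the two, and no interpretation could produce
  both. The three kinds of certificate exclude this conflict differently: the contents at both ends
  are equal; or an unmentioned update is replaced such that any two predicate terms that now
  coincide coincided before; or the two ends agree on every predicate term that can be met again.

  Two measures make terms comparable. For fresh contents it is the length of the leftmost branch
  modulo a large number, because substitution acts on it additively. For growing contents it is the
  size of ground subterms: a term in which these are small is determined by its instance at a large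
  content.\<close>

definition recursive :: "nat \<Rightarrow> (nat list \<Rightarrow> nat) \<Rightarrow> bool" where
  "recursive k F \<longleftrightarrow> (\<exists>r. \<forall>xs. length xs = k \<longrightarrow> rec_eval r xs (F xs))"

lemma recursive_cong:
  assumes "recursive k F" and "\<And>xs. length xs = k \<Longrightarrow> F xs = G xs"
  shows "recursive k G"
proof -
  obtain r where "\<And>xs. length xs = k \<Longrightarrow> rec_eval r xs (F xs)"
    using assms(1) unfolding recursive_def by blast
  then have "\<forall>xs. length xs = k \<longrightarrow> rec_eval r xs (G xs)" using assms(2) by simp
  then show ?thesis unfolding recursive_def by blast
qed

lemma recursive_proj: "i < k \<Longrightarrow> recursive k (\<lambda>xs. xs ! i)"
  unfolding recursive_def by (blast intro: eval_Proj)

lemma recursive_comp: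
  assumes F: "recursive (length Gs) F" and Gs: "\<forall>G \<in> set Gs. recursive k G"
  shows "recursive k (\<lambda>xs. F (map (\<lambda>G. G xs) Gs))"
proof -
  obtain f where f: "\<And>xs. length xs = length Gs \<Longrightarrow> rec_eval f xs (F xs)"
    using F unfolding recursive_def by auto
  have "\<exists>g. \<forall>G \<in> set Gs. \<forall>xs. length xs = k \<longrightarrow> rec_eval (g G) xs (G xs)"
    using Gs unfolding recursive_def by (rule bchoice)
  then obtain g where g: "\<And>G xs. G \<in> set Gs \<Longrightarrow> length xs = k \<Longrightarrow> rec_eval (g G) xs (G xs)"
    by blast
  have "rec_eval (Comp f (map g Gs)) xs (F (map (\<lambda>G. G xs) Gs))" if "length xs = k" for xs
    by (rule eval_Comp[OF _ f]) (simp_all add: list_all2_conv_all_nth g that)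
  then show ?thesis unfolding recursive_def by blast
qed

lemma recursive_comp1:
  assumes "recursive 1 (\<lambda>xs. f (xs ! 0))" "recursive k G"
  shows "recursive k (\<lambda>xs. f (G xs))"
  using recursive_comp[of "[G]" "\<lambda>xs. f (xs ! 0)" k] assms by simp

lemma recursive_comp2:
  assumes "recursive 2 (\<lambda>xs. f (xs ! 0) (xs ! 1))" "recursive k G" "recursive k H"
  shows "recursive k (\<lambda>xs. f (G xs) (H xs))"
  using recursive_comp[of "[G, H]" "\<lambda>xs. f (xs ! 0) (xs ! 1)" k] assms
  by (simp add: numeral_2_eq_2)

lemma recursive_Suc:
  assumes "recursive k F" shows "recursive k (\<lambda>xs. Suc (F xs))"
proof (rule recursive_comp1[OF _ assms])
  have "rec_eval Successor xs (Suc (xs ! 0))" if "length xs = 1" for xs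
    using that eval_Succ by (cases xs) auto
  then show "recursive 1 (\<lambda>xs. Suc (xs ! 0))" unfolding recursive_def by blast
qed

lemma recursive_const: "recursive k (\<lambda>_. c)"
proof (induction c)
  case 0
  show ?case unfolding recursive_def by (blast intro: eval_Zero)
qed (erule recursive_Suc)

lemma recursive_rec_nat:
  assumes "recursive k F" and "recursive (Suc (Suc k)) G"
  shows "recursive (Suc k) (\<lambda>xs. rec_nat (F (tl xs)) (\<lambda>n y. G (n # y # tl xs)) (hd xs))"
proof -
  obtain f g where f: "\<And>xs. length xs = k \<Longrightarrow> rec_eval f xs (F xs)"
    and g: "\<And>xs. length xs = Suc (Suc k) \<Longrightarrow> rec_eval g xs (G xs)"
    using assms unfolding recursive_def by auto
  have "rec_eval (PrimRec f g) (n # ys) (rec_nat (F ys) (\<lambda>n y. G (n # y # ys)) n)"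
    if "length ys = k" for n ys
  proof (induction n)
    case 0
    show ?case by (simp add: eval_PrimRec_0 f that)
  next
    case (Suc n)
    then show ?case using eval_PrimRec_Suc[OF Suc g] that by simp
  qed
  then have "rec_eval (PrimRec f g) xs (rec_nat (F (tl xs)) (\<lambda>n y. G (n # y # tl xs)) (hd xs))"
    if "length xs = Suc k" for xs
    using that by (cases xs) auto
  then show ?thesis unfolding recursive_def by blast
qed

lemma recursive_rec_nat1:
  assumes "recursive 2 (\<lambda>xs. g (xs ! 0) (xs ! 1))"
  shows "recursive 1 (\<lambda>xs. rec_nat c g (xs ! 0))"
proof -
  have "recursive 1 (\<lambda>xs. rec_nat c (\<lambda>n y. g n y) (hd xs))"
    using recursive_rec_nat[OF recursive_const[of 0 c], of "\<lambda>xs. g (xs ! 0) (xs ! 1)"] assms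
    by (simp add: numeral_2_eq_2)
  then show ?thesis by (rule recursive_cong) (auto simp: length_Suc_conv)
qed

lemma recursive_rec_nat2:
  assumes "recursive 1 (\<lambda>xs. f (xs ! 0))" and "recursive 3 (\<lambda>xs. g (xs ! 0) (xs ! 1) (xs ! 2))"
  shows "recursive 2 (\<lambda>xs. rec_nat (f (xs ! 1)) (\<lambda>n y. g n y (xs ! 1)) (xs ! 0))"
proof -
  have "recursive 2 (\<lambda>xs. rec_nat (f (tl xs ! 0)) (\<lambda>n y. g n y (tl xs ! 0)) (hd xs))"
    using recursive_rec_nat[of 1 "\<lambda>xs. f (xs ! 0)" "\<lambda>xs. g (xs ! 0) (xs ! 1) (xs ! 2)"] assms
    by (simp add: numeral_2_eq_2 numeral_3_eq_3)
  then show ?thesis by (rule recursive_cong) (auto simp: numeral_2_eq_2 length_Suc_conv)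
qed

lemma recursive_add:
  assumes "recursive k F" "recursive k G" shows "recursive k (\<lambda>xs. F xs + G xs)"
proof (rule recursive_comp2[OF _ assms])
  have "recursive 2 (\<lambda>xs. rec_nat (xs ! 1) (\<lambda>n y. Suc y) (xs ! 0))"
    by (rule recursive_rec_nat2) (intro recursive_proj recursive_Suc; simp)+
  moreover have "rec_nat y (\<lambda>n. Suc) x = x + y" for x y by (induction x) auto
  ultimately show "recursive 2 (\<lambda>xs. xs ! 0 + xs ! 1)" by simp
qed

lemma recursive_pred:
  assumes "recursive k F" shows "recursive k (\<lambda>xs. F xs - 1)"
proof (rule recursive_comp1[OF _ assms])
  have "recursive 1 (\<lambda>xs. rec_nat 0 (\<lambda>n y. n) (xs ! 0))"
    by (rule recursive_rec_nat1) (auto intro: recursive_proj)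
  moreover have "rec_nat 0 (\<lambda>n y. n) x = x - 1" for x by (cases x) auto
  ultimately show "recursive 1 (\<lambda>xs. xs ! 0 - 1)" by simp
qed

lemma recursive_diff:
  assumes "recursive k F" "recursive k G" shows "recursive k (\<lambda>xs. F xs - G xs)"
\<comment> \<open>Recursion runs on the first argument, which has to be the subtrahend; hence the
  swapped arguments.\<close>
proof (rule recursive_comp2[where f = "\<lambda>x y. y - x", OF _ assms(2,1)])
  have "recursive 2 (\<lambda>xs. rec_nat (xs ! 1) (\<lambda>n y. y - 1) (xs ! 0))"
    by (rule recursive_rec_nat2) (intro recursive_proj recursive_pred; simp)+
  moreover have "rec_nat y (\<lambda>n y. y - 1) x = y - x" for x y by (induction x) auto
  ultimately show "recursive 2 (\<lambda>xs. xs ! 1 - xs ! 0)" by simp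
qed

lemma recursive_triangle:
  assumes "recursive k F" shows "recursive k (\<lambda>xs. triangle (F xs))"
proof (rule recursive_comp1[OF _ assms])
  have "recursive 1 (\<lambda>xs. rec_nat 0 (\<lambda>n y. y + Suc n) (xs ! 0))"
    by (rule recursive_rec_nat1) (intro recursive_add recursive_Suc recursive_proj; simp)
  moreover have "rec_nat 0 (\<lambda>n y. y + Suc n) x = triangle x" for x by (induction x) auto
  ultimately show "recursive 1 (\<lambda>xs. triangle (xs ! 0))" by simp
qed

lemma recursive_prod_encode:
  assumes "recursive k F" "recursive k G" shows "recursive k (\<lambda>xs. prod_encode (F xs, G xs))"
  unfolding prod_encode_def prod.case by (intro recursive_add recursive_triangle assms)

text \<open>The index of the diagonal of the Cantor pairing on which \<open>z\<close> lies. Passing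
  to \<open>Suc z\<close>, the truncated difference adds 1 exactly when the next triangle number is
  reached. Both components of \<open>prod_decode\<close> are arithmetic expressions in this index,
  which makes them primitive recursive.\<close>

definition diagonal :: "nat \<Rightarrow> nat" where
  "diagonal = rec_nat 0 (\<lambda>z s. s + (1 - (triangle (Suc s) - Suc z)))"

lemma triangle_diagonal: "triangle (diagonal z) \<le> z \<and> z < triangle (Suc (diagonal z))"
proof (induction z)
  case 0
  show ?case by (simp add: diagonal_def)
next
  case (Suc z)
  let ?s = "diagonal z"
  have "diagonal (Suc z) = (if triangle (Suc ?s) \<le> Suc z then Suc ?s else ?s)"
    by (simp add: diagonal_def)
  then show ?case using Suc by auto
qed

lemma triangle_mono: "m \<le> n \<Longrightarrow> triangle m \<le> triangle n"
  by (induction n) (auto simp: le_Suc_eq)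

lemma diagonal_prod_encode: "diagonal (prod_encode (m, n)) = m + n"
proof -
  let ?z = "prod_encode (m, n)"
  have z: "triangle (m + n) \<le> ?z \<and> ?z < triangle (Suc (m + n))" by (simp add: prod_encode_def)
  have "\<not> diagonal ?z < m + n"
    using triangle_mono[of "Suc (diagonal ?z)" "m + n"] z triangle_diagonal[of ?z] by linarith
  moreover have "\<not> m + n < diagonal ?z"
    using triangle_mono[of "Suc (m + n)" "diagonal ?z"] z triangle_diagonal[of ?z] by linarith
  ultimately show ?thesis by simp
qed

lemma recursive_diagonal:
  assumes "recursive k F" shows "recursive k (\<lambda>xs. diagonal (F xs))"
  unfolding diagonal_def
  by (rule recursive_comp1[OF _ assms], rule recursive_rec_nat1)
    (intro recursive_add recursive_diff recursive_triangle recursive_Suc recursive_const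
      recursive_proj; simp)

lemma diagonal_prod_decode:
  "fst (prod_decode z) = z - triangle (diagonal z)"
  "snd (prod_decode z) = diagonal z - fst (prod_decode z)"
proof -
  obtain m n where z: "z = prod_encode (m, n)" by (metis prod.exhaust prod_decode_inverse)
  have "prod_encode (m, n) = triangle (m + n) + m" by (simp add: prod_encode_def)
  then show "fst (prod_decode z) = z - triangle (diagonal z)"
    "snd (prod_decode z) = diagonal z - fst (prod_decode z)"
    unfolding z diagonal_prod_encode prod_encode_inverse by simp_all
qed

lemma recursive_fst:
  assumes "recursive k F" shows "recursive k (\<lambda>xs. fst (prod_decode (F xs)))"
  unfolding diagonal_prod_decode(1)
  by (intro recursive_diff recursive_triangle recursive_diagonal assms)

lemma recursive_snd:
  assumes "recursive k F" shows "recursive k (\<lambda>xs. snd (prod_decode (F xs)))"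
  unfolding diagonal_prod_decode(2)
  by (intro recursive_diff recursive_fst recursive_diagonal assms)

text \<open>Argument, counter and accumulator are packed into one number, so the step function is
  unary and later constructions never have to handle higher arities.\<close>

lemma recursive_rec_nat_param:
  assumes F: "recursive 1 (\<lambda>xs. F (xs ! 0))" and G: "recursive 1 (\<lambda>xs. G (xs ! 0))"
    and N: "recursive 1 (\<lambda>xs. N (xs ! 0))"
  shows "recursive 1 (\<lambda>xs. rec_nat (F (xs ! 0))
    (\<lambda>k y. G (prod_encode (xs ! 0, prod_encode (k, y)))) (N (xs ! 0)))"
proof (rule recursive_comp2[where f = "\<lambda>n x. rec_nat (F x)
    (\<lambda>k y. G (prod_encode (x, prod_encode (k, y)))) n", OF _ N recursive_proj])
  show "recursive 2 (\<lambda>xs. rec_nat (F (xs ! 1))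
      (\<lambda>k y. G (prod_encode (xs ! 1, prod_encode (k, y)))) (xs ! 0))"
    by (rule recursive_rec_nat2[OF F, of "\<lambda>k y x. G (prod_encode (x, prod_encode (k, y)))"],
        rule recursive_comp1[OF G])
      (intro recursive_prod_encode recursive_proj; simp)
qed simp

definition recursive1 :: "(nat \<Rightarrow> nat) \<Rightarrow> bool" where
  "recursive1 f \<longleftrightarrow> recursive 1 (\<lambda>xs. f (xs ! 0))"

definition recursive2 :: "(nat \<Rightarrow> nat \<Rightarrow> nat) \<Rightarrow> bool" where
  "recursive2 f \<longleftrightarrow> recursive 2 (\<lambda>xs. f (xs ! 0) (xs ! 1))"

lemma recursive1_id: "recursive1 (\<lambda>n. n)"
  unfolding recursive1_def by (rule recursive_proj) simp

lemma recursive1_const: "recursive1 (\<lambda>n. c)"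
  unfolding recursive1_def by (rule recursive_const)

lemma recursive1_comp: "recursive1 f \<Longrightarrow> recursive1 g \<Longrightarrow> recursive1 (\<lambda>n. f (g n))"
  unfolding recursive1_def by (rule recursive_comp1[of f])

lemma recursive1_comp2:
  "recursive2 f \<Longrightarrow> recursive1 g \<Longrightarrow> recursive1 h \<Longrightarrow> recursive1 (\<lambda>n. f (g n) (h n))"
  unfolding recursive1_def recursive2_def by (rule recursive_comp2[of f])

lemma recursive1_Suc: "recursive1 Suc"
  unfolding recursive1_def by (intro recursive_Suc recursive_proj) simp

lemma recursive1_pred: "recursive1 (\<lambda>n. n - 1)"
  unfolding recursive1_def by (intro recursive_pred recursive_proj) simp

lemma recursive1_fst: "recursive1 (\<lambda>n. fst (prod_decode n))"
  unfolding recursive1_def by (intro recursive_fst recursive_proj) simp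

lemma recursive1_snd: "recursive1 (\<lambda>n. snd (prod_decode n))"
  unfolding recursive1_def by (intro recursive_snd recursive_proj) simp

lemma recursive2_prod_encode: "recursive2 (\<lambda>m n. prod_encode (m, n))"
  unfolding recursive2_def by (intro recursive_prod_encode recursive_proj; simp)

lemma recursive1_rec_nat:
  assumes "recursive1 F" "recursive1 G" "recursive1 N"
  shows "recursive1 (\<lambda>x. rec_nat (F x) (\<lambda>k y. G (prod_encode (x, prod_encode (k, y)))) (N x))"
  using assms unfolding recursive1_def by (rule recursive_rec_nat_param)

section \<open>Computable functions on encoded types\<close>

text \<open>Only injectivity is demanded, because the codes of formulas do not exhaust the natural
  numbers.\<close>

class encodable =
  fixes enc :: "'a \<Rightarrow> nat"
  assumes enc_inject: "enc x = enc y \<Longrightarrow> x = y"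

lemma enc_eq [simp]: "enc x = enc y \<longleftrightarrow> x = y"
  by (auto dest: enc_inject)

instantiation nat :: encodable begin
definition enc_nat :: "nat \<Rightarrow> nat" where [simp]: "enc_nat n = n"
instance by standard simp
end

instantiation bool :: encodable begin
definition enc_bool :: "bool \<Rightarrow> nat" where "enc_bool b = of_bool b"
instance by standard (simp add: enc_bool_def of_bool_def split: if_splits)
end

instantiation prod :: (encodable, encodable) encodable begin
definition enc_prod :: "'a \<times> 'b \<Rightarrow> nat" where
  "enc_prod p = prod_encode (enc (fst p), enc (snd p))"
instance by standard (auto simp: enc_prod_def prod_eq_iff)
end

instantiation list :: (encodable) encodable begin
definition enc_list :: "'a list \<Rightarrow> nat" where "enc_list xs = list_encode (map enc xs)"
instance by standard (auto simp: enc_list_def list_encode_eq inj_def dest!: map_injective)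
end

instantiation fterm :: encodable begin
definition enc_fterm :: "fterm \<Rightarrow> nat" where "enc_fterm = term_code"
instance by standard (auto simp: enc_fterm_def term_code_inject)
end

instantiation formula :: encodable begin
definition enc_formula :: "formula \<Rightarrow> nat" where "enc_formula = formula_code"
instance by standard (auto simp: enc_formula_def formula_code_inject)
end

instantiation signature :: encodable begin
definition enc_signature :: "signature \<Rightarrow> nat" where "enc_signature = signature_code"
instance
  by standard (auto simp: enc_signature_def signature_code_def list_encode_eq
      intro: signature.expand)
end

text \<open>The realizer is total but constrained on codes only. On other numbers it may return
  anything, so recognizing the valid codes is a separate task.\<close>

definition computable :: "('a::encodable \<Rightarrow> 'b::encodable) \<Rightarrow> bool" where
  "computable f \<longleftrightarrow> (\<exists>F. recursive1 F \<and> (\<forall>x. F (enc x) = enc (f x)))"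

lemma computableI: "recursive1 F \<Longrightarrow> (\<And>x. F (enc x) = enc (f x)) \<Longrightarrow> computable f"
  unfolding computable_def by blast

named_theorems comp

text \<open>Computability sees codes only, so one realizer serves all maps with the same codes. This
  allows changing the result type, for instance between truth values and the numbers 0 and 1, or
  between a list and its code.\<close>

lemma computable_retype:
  assumes "computable f" and "\<And>x. enc (g x) = enc (f x)"
  shows "computable g"
  using assms by (simp add: computable_def)

lemma computable_id [comp]: "computable (\<lambda>x. x)"
  by (rule computableI[OF recursive1_id]) simp

lemma computable_const [comp]: "computable (\<lambda>x. c)"
  by (rule computableI[OF recursive1_const]) simp

lemma computable_comp:
  assumes "computable f" "computable g"
  shows "computable (\<lambda>x. f (g x))"
proof -
  obtain F where F: "recursive1 F" "\<And>x. F (enc x) = enc (f x)"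
    using assms(1) unfolding computable_def by blast
  obtain G where G: "recursive1 G" "\<And>x. G (enc x) = enc (g x)"
    using assms(2) unfolding computable_def by blast
  show ?thesis by (rule computableI[OF recursive1_comp[OF F(1) G(1)]]) (simp add: F G)
qed

lemma computable_nat2:
  assumes "recursive2 f" "computable g" "computable h"
    and "\<And>x. enc (k x) = f (enc (g x)) (enc (h x))"
  shows "computable k"
proof -
  obtain G where G: "recursive1 G" "\<And>x. G (enc x) = enc (g x)"
    using assms(2) unfolding computable_def by blast
  obtain H where H: "recursive1 H" "\<And>x. H (enc x) = enc (h x)"
    using assms(3) unfolding computable_def by blast
  show ?thesis
    by (rule computableI[OF recursive1_comp2[OF assms(1) G(1) H(1)]]) (simp add: assms(4) G H)
qed

lemma computable_Pair [comp]:
  assumes "computable f" "computable g"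
  shows "computable (\<lambda>x. (f x, g x))"
  by (rule computable_nat2[OF recursive2_prod_encode assms]) (simp add: enc_prod_def)

lemma computable_fst [comp]: "computable f \<Longrightarrow> computable (\<lambda>x. fst (f x))"
  by (rule computable_comp[OF computableI[OF recursive1_fst]]) (simp_all add: enc_prod_def)

lemma computable_snd [comp]: "computable f \<Longrightarrow> computable (\<lambda>x. snd (f x))"
  by (rule computable_comp[OF computableI[OF recursive1_snd]]) (simp_all add: enc_prod_def)

lemma computable_comp2:
  assumes "computable (\<lambda>z. f (fst z) (snd z))" "computable g" "computable h"
  shows "computable (\<lambda>x. f (g x) (h x))"
  using computable_comp[OF assms(1) computable_Pair[OF assms(2,3)]] by simp

lemma computable_comp3:
  assumes "computable (\<lambda>z. f (fst z) (fst (snd z)) (snd (snd z)))"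
    "computable g" "computable h" "computable k"
  shows "computable (\<lambda>x. f (g x) (h x) (k x))"
  using computable_comp[OF assms(1) computable_Pair[OF assms(2) computable_Pair[OF assms(3,4)]]]
  by simp

lemma computable_comp4:
  assumes "computable (\<lambda>z. f (fst z) (fst (snd z)) (fst (snd (snd z))) (snd (snd (snd z))))"
    "computable g" "computable h" "computable k" "computable l"
  shows "computable (\<lambda>x. f (g x) (h x) (k x) (l x))"
  using computable_comp[OF assms(1) computable_Pair[OF assms(2)
        computable_Pair[OF assms(3) computable_Pair[OF assms(4,5)]]]]
  by simp

lemma computable_Suc [comp]: "computable f \<Longrightarrow> computable (\<lambda>x. Suc (f x))"
  by (rule computable_comp[OF computableI[OF recursive1_Suc]]) simp_all

lemma computable_add [comp]:
  assumes "computable f" "computable g" shows "computable (\<lambda>x. f x + (g x :: nat))"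
proof (rule computable_nat2[OF _ assms])
  show "recursive2 (+)" unfolding recursive2_def by (intro recursive_add recursive_proj; simp)
qed simp

lemma computable_diff [comp]:
  assumes "computable f" "computable g" shows "computable (\<lambda>x. f x - (g x :: nat))"
proof (rule computable_nat2[OF _ assms])
  show "recursive2 (-)" unfolding recursive2_def by (intro recursive_diff recursive_proj; simp)
qed simp

lemma computable_eq [comp]:
  assumes "computable f" "computable g" shows "computable (\<lambda>x. f x = g x)"
proof (rule computable_nat2[OF _ assms])
  \<comment> \<open>The two truncated differences vanish together only for equal codes, and equal
    codes mean equal values.\<close>
  show "recursive2 (\<lambda>m n. 1 - ((m - n) + (n - m)))" unfolding recursive2_def
    by (intro recursive_diff recursive_proj recursive_add recursive_const; simp)
  show "enc (f x = g x) = 1 - ((enc (f x) - enc (g x)) + (enc (g x) - enc (f x)))" for x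
  proof (cases "f x = g x")
    case False
    then have "enc (f x) \<noteq> enc (g x)" by simp
    then have "1 - ((enc (f x) - enc (g x)) + (enc (g x) - enc (f x))) = 0" by linarith
    then show ?thesis using False by (simp add: enc_bool_def)
  qed (simp add: enc_bool_def)
qed

lemma computable_less [comp]:
  assumes "computable f" "computable g" shows "computable (\<lambda>x. f x < (g x :: nat))"
proof (rule computable_nat2[OF _ assms])
  show "recursive2 (\<lambda>m n. 1 - (Suc m - n))" unfolding recursive2_def
    by (intro recursive_diff recursive_proj recursive_Suc recursive_const; simp)
qed (auto simp: enc_bool_def)

lemma computable_le [comp]:
  "computable f \<Longrightarrow> computable g \<Longrightarrow> computable (\<lambda>x. f x \<le> (g x :: nat))"
  unfolding less_Suc_eq_le[symmetric] by (intro comp)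

lemma computable_rec_nat [comp]:
  assumes "computable f" "computable (\<lambda>z. g (fst z) (fst (snd z)) (snd (snd z)))" "computable n"
  shows "computable (\<lambda>x. rec_nat (f x) (\<lambda>k y. g x k y) (n x))"
proof -
  obtain F where F: "recursive1 F" "\<And>x. F (enc x) = enc (f x)"
    using assms(1) unfolding computable_def by blast
  obtain G where G: "recursive1 G" "\<And>z. G (enc z) = enc (g (fst z) (fst (snd z)) (snd (snd z)))"
    using assms(2) unfolding computable_def by blast
  obtain N where N: "recursive1 N" "\<And>x. N (enc x) = enc (n x)"
    using assms(3) unfolding computable_def by blast
  have G': "G (prod_encode (enc x, prod_encode (k, enc y))) = enc (g x k y)" for x k y
    using G(2)[of "(x, k, y)"] by (simp add: enc_prod_def)
  have "rec_nat (F (enc x)) (\<lambda>k y. G (prod_encode (enc x, prod_encode (k, y)))) m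
    = enc (rec_nat (f x) (g x) m)" for x m
    by (induction m) (auto simp: F G')
  then show ?thesis
    by (intro computableI[OF recursive1_rec_nat[OF F(1) G(1) N(1)]]) (simp add: N)
qed

lemma computable_of_bool: "computable b \<Longrightarrow> computable (\<lambda>x. of_bool (b x) :: nat)"
  by (erule computable_retype) (simp add: enc_bool_def)

lemma computable_If [comp]:
  assumes "computable b" "computable f" "computable g"
  shows "computable (\<lambda>x. if b x then f x else g x)"
proof -
  have "computable (\<lambda>x. rec_nat (g x) (\<lambda>_ _. f x) (of_bool (b x)))"
    by (intro comp computable_of_bool assms computable_comp[OF assms(2)])
  moreover have "rec_nat (g x) (\<lambda>_ _. f x) (of_bool (b x)) = (if b x then f x else g x)" for x
    by simp
  ultimately show ?thesis by simp
qed

lemma computable_conj [comp]: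
  assumes "computable a" "computable b" shows "computable (\<lambda>x. a x \<and> b x)"
proof -
  have "computable (\<lambda>x. if a x then b x else False)" by (intro comp assms)
  moreover have "(if a x then b x else False) = (a x \<and> b x)" for x by simp
  ultimately show ?thesis by (simp only:)
qed

lemma computable_not [comp]:
  assumes "computable a" shows "computable (\<lambda>x. \<not> a x)"
proof -
  have "computable (\<lambda>x. if a x then False else True)" by (intro comp assms)
  moreover have "(if a x then False else True) = (\<not> a x)" for x by simp
  ultimately show ?thesis by (simp only:)
qed

lemma computable_disj [comp]:
  assumes "computable a" "computable b" shows "computable (\<lambda>x. a x \<or> b x)"
proof -
  have "computable (\<lambda>x. if a x then True else b x)" by (intro comp assms)
  moreover have "(if a x then True else b x) = (a x \<or> b x)" for x by simp
  ultimately show ?thesis by (simp only:)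
qed

lemma computable_imp [comp]:
  assumes "computable a" "computable b" shows "computable (\<lambda>x. a x \<longrightarrow> b x)"
  unfolding imp_conv_disj by (intro comp assms)

lemma computable_case_nat [comp]:
  assumes "computable f" "computable (\<lambda>z. g (fst z) (snd z))" "computable n"
  shows "computable (\<lambda>x. case n x of 0 \<Rightarrow> f x | Suc k \<Rightarrow> g x k)"
proof -
  have "computable (\<lambda>x. rec_nat (f x) (\<lambda>k _. g x k) (n x))"
    by (intro comp computable_comp2[OF assms(2)] assms)
  moreover have "rec_nat (f x) (\<lambda>k _. g x k) m = (case m of 0 \<Rightarrow> f x | Suc k \<Rightarrow> g x k)" for x m
    by (cases m) auto
  ultimately show ?thesis by simp
qed

lemma computable_times [comp]:
  assumes "computable f" "computable g" shows "computable (\<lambda>x. f x * (g x :: nat))"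
proof -
  have "computable (\<lambda>x. rec_nat 0 (\<lambda>_ y. y + g x) (f x))"
    by (intro comp computable_comp[OF assms(2)] assms)
  moreover have "rec_nat 0 (\<lambda>_ y. y + m) n = n * m" for m n :: nat by (induction n) auto
  ultimately show ?thesis by simp
qed

lemma computable_power [comp]:
  assumes "computable f" "computable g" shows "computable (\<lambda>x. f x ^ g x :: nat)"
proof -
  have "computable (\<lambda>x. rec_nat 1 (\<lambda>_ y. f x * y) (g x))"
    by (intro comp computable_comp[OF assms(1)] assms)
  moreover have "rec_nat 1 (\<lambda>_ y. m * y) n = m ^ n" for m n :: nat by (induction n) auto
  ultimately show ?thesis by simp
qed

lemma computable_all_less [comp]:
  fixes n :: "'a::encodable \<Rightarrow> nat"
  assumes "computable (\<lambda>z. P (fst z) (snd z))" "computable n"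
  shows "computable (\<lambda>x. \<forall>i < n x. P x i)"
proof -
  have "computable (\<lambda>x. rec_nat True (\<lambda>i b. P x i \<and> b) (n x))"
    by (intro comp computable_comp2[OF assms(1)] assms)
  moreover have "rec_nat True (\<lambda>i b. P x i \<and> b) m = (\<forall>i<m. P x i)" for x m
    by (induction m) (auto simp: less_Suc_eq)
  ultimately show ?thesis by simp
qed

lemma computable_ex_less [comp]:
  fixes n :: "'a::encodable \<Rightarrow> nat"
  assumes "computable (\<lambda>z. P (fst z) (snd z))" "computable n"
  shows "computable (\<lambda>x. \<exists>i < n x. P x i)"
  using computable_not[OF computable_all_less[OF computable_not[OF assms(1)] assms(2)]] by simp

subsection \<open>Lists\<close>

lemma enc_Nil [simp]: "enc [] = 0"
  by (simp add: enc_list_def)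

lemma enc_Cons [simp]: "enc (x # xs) = Suc (prod_encode (enc x, enc xs))"
  by (simp add: enc_list_def)

lemma length_le_enc: "length xs \<le> enc xs"
proof (induction xs)
  case (Cons x xs)
  then show ?case using le_prod_encode_2[of "enc xs" "enc x"] by simp
qed simp

lemma computable_enc [comp]: "computable f \<Longrightarrow> computable (\<lambda>x. enc (f x))"
  by (erule computable_retype) simp

lemma computable_Cons [comp]:
  assumes "computable f" "computable g" shows "computable (\<lambda>x. f x # g x)"
proof (rule computable_nat2[OF _ assms])
  show "recursive2 (\<lambda>m n. Suc (prod_encode (m, n)))" unfolding recursive2_def
    by (intro recursive_Suc recursive_prod_encode recursive_proj; simp)
qed simp

lemma computable_tl [comp]:
  assumes "computable f" shows "computable (\<lambda>x. tl (f x))"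
proof -
  have "recursive1 (\<lambda>n. snd (prod_decode (n - 1)))"
    by (rule recursive1_comp[OF recursive1_snd recursive1_pred])
  \<comment> \<open>The empty list needs no case distinction: its code 0 is its own predecessor and
    decodes to a pair of zeros, which gives the code of \<open>tl []\<close>.\<close>
  moreover have "snd (prod_decode 0) = 0" by (simp add: prod_decode_def prod_decode_aux.simps)
  then have "snd (prod_decode (enc xs - 1)) = enc (tl xs)" for xs :: "'b list"
    by (cases xs) auto
  ultimately have "computable (tl :: 'b list \<Rightarrow> 'b list)" by (rule computableI)
  then show ?thesis using assms by (rule computable_comp)
qed

text \<open>A list code is 0 or the successor of a pair code. Case analysis is therefore recursion
  on the code whose last step sees the pair in the counter and discards the accumulator;
  \<open>G2\<close> does the discarding.\<close>

lemma computable_case_list [comp]: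
  assumes "computable f" "computable (\<lambda>z. g (fst z) (fst (snd z)) (snd (snd z)))" "computable l"
  shows "computable (\<lambda>x. case l x of [] \<Rightarrow> f x | y # ys \<Rightarrow> g x y ys)"
proof -
  obtain F where F: "recursive1 F" "\<And>x. F (enc x) = enc (f x)"
    using assms(1) unfolding computable_def by blast
  obtain G where G: "recursive1 G" "\<And>z. G (enc z) = enc (g (fst z) (fst (snd z)) (snd (snd z)))"
    using assms(2) unfolding computable_def by blast
  obtain L where L: "recursive1 L" "\<And>x. L (enc x) = enc (l x)"
    using assms(3) unfolding computable_def by blast
  have G': "G (prod_encode (enc x, prod_encode (enc y, enc ys))) = enc (g x y ys)" for x y ys
    using G(2)[of "(x, y, ys)"] by (simp add: enc_prod_def)
  define G2 where
    "G2 n = G (prod_encode (fst (prod_decode n), fst (prod_decode (snd (prod_decode n)))))" for n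
  have G2: "recursive1 G2" unfolding G2_def
    by (rule recursive1_comp[OF G(1) recursive1_comp2[OF recursive2_prod_encode recursive1_fst
            recursive1_comp[OF recursive1_fst recursive1_snd]]])
  show ?thesis
    by (rule computableI[OF recursive1_rec_nat[OF F(1) G2 L(1)]])
      (auto simp: L F G2_def G' split: list.split)
qed

lemma computable_drop [comp]:
  assumes "computable n" "computable l" shows "computable (\<lambda>x. drop (n x) (l x))"
proof -
  have "computable (\<lambda>x. rec_nat (l x) (\<lambda>_ r. tl r) (n x))"
    by (intro comp assms)
  moreover have "rec_nat xs (\<lambda>_ r. tl r) m = drop m xs" for m and xs :: "'b list"
    by (induction m) (auto simp: drop_Suc tl_drop)
  ultimately show ?thesis by simp
qed

text \<open>The counter walks through the suffixes of the list from the end. Any upper bound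
  \<open>N\<close> of the length will do, because suffixes taken beyond the end are empty and leave
  the accumulator alone.\<close>

lemma rec_list_eq_rec_nat:
  assumes "length l \<le> N"
  shows "rec_nat f (\<lambda>k r. case drop (N - Suc k) l of [] \<Rightarrow> r | y # ys \<Rightarrow> g y ys r) N = rec_list f g l"
proof -
  have "rec_nat f (\<lambda>k r. case drop (N - Suc k) l of [] \<Rightarrow> r | y # ys \<Rightarrow> g y ys r) k
      = rec_list f g (drop (N - k) l)" if "k \<le> N" for k
    using that
  proof (induction k)
    case 0
    then show ?case using assms by simp
  next
    case (Suc k)
    then have "drop (N - k) l = tl (drop (N - Suc k) l)"
      by (metis Suc_diff_Suc Suc_le_lessD drop_Suc tl_drop)
    with Suc show ?case by (cases "drop (N - Suc k) l") auto
  qed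
  then show ?thesis by simp
qed

lemma computable_rec_list [comp]:
  assumes "computable f"
    and g: "computable (\<lambda>z. g (fst z) (fst (snd z)) (fst (snd (snd z))) (snd (snd (snd z))))"
    and "computable l"
  shows "computable (\<lambda>x. rec_list (f x) (\<lambda>y ys r. g x y ys r) (l x))"
proof -
  \<comment> \<open>The code of the list serves as the bound, since \<open>length\<close> is itself
    obtained from this recursion only later.\<close>
  have "computable (\<lambda>x. rec_nat (f x)
      (\<lambda>k r. case drop (enc (l x) - Suc k) (l x) of [] \<Rightarrow> r | y # ys \<Rightarrow> g x y ys r) (enc (l x)))"
    by (intro comp assms computable_comp4[OF g] computable_comp[OF assms(3)])
  then show ?thesis by (simp add: rec_list_eq_rec_nat length_le_enc)
qed

lemma computable_map [comp]:
  assumes "computable (\<lambda>z. h (fst z) (snd z))" "computable l"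
  shows "computable (\<lambda>x. map (\<lambda>y. h x y) (l x))"
proof -
  have "computable (\<lambda>x. rec_list [] (\<lambda>y _ r. h x y # r) (l x))"
    by (intro comp computable_comp2[OF assms(1)] assms)
  moreover have "rec_list [] (\<lambda>y _ r. h x y # r) ys = map (h x) ys" for x ys
    by (induction ys) auto
  ultimately show ?thesis by simp
qed

lemma computable_append [comp]:
  assumes "computable f" "computable g" shows "computable (\<lambda>x. f x @ g x)"
proof -
  have "computable (\<lambda>x. rec_list (g x) (\<lambda>y _ r. y # r) (f x))" by (intro comp assms)
  moreover have "rec_list ys (\<lambda>y _ r. y # r) xs = xs @ ys" for xs ys :: "'b list"
    by (induction xs) auto
  ultimately show ?thesis by simp
qed

lemma computable_concat [comp]:
  assumes "computable f" shows "computable (\<lambda>x. concat (f x))"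
proof -
  have "computable (\<lambda>x. rec_list [] (\<lambda>y _ r. y @ r) (f x))" by (intro comp assms)
  moreover have "rec_list [] (\<lambda>y _ r. y @ r) xs = concat xs" for xs :: "'b list list"
    by (induction xs) auto
  ultimately show ?thesis by simp
qed

lemma computable_rev [comp]:
  assumes "computable f" shows "computable (\<lambda>x. rev (f x))"
proof -
  have "computable (\<lambda>x. rec_list [] (\<lambda>y _ r. r @ [y]) (f x))" by (intro comp assms)
  moreover have "rec_list [] (\<lambda>y _ r. r @ [y]) xs = rev xs" for xs :: "'b list"
    by (induction xs) auto
  ultimately show ?thesis by simp
qed

lemma computable_length [comp]:
  assumes "computable f" shows "computable (\<lambda>x. length (f x))"
proof -
  have "computable (\<lambda>x. rec_list 0 (\<lambda>_ _ r. Suc r) (f x))" by (intro comp assms)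
  moreover have "rec_list 0 (\<lambda>_ _ r. Suc r) xs = length xs" for xs :: "'b list"
    by (induction xs) auto
  ultimately show ?thesis by simp
qed

lemma computable_sum_list [comp]:
  assumes "computable f" shows "computable (\<lambda>x. sum_list (f x) :: nat)"
proof -
  have "computable (\<lambda>x. rec_list 0 (\<lambda>y _ r. y + r) (f x))" by (intro comp assms)
  moreover have "rec_list 0 (\<lambda>y _ r. y + r) xs = sum_list xs" for xs :: "nat list"
    by (induction xs) auto
  ultimately show ?thesis by simp
qed

lemma computable_ball_set [comp]:
  assumes "computable (\<lambda>z. P (fst z) (snd z))" "computable l"
  shows "computable (\<lambda>x. \<forall>y \<in> set (l x). P x y)"
proof -
  have "computable (\<lambda>x. rec_list True (\<lambda>y _ r. P x y \<and> r) (l x))"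
    by (intro comp computable_comp2[OF assms(1)] assms)
  moreover have "rec_list True (\<lambda>y _ r. P x y \<and> r) ys = (\<forall>y \<in> set ys. P x y)" for x ys
    by (induction ys) auto
  ultimately show ?thesis by simp
qed

lemma computable_bex_set [comp]:
  assumes "computable (\<lambda>z. P (fst z) (snd z))" "computable l"
  shows "computable (\<lambda>x. \<exists>y \<in> set (l x). P x y)"
  using computable_not[OF computable_ball_set[OF computable_not[OF assms(1)] assms(2)]] by simp

lemma computable_member [comp]:
  assumes "computable f" "computable l" shows "computable (\<lambda>x. f x \<in> set (l x))"
proof -
  have "computable (\<lambda>x. \<exists>y \<in> set (l x). f x = y)"
    by (intro comp assms computable_comp[OF assms(1)])
  then show ?thesis by simp
qed

lemma computable_upt [comp]:
  assumes "computable n" shows "computable (\<lambda>x. [0..<n x])"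
proof -
  have "computable (\<lambda>x. rec_nat [] (\<lambda>k r. r @ [k]) (n x))" by (intro comp assms)
  moreover have "rec_nat [] (\<lambda>k r. r @ [k]) m = [0..<m]" for m
    by (induction m) auto
  ultimately show ?thesis by simp
qed

lemma computable_nth_default [comp]:
  assumes "computable d" "computable l" "computable n"
  shows "computable (\<lambda>x. nth_default (d x) (l x) (n x))"
proof -
  have "computable (\<lambda>x. case drop (n x) (l x) of [] \<Rightarrow> d x | y # ys \<Rightarrow> y)"
    by (intro comp assms)
  moreover have "(case drop m ys of [] \<Rightarrow> e | y # _ \<Rightarrow> y) = nth_default e ys m" for m e and ys :: "'b list"
    by (cases "m < length ys")
      (auto simp: nth_default_nth nth_default_beyond Cons_nth_drop_Suc[symmetric])
  ultimately show ?thesis by simp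
qed

lemma computable_take [comp]:
  assumes "computable n" "computable l" shows "computable (\<lambda>x. take (n x) (l x))"
proof -
  have "computable (\<lambda>x. rev (drop (length (l x) - n x) (rev (l x))))"
    by (intro comp assms)
  moreover have "rev (drop (length xs - m) (rev xs)) = take m xs" for m and xs :: "'b list"
    by (cases "m \<le> length xs") (auto simp: rev_drop)
  ultimately show ?thesis by simp
qed

lemma computable_foldl [comp]:
  assumes "computable a" and g: "computable (\<lambda>z. g (fst z) (fst (snd z)) (snd (snd z)))"
    and "computable l"
  shows "computable (\<lambda>x. foldl (\<lambda>r y. g x r y) (a x) (l x))"
proof -
  have "computable (\<lambda>x. rec_list (a x) (\<lambda>y _ r. g x r y) (rev (l x)))"
    by (intro comp assms computable_comp3[OF g])
  moreover have "rec_list r (\<lambda>y _ r. g x r y) (rev ys) = foldl (g x) r ys" for x r ys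
    by (induction ys rule: rev_induct) auto
  ultimately show ?thesis by simp
qed

lemma computable_subseqs [comp]:
  assumes "computable f" shows "computable (\<lambda>x. subseqs (f x))"
proof -
  have "computable (\<lambda>x. rec_list [[]] (\<lambda>y _ r. map (\<lambda>ys. y # ys) r @ r) (f x))"
    by (intro comp assms)
  moreover have "rec_list [[]] (\<lambda>y _ r. map (\<lambda>ys. y # ys) r @ r) xs = subseqs xs" for xs :: "'b list"
    by (induction xs) (auto simp: Let_def)
  ultimately show ?thesis by simp
qed

lemma computable_n_lists [comp]:
  assumes "computable n" "computable l" shows "computable (\<lambda>x. List.n_lists (n x) (l x))"
proof -
  have "computable (\<lambda>x. rec_nat [[]] (\<lambda>_ r. concat (map (\<lambda>ys. map (\<lambda>y. y # ys) (l x)) r)) (n x))"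
    by (intro comp assms computable_comp[OF assms(2)])
  moreover have "rec_nat [[]] (\<lambda>_ r. concat (map (\<lambda>ys. map (\<lambda>y. y # ys) xs) r)) m = List.n_lists m xs"
    for m and xs :: "'b list"
    by (induction m) auto
  ultimately show ?thesis by simp
qed

subsection \<open>Terms and formulas\<close>

text \<open>Recursion on terms and formulas refers to codes that are smaller, but not by one. The
  auxiliary recursion \<open>H\<close> therefore collects all earlier values in a list.\<close>

lemma computable_course_of_values:
  assumes step: "computable (\<lambda>z. step (fst z) (fst (snd z)) (snd (snd z)))"
  shows "\<exists>E. computable (\<lambda>z. E (fst z) (snd z)) \<and> (\<forall>p n. E p n = step p n (map (E p) [0..<n]))"
proof -
  define H where "H p n = rec_nat [] (\<lambda>k r. r @ [step p k r]) n" for p n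
  define E where "E p n = step p n (H p n)" for p n
  have "computable (\<lambda>z. E (fst z) (snd z))" unfolding E_def H_def
    by (intro comp computable_comp3[OF step])
  moreover have "H p n = map (E p) [0..<n]" for p n
    by (induction n) (simp_all add: H_def E_def)
  then have "E p n = step p n (map (E p) [0..<n])" for p n unfolding E_def[of p n] by simp
  ultimately show ?thesis by blast
qed

lemma computable_prod_decode [comp]: "computable f \<Longrightarrow> computable (\<lambda>x. prod_decode (f x))"
  by (erule computable_retype) (simp add: enc_prod_def)

lemma computable_prod_encode [comp]: "computable f \<Longrightarrow> computable (\<lambda>x. prod_encode (f x))"
  by (erule computable_retype) (simp add: enc_prod_def)

lemma computable_list_decode [comp]: "computable f \<Longrightarrow> computable (\<lambda>x. list_decode (f x))"
  by (erule computable_retype) (simp add: enc_list_def map_idI)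

lemma enc_Cell [simp]: "enc (Cell c) = prod_encode (0, c)"
  by (simp add: enc_fterm_def)

lemma enc_FApp [simp]: "enc (FApp f ts) = prod_encode (Suc f, enc ts)"
  by (simp add: enc_fterm_def enc_list_def cong: map_cong)

lemma prod_encode_Suc_gt: "b < prod_encode (Suc a, b)"
  using le_prod_encode_2[of b 0] by (simp add: prod_encode_def)

lemma mem_less_list_encode: "m \<in> set ms \<Longrightarrow> m < list_encode ms"
proof (induction ms)
  case (Cons a ms)
  then show ?case
    using le_prod_encode_1[of a "list_encode ms"] le_prod_encode_2[of "list_encode ms" a] by auto
qed simp

text \<open>Tag 0 always gives a cell, and a positive tag an application to arguments with smaller
  codes. Hence decoding of terms is total, and a search through all numbers is a search through all
  certificates built from terms.\<close>

lemma surj_enc_fterm: "surj (enc :: fterm \<Rightarrow> nat)"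
proof -
  have "\<exists>t::fterm. enc t = n" for n
  proof (induction n rule: less_induct)
    case (less n)
    obtain a b where n: "n = prod_encode (a, b)" by (metis prod.exhaust prod_decode_inverse)
    show ?case
    proof (cases a)
      case 0
      then show ?thesis using n by (metis enc_Cell)
    next
      case (Suc f)
      have "\<exists>t::fterm. enc t = m" if "m \<in> set (list_decode b)" for m
        using less mem_less_list_encode[OF that] prod_encode_Suc_gt[of b f] n Suc by simp
      then obtain g where "\<And>m. m \<in> set (list_decode b) \<Longrightarrow> enc (g m :: fterm) = m" by metis
      then have "enc (map g (list_decode b)) = b"
        by (simp add: enc_list_def map_idI cong: map_cong)
      then show ?thesis using n Suc by (metis enc_FApp)
    qed
  qed
  then show ?thesis by (metis surjI)
qed

definition dec_term :: "nat \<Rightarrow> fterm" where "dec_term = inv enc"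

lemma enc_dec_term [simp]: "enc (dec_term n) = n"
  by (simp add: dec_term_def surj_enc_fterm surj_f_inv_f)

lemma dec_term_enc [simp]: "dec_term (enc t) = t"
  by (metis enc_dec_term enc_inject)

lemma computable_dec_term [comp]: "computable f \<Longrightarrow> computable (\<lambda>x. dec_term (f x))"
  by (erule computable_retype) simp

lemma computable_Cell [comp]: "computable f \<Longrightarrow> computable (\<lambda>x. Cell (f x))"
proof -
  assume "computable f"
  then have "computable (\<lambda>x. (0::nat, f x))" by (intro comp)
  then show ?thesis by (rule computable_retype) (simp add: enc_prod_def)
qed

lemma computable_FApp [comp]:
  assumes "computable f" "computable g" shows "computable (\<lambda>x. FApp (f x) (g x))"
proof -
  have "computable (\<lambda>x. (Suc (f x), g x))" by (intro comp assms)
  then show ?thesis by (rule computable_retype) (simp add: enc_prod_def)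
qed

lemma list_decode_enc: "list_decode (enc xs) = map enc xs"
  by (simp add: enc_list_def)

text \<open>Codes of arguments are smaller than the code of the application, so their values are
  already in the table of the course-of-values recursion. The default \<open>g p 0\<close> only
  makes the table access total.\<close>

lemma computable_fterm_rec:
  assumes F: "\<And>p c. F p (Cell c) = g p c"
    "\<And>p f ts. F p (FApp f ts) = h p f ts (map (F p) ts)"
  assumes g: "computable (\<lambda>z. g (fst z) (snd z))"
    and h: "computable (\<lambda>z. h (fst z) (fst (snd z)) (fst (snd (snd z))) (snd (snd (snd z))))"
  assumes "computable p" "computable t"
  shows "computable (\<lambda>x. F (p x) (t x))"
proof -
  define step where "step p n r = (case fst (prod_decode n) of 0 \<Rightarrow> g p (snd (prod_decode n))
    | Suc f \<Rightarrow> h p f (map dec_term (list_decode (snd (prod_decode n))))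
        (map (\<lambda>m. nth_default (g p 0) r m) (list_decode (snd (prod_decode n)))))" for p n r
  have "computable (\<lambda>z. step (fst z) (fst (snd z)) (snd (snd z)))" unfolding step_def
    by (intro comp computable_comp2[OF g] computable_comp4[OF h])
  then obtain E where E: "computable (\<lambda>z. E (fst z) (snd z))"
    "\<And>p n. E p n = step p n (map (E p) [0..<n])"
    using computable_course_of_values by blast
  have EF: "E p (enc t) = F p t" for p t
  proof (induction t)
    case (Cell c)
    then show ?case by (simp add: E(2)[of p "prod_encode (0, c)"] step_def F)
  next
    case (FApp f ts)
    let ?n = "prod_encode (Suc f, enc ts)"
    have "nth_default (g p 0) (map (E p) [0..<?n]) (enc t) = F p t" if "t \<in> set ts" for t
    proof -
      have "enc t < ?n"
        using that mem_less_list_encode[of "enc t" "map enc ts"] prod_encode_Suc_gt[of "enc ts" f]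
        by (simp add: enc_list_def)
      then show ?thesis using FApp that by (simp add: nth_default_nth)
    qed
    then have "map (\<lambda>m. nth_default (g p 0) (map (E p) [0..<?n]) m) (list_decode (enc ts)) = map (F p) ts"
      by (simp add: list_decode_enc)
    moreover have "map dec_term (list_decode (enc ts)) = ts"
      by (simp add: list_decode_enc map_idI)
    ultimately show ?case by (simp add: E(2)[of p ?n] step_def F)
  qed
  have "computable (\<lambda>x. E (p x) (enc (t x)))"
    by (intro computable_comp2[OF E(1)] comp assms)
  then show ?thesis by (simp add: EF)
qed

lemma enc_formula_simps:
  "enc TrueF = prod_encode (0, 0)"
  "enc (Neg \<phi>) = prod_encode (1, enc \<phi>)"
  "enc (Conj \<phi> \<psi>) = prod_encode (2, prod_encode (enc \<phi>, enc \<psi>))"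
  "enc (Next \<phi>) = prod_encode (3, enc \<phi>)"
  "enc (Until \<phi> \<psi>) = prod_encode (4, prod_encode (enc \<phi>, enc \<psi>))"
  "enc (Pred p ts) = prod_encode (5, prod_encode (p, enc ts))"
  "enc (Update c \<tau>) = prod_encode (6, prod_encode (c, enc \<tau>))"
  by (simp_all add: enc_formula_def enc_list_def enc_fterm_def cong: map_cong)

lemma prod_encode_pos_gt: "0 < a \<Longrightarrow> b < prod_encode (a, b)"
  using prod_encode_Suc_gt[of b "a - 1"] by simp

lemma prod_encode_pos_gt2:
  assumes "0 < a" shows "b < prod_encode (a, prod_encode (b, c))" "c < prod_encode (a, prod_encode (b, c))"
  using prod_encode_pos_gt[OF assms, of "prod_encode (b, c)"] le_prod_encode_1[of b c]
    le_prod_encode_2[of c b] by linarith+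

text \<open>The Boolean component says whether the number is the code of a formula.\<close>

lemma formula_table:
  fixes F :: "'p::encodable \<Rightarrow> formula \<Rightarrow> 'b::encodable"
  assumes F: "\<And>p. F p TrueF = fT p"
    "\<And>p \<phi>. F p (Neg \<phi>) = fN p (F p \<phi>)"
    "\<And>p \<phi> \<psi>. F p (Conj \<phi> \<psi>) = fC p (F p \<phi>) (F p \<psi>)"
    "\<And>p \<phi>. F p (Next \<phi>) = fX p (F p \<phi>)"
    "\<And>p \<phi> \<psi>. F p (Until \<phi> \<psi>) = fU p (F p \<phi>) (F p \<psi>)"
    "\<And>p q ts. F p (Pred q ts) = fP p q ts"
    "\<And>p c \<tau>. F p (Update c \<tau>) = fA p c \<tau>"
  assumes T: "computable fT"
    and N: "computable (\<lambda>z. fN (fst z) (snd z))"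
    and C: "computable (\<lambda>z. fC (fst z) (fst (snd z)) (snd (snd z)))"
    and X: "computable (\<lambda>z. fX (fst z) (snd z))"
    and U: "computable (\<lambda>z. fU (fst z) (fst (snd z)) (snd (snd z)))"
    and P: "computable (\<lambda>z. fP (fst z) (fst (snd z)) (snd (snd z)))"
    and A: "computable (\<lambda>z. fA (fst z) (fst (snd z)) (snd (snd z)))"
  shows "\<exists>E. computable (\<lambda>z. E (fst z) (snd z)) \<and> (\<forall>p \<phi>. E p (enc \<phi>) = (True, F p \<phi>)) \<and>
    (\<forall>p n. fst (E p n) \<longrightarrow> n \<in> range (enc :: formula \<Rightarrow> nat))"
proof -
  define L :: "'p \<Rightarrow> nat \<Rightarrow> (bool \<times> 'b) list \<Rightarrow> bool \<times> 'b"
    where "L p m r = nth_default (False, fT p) r m" for p m r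
  define step :: "'p \<Rightarrow> nat \<Rightarrow> (bool \<times> 'b) list \<Rightarrow> bool \<times> 'b"
    where "step p n r = (let a = fst (prod_decode n); b = snd (prod_decode n);
      b1 = fst (prod_decode b); b2 = snd (prod_decode b) in
    if a = 0 then (b = 0, fT p)
    else if a = 1 then (fst (L p b r), fN p (snd (L p b r)))
    else if a = 2 then (fst (L p b1 r) \<and> fst (L p b2 r), fC p (snd (L p b1 r)) (snd (L p b2 r)))
    else if a = 3 then (fst (L p b r), fX p (snd (L p b r)))
    else if a = 4 then (fst (L p b1 r) \<and> fst (L p b2 r), fU p (snd (L p b1 r)) (snd (L p b2 r)))
    else if a = 5 then (True, fP p b1 (map dec_term (list_decode b2)))
    else if a = 6 then (True, fA p b1 (dec_term b2))
    else (False, fT p))" for p n r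
  have L: "computable (\<lambda>z. L (fst z) (fst (snd z)) (snd (snd z)))" unfolding L_def
    by (intro comp computable_comp[OF T])
  have "computable (\<lambda>z. step (fst z) (fst (snd z)) (snd (snd z)))" unfolding step_def Let_def
    by (intro comp computable_comp3[OF L] computable_comp[OF T] computable_comp2[OF N]
        computable_comp3[OF C] computable_comp2[OF X] computable_comp3[OF U] computable_comp3[OF P]
        computable_comp3[OF A])
  then obtain E where E: "computable (\<lambda>z. E (fst z) (snd z))"
    "\<And>p n. E p n = step p n (map (E p) [0..<n])"
    using computable_course_of_values by blast
  have L': "L p m (map (E p) [0..<n]) = E p m" if "m < n" for p m n
    using that by (simp add: L_def nth_default_nth)
  have terms: "map dec_term (list_decode (enc ts)) = ts" for ts :: "fterm list"
    by (simp add: list_decode_enc map_idI)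
  have EF: "E p (enc \<phi>) = (True, F p \<phi>)" for p \<phi>
    by (induction \<phi>; subst E(2))
      (simp_all add: step_def enc_formula_simps Let_def F L' prod_encode_pos_gt prod_encode_pos_gt2 terms
        del: One_nat_def)
  have "fst (E p n) \<longrightarrow> n \<in> range (enc :: formula \<Rightarrow> nat)" for p n
  proof (induction n rule: less_induct)
    case (less n)
    obtain a b where n: "n = prod_encode (a, b)" by (metis prod.exhaust prod_decode_inverse)
    obtain b1 b2 where b: "b = prod_encode (b1, b2)" by (metis prod.exhaust prod_decode_inverse)
    have IH: "\<exists>\<phi> :: formula. m = enc \<phi>" if "m < n" "fst (E p m)" for m using less that by auto
    show ?case
    proof
      assume v: "fst (E p n)"
      then have v: "fst (step p n (map (E p) [0..<n]))" by (subst (asm) E(2))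
      have "\<exists>\<phi> :: formula. n = enc \<phi>"
      \<comment> \<open>These are the tags without recursive references; those above 6 are ruled out
        by the flag.\<close>
      proof (cases "a = 0 \<or> 5 \<le> a")
        case True
        have "enc (map dec_term (list_decode b2)) = b2"
          by (simp add: enc_list_def map_idI comp_def)
        with v n b True have "n = enc TrueF \<or> n = enc (Pred b1 (map dec_term (list_decode b2))) \<or>
            n = enc (Update b1 (dec_term b2))"
          by (auto simp: step_def enc_formula_simps Let_def split: if_splits)
        then show ?thesis by blast
      next
        case False
        then have a: "0 < a" and "a = 1 \<or> a = 2 \<or> a = 3 \<or> a = 4" by auto
        then consider "a = 1 \<or> a = 3" | "a = 2 \<or> a = 4" by blast
        then show ?thesis
        proof cases
          case 1
          have lt: "b < n" using n prod_encode_pos_gt[OF a] by simp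
          with v n 1 have "fst (E p b)" by (auto simp: step_def L')
          then obtain \<phi> :: formula where "b = enc \<phi>" using IH lt by blast
          then have "n = enc (Neg \<phi>) \<or> n = enc (Next \<phi>)" using n 1 by (auto simp: enc_formula_simps)
          then show ?thesis by blast
        next
          case 2
          have lt: "b1 < n" "b2 < n" using n b prod_encode_pos_gt2[OF a] by simp_all
          with v n 2 have "fst (E p b1)" "fst (E p b2)" by (auto simp: step_def L' b)
          then obtain \<phi> \<psi> :: formula where "b1 = enc \<phi>" "b2 = enc \<psi>" using IH lt by blast
          then have "n = enc (Conj \<phi> \<psi>) \<or> n = enc (Until \<phi> \<psi>)"
            using n b 2 by (auto simp: enc_formula_simps)
          then show ?thesis by blast
        qed
      qed
      then show "n \<in> range (enc :: formula \<Rightarrow> nat)" by auto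
    qed
  qed
  with E(1) EF show ?thesis by blast
qed

lemma computable_formula_rec:
  fixes F :: "'p::encodable \<Rightarrow> formula \<Rightarrow> 'b::encodable"
  assumes F: "\<And>p. F p TrueF = fT p"
    "\<And>p \<phi>. F p (Neg \<phi>) = fN p (F p \<phi>)"
    "\<And>p \<phi> \<psi>. F p (Conj \<phi> \<psi>) = fC p (F p \<phi>) (F p \<psi>)"
    "\<And>p \<phi>. F p (Next \<phi>) = fX p (F p \<phi>)"
    "\<And>p \<phi> \<psi>. F p (Until \<phi> \<psi>) = fU p (F p \<phi>) (F p \<psi>)"
    "\<And>p q ts. F p (Pred q ts) = fP p q ts"
    "\<And>p c \<tau>. F p (Update c \<tau>) = fA p c \<tau>"
  assumes comp: "computable fT"
    "computable (\<lambda>z. fN (fst z) (snd z))"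
    "computable (\<lambda>z. fC (fst z) (fst (snd z)) (snd (snd z)))"
    "computable (\<lambda>z. fX (fst z) (snd z))"
    "computable (\<lambda>z. fU (fst z) (fst (snd z)) (snd (snd z)))"
    "computable (\<lambda>z. fP (fst z) (fst (snd z)) (snd (snd z)))"
    "computable (\<lambda>z. fA (fst z) (fst (snd z)) (snd (snd z)))"
  assumes p: "computable p" and f: "computable f"
  shows "computable (\<lambda>x. F (p x) (f x))"
proof -
  obtain E where E: "computable (\<lambda>z. E (fst z) (snd z))" "\<And>p \<phi>. E p (enc \<phi>) = (True, F p \<phi>)"
    using formula_table[OF F comp] by blast
  have "computable (\<lambda>x. snd (E (p x) (enc (f x))))"
    by (intro computable_comp2[OF E(1)] computable_snd computable_enc p f)
  then show ?thesis by (simp add: E(2))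
qed

lemma computable_is_formula: "computable (\<lambda>n::nat. n \<in> range (enc :: formula \<Rightarrow> nat))"
proof -
  obtain E :: "nat \<Rightarrow> nat \<Rightarrow> bool \<times> nat" where E: "computable (\<lambda>z. E (fst z) (snd z))"
    "\<And>p \<phi>. E p (enc (\<phi> :: formula)) = (True, 0)"
    "\<And>p n. fst (E p n) \<Longrightarrow> n \<in> range (enc :: formula \<Rightarrow> nat)"
    using formula_table[of "\<lambda>_ _. 0" "\<lambda>_. 0" "\<lambda>_ _. 0" "\<lambda>_ _ _. 0" "\<lambda>_ _. 0" "\<lambda>_ _ _. 0"
        "\<lambda>_ _ _. 0" "\<lambda>_ _ _. 0", OF refl refl refl refl refl refl refl computable_const computable_const
        computable_const computable_const computable_const computable_const computable_const] by blast
  have "computable (\<lambda>n. fst (E 0 n))" by (intro computable_comp2[OF E(1)] comp)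
  moreover have "fst (E 0 n) = (n \<in> range (enc :: formula \<Rightarrow> nat))" for n
    using E(2,3) by (metis fst_conv rangeE)
  ultimately show ?thesis by (simp only:)
qed

lemma computable_signature:
  assumes "computable f"
  shows computable_num_cells [comp]: "computable (\<lambda>x. num_cells (f x))"
    and computable_fun_arities [comp]: "computable (\<lambda>x. fun_arities (f x))"
    and computable_pred_arities [comp]: "computable (\<lambda>x. pred_arities (f x))"
proof -
  have id: "map enc ns = ns" for ns :: "nat list" by (simp add: map_idI)
  have *: "computable (\<lambda>x. (num_cells (f x), fun_arities (f x), pred_arities (f x)))"
    by (rule computable_retype[OF assms])
      (simp add: enc_prod_def enc_list_def enc_signature_def signature_code_def id)
  show "computable (\<lambda>x. num_cells (f x))" using computable_fst[OF *] by simp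
  show "computable (\<lambda>x. fun_arities (f x))" using computable_fst[OF computable_snd[OF *]] by simp
  show "computable (\<lambda>x. pred_arities (f x))" using computable_snd[OF computable_snd[OF *]] by simp
qed

subsection \<open>Decision problems\<close>

lemma enc_instance: "instance_code x = enc x"
  by (simp add: instance_code_def enc_prod_def enc_signature_def enc_formula_def)

lemma surj_signature_code: "surj signature_code"
proof -
  have "\<exists>\<Sigma>. signature_code \<Sigma> = n" for n
  proof -
    obtain a m where n: "n = prod_encode (a, m)" by (metis prod.exhaust prod_decode_inverse)
    obtain b c where m: "m = prod_encode (b, c)" by (metis prod.exhaust prod_decode_inverse)
    have "signature_code (Signature a (list_decode b) (list_decode c)) = n"
      by (simp add: signature_code_def n m)
    then show ?thesis ..
  qed
  then show ?thesis by (metis surjI)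
qed

text \<open>Every number codes a signature, so only the formula component can be malformed.\<close>

lemma range_enc_instance:
  "n \<in> range (enc :: signature \<times> formula \<Rightarrow> nat) \<longleftrightarrow> snd (prod_decode n) \<in> range (enc :: formula \<Rightarrow> nat)"
proof
  assume "snd (prod_decode n) \<in> range (enc :: formula \<Rightarrow> nat)"
  then obtain \<phi> :: formula where \<phi>: "snd (prod_decode n) = enc \<phi>" by auto
  obtain \<Sigma> where \<Sigma>: "fst (prod_decode n) = signature_code \<Sigma>" using surj_signature_code by (metis surjD)
  have "n = prod_encode (fst (prod_decode n), snd (prod_decode n))" by simp
  also have "\<dots> = enc (\<Sigma>, \<phi>)" unfolding \<phi> \<Sigma> by (simp add: enc_prod_def enc_signature_def)
  finally show "n \<in> range (enc :: signature \<times> formula \<Rightarrow> nat)" by auto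
qed (auto simp: enc_prod_def)

text \<open>A decision function has to answer 0 also on numbers that code no instance, where the
  realizer of \<open>\<chi>\<close> is uncontrolled. It is therefore guarded by the test for formula
  codes.\<close>

lemma decidable_problemI:
  assumes "computable \<chi>"
  shows "decidable_problem {x. \<chi> x}"
proof -
  obtain K where K: "recursive1 K" "\<And>x. K (enc x) = enc (\<chi> x)"
    using assms unfolding computable_def by blast
  have "computable K" using K(1) unfolding computable_def by auto
  then have "computable (\<lambda>n. if snd (prod_decode n) \<in> range (enc :: formula \<Rightarrow> nat) then K n else 0)"
    by (intro comp computable_comp[OF computable_is_formula])
  then obtain D where D: "recursive1 D"
    "\<And>n. D n = (if snd (prod_decode n) \<in> range (enc :: formula \<Rightarrow> nat) then K n else 0)"
    unfolding computable_def by auto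
  have "D n = (if n \<in> instance_code ` {x. \<chi> x} then 1 else 0)" for n
  proof (cases "n \<in> range (enc :: signature \<times> formula \<Rightarrow> nat)")
    case True
    then obtain x :: "signature \<times> formula" where n: "n = enc x" by blast
    have "D n = enc (\<chi> x)" using True unfolding D(2) range_enc_instance[symmetric] by (simp add: n K)
    then show ?thesis by (auto simp: n enc_bool_def enc_instance)
  next
    case False
    then have "D n = 0" unfolding D(2) range_enc_instance[symmetric] by simp
    then show ?thesis using False by (auto simp: enc_instance)
  qed
  moreover obtain r where "\<And>n. rec_eval r [n] (D n)"
  proof -
    obtain r where r: "\<And>xs. length xs = 1 \<Longrightarrow> rec_eval r xs (D (xs ! 0))"
      using D(1) unfolding recursive1_def recursive_def by blast
    have "rec_eval r [n] (D n)" for n using r[of "[n]"] by simp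
    then show ?thesis by (rule that)
  qed
  ultimately show ?thesis unfolding decidable_problem_def decidable_def by metis
qed

text \<open>Unbounded search for a certificate. Surjectivity of the coding ensures that each number
  tried is the code of a certificate, so the search cannot stop at a meaningless number.\<close>

lemma semi_decidable_problemI:
  fixes \<chi> :: "signature \<times> formula \<Rightarrow> 'c::encodable \<Rightarrow> bool"
  assumes \<chi>: "computable (\<lambda>z. \<chi> (fst z) (snd z))" and surj: "surj (enc :: 'c \<Rightarrow> nat)"
  shows "semi_decidable_problem {x. \<exists>w. \<chi> x w}"
proof -
  obtain K where K: "recursive1 K" "\<And>z. K (enc z) = enc (\<chi> (fst z) (snd z))"
    using \<chi> unfolding computable_def by blast
  have "computable K" using K(1) unfolding computable_def by auto
  then have K': "computable (\<lambda>z. K (prod_encode (fst z, snd z)))"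
    by (rule computable_comp[of K]) (intro comp)
  have "computable (\<lambda>z. if snd (prod_decode (fst z)) \<in> range (enc :: formula \<Rightarrow> nat)
      then K (prod_encode (fst z, snd z)) else 0)"
    by (intro comp computable_comp[OF computable_is_formula] K')
  then obtain D where D: "recursive1 D"
    "\<And>z. D (enc z) = (if snd (prod_decode (fst z)) \<in> range (enc :: formula \<Rightarrow> nat)
      then K (prod_encode (fst z, snd z)) else 0)"
    unfolding computable_def by auto
  \<comment> \<open>\<open>Minim\<close> looks for a zero in the first argument; hence the
    certificate comes first and acceptance is inverted.\<close>
  have "recursive 2 (\<lambda>xs. 1 - D (prod_encode (xs ! 1, xs ! 0)))"
    by (intro recursive_diff recursive_const recursive_comp1[OF D(1)[unfolded recursive1_def]]
        recursive_prod_encode recursive_proj; simp)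
  then obtain r where r: "\<And>xs. length xs = 2 \<Longrightarrow> rec_eval r xs (1 - D (prod_encode (xs ! 1, xs ! 0)))"
    unfolding recursive_def by blast
  have r: "rec_eval r [w, n] (1 - D (prod_encode (n, w)))" for w n
    using r[of "[w, n]"] by simp
  have D_pos: "D (prod_encode (n, enc w)) \<noteq> 0 \<longleftrightarrow> (\<exists>x. n = enc x \<and> \<chi> x w)" for n and w :: 'c
  proof (cases "n \<in> range (enc :: signature \<times> formula \<Rightarrow> nat)")
    case True
    then obtain x :: "signature \<times> formula" where n: "n = enc x" by blast
    have "D (prod_encode (n, enc w)) = K (prod_encode (n, enc w))"
      using True D(2)[of "(n, enc w)"] unfolding range_enc_instance by (simp add: enc_prod_def)
    also have "\<dots> = enc (\<chi> x w)" using K(2)[of "(x, w)"] by (simp add: enc_prod_def n)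
    finally show ?thesis by (auto simp: n enc_bool_def)
  next
    case False
    then have "D (prod_encode (n, enc w)) = 0"
      using D(2)[of "(n, enc w)"] unfolding range_enc_instance by (simp add: enc_prod_def)
    then show ?thesis using False by auto
  qed
  have "n \<in> instance_code ` {x. \<exists>w. \<chi> x w} \<longleftrightarrow> (\<exists>y. rec_eval (Minim r) [n] y)" for n
  proof -
    have "n \<in> instance_code ` {x. \<exists>w. \<chi> x w} \<longleftrightarrow> (\<exists>w. D (prod_encode (n, enc (w :: 'c))) \<noteq> 0)"
      unfolding D_pos enc_instance by blast
    also have "\<dots> \<longleftrightarrow> (\<exists>m. D (prod_encode (n, m)) \<noteq> 0)"
    proof -
      have "\<exists>w :: 'c. enc w = m" for m using surjD[OF surj, of m] by (auto simp: eq_commute)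
      then show ?thesis by (intro iffI; elim exE) (blast, metis)
    qed
    also have "\<dots> \<longleftrightarrow> (\<exists>y. rec_eval (Minim r) [n] y)"
    proof
      assume *: "\<exists>m. D (prod_encode (n, m)) \<noteq> 0"
      define m where "m = (LEAST m. D (prod_encode (n, m)) \<noteq> 0)"
      have m: "D (prod_encode (n, m)) \<noteq> 0" unfolding m_def using * by (rule LeastI_ex)
      have less: "D (prod_encode (n, k)) = 0" if "k < m" for k
        using not_less_Least that unfolding m_def by blast
      have "rec_eval (Minim r) [n] m"
      proof (rule eval_Minim)
        show "rec_eval r [m, n] 0" using r[of m n] m by simp
        show "\<forall>k<m. \<exists>y. rec_eval r [k, n] (Suc y)"
        proof (intro allI impI exI)
          fix k assume "k < m"
          then show "rec_eval r [k, n] (Suc 0)" using r[of k n] less[of k] by simp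
        qed
      qed
      then show "\<exists>y. rec_eval (Minim r) [n] y" ..
    next
      assume "\<exists>y. rec_eval (Minim r) [n] y"
      then obtain y where "rec_eval r [y, n] 0" by (auto elim: rec_eval_MinimE)
      then have "1 - D (prod_encode (n, y)) = 0" using r rec_eval_deterministic by blast
      then show "\<exists>m. D (prod_encode (n, m)) \<noteq> 0" by (intro exI[of _ y]) simp
    qed
    finally show ?thesis .
  qed
  then show ?thesis unfolding semi_decidable_problem_def semi_decidable_def by blast
qed

section \<open>Satisfiability over term structures\<close>

fun subst :: "(nat \<Rightarrow> fterm) \<Rightarrow> fterm \<Rightarrow> fterm" where
  "subst e (Cell c) = e c"
| "subst e (FApp f ts) = FApp f (map (subst e) ts)"

primrec env :: "computation \<Rightarrow> nat \<Rightarrow> nat \<Rightarrow> fterm" where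
  "env \<sigma> 0 = Cell"
| "env \<sigma> (Suc t) = (\<lambda>c. subst (env \<sigma> t) (\<sigma> t c))"

lemma subst_subst: "subst e (subst e' \<tau>) = subst (\<lambda>c. subst e (e' c)) \<tau>"
  by (induction \<tau>) auto

lemma subst_Cell [simp]: "subst Cell \<tau> = \<tau>"
  by (induction \<tau>) (auto simp: map_idI)

fun cells :: "fterm \<Rightarrow> nat set" where
  "cells (Cell c) = {c}"
| "cells (FApp f ts) = (\<Union>t \<in> set ts. cells t)"

lemma subst_cong: "(\<And>c. c \<in> cells \<tau> \<Longrightarrow> e c = e' c) \<Longrightarrow> subst e \<tau> = subst e' \<tau>"
  by (induction \<tau>) auto

lemma wf_term_cells: "wf_term \<Sigma> \<tau> \<Longrightarrow> c \<in> cells \<tau> \<Longrightarrow> c < num_cells \<Sigma>"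
  by (induction \<tau>) auto

lemma wf_term_subst:
  "wf_term \<Sigma> \<tau> \<Longrightarrow> (\<And>c. c < num_cells \<Sigma> \<Longrightarrow> wf_term \<Sigma> (e c)) \<Longrightarrow> wf_term \<Sigma> (subst e \<tau>)"
  by (induction \<tau>) auto

lemma unroll_eq_subst: "unroll \<sigma> t \<tau> = subst (env \<sigma> t) \<tau>"
proof (induction t arbitrary: \<tau>)
  case 0
  show ?case by (induction \<tau>) auto
next
  case (Suc t)
  show ?case by (induction \<tau>) (auto simp: Suc)
qed

fun obs :: "computation \<Rightarrow> (nat \<Rightarrow> fterm list \<Rightarrow> bool) \<Rightarrow> nat \<Rightarrow> formula \<Rightarrow> bool" where
  "obs \<sigma> P t (Pred p ts) \<longleftrightarrow> P p (map (subst (env \<sigma> t)) ts)"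
| "obs \<sigma> P t (Update c \<tau>) \<longleftrightarrow> \<sigma> t c = \<tau>"
| "obs \<sigma> P t \<phi> \<longleftrightarrow> False"

text \<open>Temporal semantics over an arbitrary word of atoms. Words can thus be rearranged into
  lassos before it is known whether the result comes from an execution.\<close>

fun ltl :: "(nat \<Rightarrow> formula \<Rightarrow> bool) \<Rightarrow> nat \<Rightarrow> formula \<Rightarrow> bool" where
  "ltl w t TrueF \<longleftrightarrow> True"
| "ltl w t (Neg \<phi>) \<longleftrightarrow> \<not> ltl w t \<phi>"
| "ltl w t (Conj \<phi> \<psi>) \<longleftrightarrow> ltl w t \<phi> \<and> ltl w t \<psi>"
| "ltl w t (Next \<phi>) \<longleftrightarrow> ltl w (Suc t) \<phi>"
| "ltl w t (Until \<phi> \<psi>) \<longleftrightarrow>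
     (\<exists>t'\<ge>t. ltl w t' \<psi> \<and> (\<forall>s. t \<le> s \<and> s < t' \<longrightarrow> ltl w s \<phi>))"
| "ltl w t (Pred p ts) \<longleftrightarrow> w t (Pred p ts)"
| "ltl w t (Update c \<tau>) \<longleftrightarrow> w t (Update c \<tau>)"

lemma holds_eq_ltl:
  "holds \<sigma> I t \<phi> = ltl (obs \<sigma> (\<lambda>p us. pred_val I p (map (term_val I) us))) t \<phi>"
  by (induction \<phi> arbitrary: t) (simp_all add: unroll_eq_subst comp_def)

definition herbrand_sat :: "signature \<Rightarrow> formula \<Rightarrow> bool" where
  "herbrand_sat \<Sigma> \<phi> \<longleftrightarrow> (\<exists>\<sigma> P. computation_over \<Sigma> \<sigma> \<and> ltl (obs \<sigma> P) 0 \<phi>)"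

text \<open>An execution yields the set of predicate terms that it makes true. Conversely, terms are
  embedded into the infinite universe through their codes, each term is interpreted by its own
  image, and the inverse embedding lets the predicates read the term back.\<close>

lemma satisfiable_iff_herbrand:
  assumes "infinite (UNIV :: 'u set)"
  shows "satisfiable_TU TYPE('u) \<Sigma> \<phi> \<longleftrightarrow> herbrand_sat \<Sigma> \<phi>"
proof
  assume "satisfiable_TU TYPE('u) \<Sigma> \<phi>"
  then show "herbrand_sat \<Sigma> \<phi>"
    unfolding satisfiable_TU_def herbrand_sat_def holds_eq_ltl by blast
next
  assume "herbrand_sat \<Sigma> \<phi>"
  then obtain \<sigma> P where \<sigma>: "computation_over \<Sigma> \<sigma>" and P: "ltl (obs \<sigma> P) 0 \<phi>"
    unfolding herbrand_sat_def by blast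
  obtain g :: "nat \<Rightarrow> 'u" where g: "inj g"
    using assms infinite_countable_subset by blast
  define i :: "fterm \<Rightarrow> 'u val" where "i t = OtherV (g (enc t))" for t
  have i: "inj i" by (rule injI) (simp add: i_def inj_eq[OF g])
  define I where "I = Assignment (\<lambda>c. i (Cell c)) (\<lambda>f vs. i (FApp f (map (inv i) vs)))
    (\<lambda>p vs. P p (map (inv i) vs))"
  have val: "term_val I t = i t" for t
    by (induction t) (auto simp: I_def i map_idI)
  have "map (inv i) (map (term_val I) us) = us" for us
    by (simp add: val i map_idI)
  then have "(\<lambda>p us. pred_val I p (map (term_val I) us)) = P" by (simp add: I_def)
  then have "holds \<sigma> I 0 \<phi>" using P by (simp add: holds_eq_ltl)
  moreover have "assignment_over \<Sigma> UNIV I" by (simp add: assignment_over_def)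
  ultimately show "satisfiable_TU TYPE('u) \<Sigma> \<phi>" using \<sigma> unfolding satisfiable_TU_def by blast
qed

section \<open>Temporal formulas on words\<close>

fun preds :: "formula \<Rightarrow> (nat \<times> fterm list) list" where
  "preds (Neg \<phi>) = preds \<phi>"
| "preds (Conj \<phi> \<psi>) = preds \<phi> @ preds \<psi>"
| "preds (Next \<phi>) = preds \<phi>"
| "preds (Until \<phi> \<psi>) = preds \<phi> @ preds \<psi>"
| "preds (Pred p ts) = [(p, ts)]"
| "preds _ = []"

fun updates :: "formula \<Rightarrow> (nat \<times> fterm) list" where
  "updates (Neg \<phi>) = updates \<phi>"
| "updates (Conj \<phi> \<psi>) = updates \<phi> @ updates \<psi>"
| "updates (Next \<phi>) = updates \<phi>"
| "updates (Until \<phi> \<psi>) = updates \<phi> @ updates \<psi>"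
| "updates (Update c \<tau>) = [(c, \<tau>)]"
| "updates _ = []"

definition agree :: "formula \<Rightarrow> (formula \<Rightarrow> bool) \<Rightarrow> (formula \<Rightarrow> bool) \<Rightarrow> bool" where
  "agree \<phi> x y \<longleftrightarrow> (\<forall>(p, ts) \<in> set (preds \<phi>). x (Pred p ts) = y (Pred p ts)) \<and>
     (\<forall>(c, \<tau>) \<in> set (updates \<phi>). x (Update c \<tau>) = y (Update c \<tau>))"

lemma agree_simps [simp]:
  "agree \<phi> x x"
  "agree (Neg \<phi>) x y = agree \<phi> x y"
  "agree (Conj \<phi> \<psi>) x y \<longleftrightarrow> agree \<phi> x y \<and> agree \<psi> x y"
  "agree (Next \<phi>) x y = agree \<phi> x y"
  "agree (Until \<phi> \<psi>) x y \<longleftrightarrow> agree \<phi> x y \<and> agree \<psi> x y"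
  "agree (Pred p ts) x y = (x (Pred p ts) = y (Pred p ts))"
  "agree (Update c \<tau>) x y = (x (Update c \<tau>) = y (Update c \<tau>))"
  by (auto simp: agree_def)

lemma ltl_cong:
  assumes "\<And>t. agree \<phi> (w t) (w' t)"
  shows "ltl w t \<phi> = ltl w' t \<phi>"
  using assms by (induction \<phi> arbitrary: t) auto

lemma ltl_shift: "ltl (\<lambda>s. w (t + s)) s \<phi> = ltl w (t + s) \<phi>"
proof (induction \<phi> arbitrary: s)
  case (Until \<phi> \<psi>)
  have "(\<exists>t'\<ge>s. ltl w (t + t') \<psi> \<and> (\<forall>r. s \<le> r \<and> r < t' \<longrightarrow> ltl w (t + r) \<phi>)) \<longleftrightarrow>
    (\<exists>t'\<ge>t + s. ltl w t' \<psi> \<and> (\<forall>r. t + s \<le> r \<and> r < t' \<longrightarrow> ltl w r \<phi>))" (is "?L \<longleftrightarrow> ?R")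
  proof
    assume ?L
    then obtain t' where *: "t' \<ge> s" "ltl w (t + t') \<psi>" "\<And>r. s \<le> r \<Longrightarrow> r < t' \<Longrightarrow> ltl w (t + r) \<phi>" by blast
    have "ltl w r \<phi>" if "t + s \<le> r" "r < t + t'" for r using *(3)[of "r - t"] that by simp
    with * show ?R by (intro exI[of _ "t + t'"]) auto
  next
    assume ?R
    then obtain t' where *: "t' \<ge> t + s" "ltl w t' \<psi>" "\<And>r. t + s \<le> r \<Longrightarrow> r < t' \<Longrightarrow> ltl w r \<phi>" by blast
    then show ?L by (intro exI[of _ "t' - t"]) auto
  qed
  then show ?case by (simp add: Until)
qed auto

text \<open>Truth in positive and falsity in negative position are both witnessed by a finite
  prefix. The polarity makes the induction pass through negations: a false conjunction needs one
  false conjunct, and an eventually occurs only where its truth has to be witnessed, by a single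
  time.\<close>

lemma reach_pol_finite:
  assumes "reach_pol b \<phi>" and "ltl w t \<phi> = b"
  shows "\<exists>n. \<forall>w'. (\<forall>s<n. agree \<phi> (w s) (w' s)) \<longrightarrow> ltl w' t \<phi> = b"
  using assms
proof (induction \<phi> arbitrary: b t)
  case (Neg \<phi>)
  then have "reach_pol (\<not> b) \<phi>" "ltl w t \<phi> = (\<not> b)" by auto
  then obtain n where "\<forall>w'. (\<forall>s<n. agree \<phi> (w s) (w' s)) \<longrightarrow> ltl w' t \<phi> = (\<not> b)"
    using Neg.IH by blast
  then show ?case by (intro exI[of _ n]) auto
next
  case (Conj \<phi> \<psi>)
  show ?case
  proof (cases b)
    case True
    then obtain m n where "\<forall>w'. (\<forall>s<m. agree \<phi> (w s) (w' s)) \<longrightarrow> ltl w' t \<phi> = b"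
      "\<forall>w'. (\<forall>s<n. agree \<psi> (w s) (w' s)) \<longrightarrow> ltl w' t \<psi> = b"
      using Conj.IH[of b t] Conj.prems by auto
    then show ?thesis using True by (intro exI[of _ "max m n"]) auto
  next
    case False
    then consider "ltl w t \<phi> = b" | "ltl w t \<psi> = b" using Conj.prems by auto
    then show ?thesis
    proof cases
      case 1
      then obtain n where "\<forall>w'. (\<forall>s<n. agree \<phi> (w s) (w' s)) \<longrightarrow> ltl w' t \<phi> = b"
        using Conj.IH(1)[of b t] Conj.prems by auto
      then show ?thesis using False by (intro exI[of _ n]) auto
    next
      case 2
      then obtain n where "\<forall>w'. (\<forall>s<n. agree \<psi> (w s) (w' s)) \<longrightarrow> ltl w' t \<psi> = b"
        using Conj.IH(2)[of b t] Conj.prems by auto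
      then show ?thesis using False by (intro exI[of _ n]) auto
    qed
  qed
next
  case (Next \<phi>)
  then show ?case using Next.IH[of b "Suc t"] by simp
next
  case (Until \<phi> \<psi>)
  then obtain t' where t': "t' \<ge> t" "ltl w t' \<psi> = b" by auto
  have b: "b" "\<phi> = TrueF" "reach_pol b \<psi>" using Until.prems by auto
  obtain n where n: "\<forall>w'. (\<forall>s<n. agree \<psi> (w s) (w' s)) \<longrightarrow> ltl w' t' \<psi> = b"
    using Until.IH(2)[OF b(3) t'(2)] by blast
  then show ?case using b t' by (intro exI[of _ n]) auto
next
  case (Pred p ts)
  then show ?case by (intro exI[of _ "Suc t"]) auto
next
  case (Update c \<tau>)
  then show ?case by (intro exI[of _ "Suc t"]) auto
qed auto

text \<open>An upper bound suffices, so sums replace maxima. A leading eventually leaves the value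
  unchanged.\<close>

fun next_depth :: "formula \<Rightarrow> nat" where
  "next_depth (Neg \<phi>) = next_depth \<phi>"
| "next_depth (Conj \<phi> \<psi>) = next_depth \<phi> + next_depth \<psi>"
| "next_depth (Next \<phi>) = Suc (next_depth \<phi>)"
| "next_depth (Until \<phi> \<psi>) = next_depth \<phi> + next_depth \<psi>"
| "next_depth _ = 0"

lemma next_fragment_finite:
  assumes "next_fragment \<phi>" and "\<And>s. s \<le> t + next_depth \<phi> \<Longrightarrow> agree \<phi> (w s) (w' s)"
  shows "ltl w t \<phi> = ltl w' t \<phi>"
  using assms by (induction \<phi> arbitrary: t) auto

subsection \<open>Lassos\<close>

primrec lasso :: "nat \<Rightarrow> nat \<Rightarrow> nat \<Rightarrow> nat" where
  "lasso i j 0 = 0"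
| "lasso i j (Suc t) = (if Suc (lasso i j t) = j then i else Suc (lasso i j t))"

lemma lasso_less: "i < j \<Longrightarrow> lasso i j t < j"
  by (induction t) auto

lemma lasso_add: "lasso i j t + m < j \<Longrightarrow> lasso i j (t + m) = lasso i j t + m"
  by (induction m) auto

lemma lasso_id: "t < j \<Longrightarrow> lasso i j t = t"
  using lasso_add[of i j 0 t] by simp

lemma lasso_wrap:
  assumes "i < j" shows "lasso i j (t + (j - lasso i j t)) = i"
proof -
  obtain m where m: "j - lasso i j t = Suc m" using lasso_less[OF assms] by (metis Suc_diff_Suc)
  then have "lasso i j (t + m) = lasso i j t + m" by (intro lasso_add) linarith
  moreover have "Suc (lasso i j t + m) = j" using m by linarith
  ultimately show ?thesis using m by simp
qed

lemma lasso_periodic: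
  assumes "i < j" "i \<le> t" shows "lasso i j (t + (j - i)) = lasso i j t"
proof -
  have "lasso i j (i + m + (j - i)) = lasso i j (i + m)" for m
  proof (induction m)
    case 0
    show ?case using lasso_wrap[OF assms(1), of i] lasso_id[of i j i] assms(1) by simp
  qed (simp only: add_Suc add_Suc_right lasso.simps)
  from this[of "t - i"] show ?thesis using assms by simp
qed

lemma lasso_ge: "i < j \<Longrightarrow> i \<le> t \<Longrightarrow> i \<le> lasso i j t"
  by (induction t) (auto simp: le_Suc_eq lasso_id)

section \<open>Closing a word into a lasso\<close>

fun subformulas :: "formula \<Rightarrow> formula set" where
  "subformulas (Neg \<phi>) = insert (Neg \<phi>) (subformulas \<phi>)"
| "subformulas (Conj \<phi> \<psi>) = insert (Conj \<phi> \<psi>) (subformulas \<phi> \<union> subformulas \<psi>)"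
| "subformulas (Next \<phi>) = insert (Next \<phi>) (subformulas \<phi>)"
| "subformulas (Until \<phi> \<psi>) = insert (Until \<phi> \<psi>) (subformulas \<phi> \<union> subformulas \<psi>)"
| "subformulas \<phi> = {\<phi>}"

lemma finite_subformulas: "finite (subformulas \<phi>)"
  by (induction \<phi>) auto

lemma subformulas_refl: "\<phi> \<in> subformulas \<phi>"
  by (cases \<phi>) auto

lemma ltl_Until_Suc:
  "ltl w t (Until \<phi> \<psi>) \<longleftrightarrow> ltl w t \<psi> \<or> ltl w t \<phi> \<and> ltl w (Suc t) (Until \<phi> \<psi>)"
proof
  assume "ltl w t (Until \<phi> \<psi>)"
  then obtain t' where t': "t' \<ge> t" "ltl w t' \<psi>" "\<And>s. t \<le> s \<Longrightarrow> s < t' \<Longrightarrow> ltl w s \<phi>" by auto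
  show "ltl w t \<psi> \<or> ltl w t \<phi> \<and> ltl w (Suc t) (Until \<phi> \<psi>)"
  proof (cases "t' = t")
    case False
    then have "ltl w (Suc t) (Until \<phi> \<psi>)" using t' by (auto intro!: exI[of _ t'])
    then show ?thesis using t' False by simp
  qed (use t' in simp)
next
  assume "ltl w t \<psi> \<or> ltl w t \<phi> \<and> ltl w (Suc t) (Until \<phi> \<psi>)"
  then show "ltl w t (Until \<phi> \<psi>)"
  proof
    assume *: "ltl w t \<phi> \<and> ltl w (Suc t) (Until \<phi> \<psi>)"
    then obtain t' where t': "t' \<ge> Suc t" "ltl w t' \<psi>" "\<And>s. Suc t \<le> s \<Longrightarrow> s < t' \<Longrightarrow> ltl w s \<phi>"
      by auto
    have "ltl w s \<phi>" if "t \<le> s" "s < t'" for s using t'(3)[of s] that * by (cases "s = t") auto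
    then show ?thesis using t' by (auto intro!: exI[of _ t'])
  qed auto
qed

text \<open>Agreement of all subformulas at \<open>i\<close> and \<open>j\<close> makes the jump
  back invisible to next operators. For until it could still postpone the goal forever; this is
  excluded by requiring that obligations present at \<open>i\<close> are met before
  \<open>j\<close>.\<close>

lemma ltl_lasso:
  assumes ij: "i < j"
    and same: "\<And>\<psi>. \<psi> \<in> subformulas \<phi> \<Longrightarrow> ltl w i \<psi> = ltl w j \<psi>"
    and fulfil: "\<And>\<psi> \<chi>. Until \<psi> \<chi> \<in> subformulas \<phi> \<Longrightarrow> ltl w i (Until \<psi> \<chi>) \<Longrightarrow>
      \<exists>t<j. i \<le> t \<and> ltl w t \<chi> \<and> (\<forall>s. i \<le> s \<and> s < t \<longrightarrow> ltl w s \<psi>)"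
    and "subformulas \<psi> \<subseteq> subformulas \<phi>"
  shows "ltl (\<lambda>t. w (lasso i j t)) t \<psi> = ltl w (lasso i j t) \<psi>"
  using assms(4)
proof (induction \<psi> arbitrary: t)
  case (Next \<psi>)
  then have "\<psi> \<in> subformulas \<phi>" using subformulas_refl by auto
  then show ?case using Next same by simp
next
  case (Until \<psi> \<chi>)
  let ?q = "lasso i j"
  have sub: "Until \<psi> \<chi> \<in> subformulas \<phi>" "subformulas \<psi> \<subseteq> subformulas \<phi>" "subformulas \<chi> \<subseteq> subformulas \<phi>"
    using Until.prems by auto
  have wrap: "ltl w (?q (Suc t)) (Until \<psi> \<chi>) = ltl w (Suc (?q t)) (Until \<psi> \<chi>)" for t
    using same[OF sub(1)] by simp
  have "(\<exists>t'\<ge>t. ltl w (?q t') \<chi> \<and> (\<forall>s. t \<le> s \<and> s < t' \<longrightarrow> ltl w (?q s) \<psi>)) \<longleftrightarrow> ltl w (?q t) (Until \<psi> \<chi>)"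
    (is "?L \<longleftrightarrow> ?R")
  proof
    assume ?L
    then obtain t' where t': "t \<le> t'" "ltl w (?q t') \<chi>" "\<And>s. t \<le> s \<Longrightarrow> s < t' \<Longrightarrow> ltl w (?q s) \<psi>"
      by blast
    from t'(1,3) show ?R
    \<comment> \<open>From the witness backwards, the expansion law carries the until formula over
      each position, including the jump from \<open>j\<close> to \<open>i\<close>.\<close>
    proof (induction t rule: inc_induct)
      case base
      then show ?case using t'(2) by (subst ltl_Until_Suc) blast
    next
      case (step n)
      then have "ltl w (?q (Suc n)) (Until \<psi> \<chi>)" "ltl w (?q n) \<psi>" by auto
      then show ?case unfolding wrap by (subst ltl_Until_Suc) blast
    qed
  next
    assume ?R
    then obtain u where u: "?q t \<le> u" "ltl w u \<chi>" "\<And>s. ?q t \<le> s \<Longrightarrow> s < u \<Longrightarrow> ltl w s \<psi>"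
      by auto
    show ?L
    proof (cases "u < j")
      case True
      have q: "?q (t + m) = ?q t + m" if "m \<le> u - ?q t" for m
        using True u(1) that by (intro lasso_add) simp
      show ?thesis
      proof (intro exI[of _ "t + (u - ?q t)"] conjI allI impI)
        show "ltl w (?q (t + (u - ?q t))) \<chi>" using q[of "u - ?q t"] u by simp
        fix s assume s: "t \<le> s \<and> s < t + (u - ?q t)"
        then have "s - t \<le> u - ?q t" by linarith
        then have "?q s = ?q t + (s - t)" using q[of "s - t"] s by simp
        moreover have "?q t + (s - t) < u" using s by linarith
        ultimately show "ltl w (?q s) \<psi>" using u(3)[of "?q t + (s - t)"] by simp
      qed simp
    next
      case False
      let ?k = "j - ?q t"
      have k: "?q t + ?k = j" using lasso_less[OF ij, of t] by simp
      \<comment> \<open>The goal is reached only after the end of the loop, so the obligation is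
        still pending at \<open>j\<close>. It then also holds at \<open>i\<close>, where the next
        round fulfils it.\<close>
      have "ltl w j (Until \<psi> \<chi>)" using u False k by (auto intro!: exI[of _ u])
      then have "ltl w i (Until \<psi> \<chi>)" using same[OF sub(1)] by blast
      then obtain v where v: "v < j" "i \<le> v" "ltl w v \<chi>" "\<And>s. i \<le> s \<Longrightarrow> s < v \<Longrightarrow> ltl w s \<psi>"
        using fulfil[OF sub(1)] by blast
      have q0: "?q (t + ?k) = i" using lasso_wrap[OF ij] .
      have q: "?q (t + ?k + m) = i + m" if "m \<le> v - i" for m
        using lasso_add[of i j "t + ?k" m] q0 v that by simp
      show ?thesis
      proof (intro exI[of _ "t + ?k + (v - i)"] conjI allI impI)
        show "ltl w (?q (t + ?k + (v - i))) \<chi>" using q[of "v - i"] v by simp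
        fix s assume s: "t \<le> s \<and> s < t + ?k + (v - i)"
        show "ltl w (?q s) \<psi>"
        proof (cases "s < t + ?k")
          case True
          then have "?q t + (s - t) < j" using s k by linarith
          then have "?q s = ?q t + (s - t)" using lasso_add[of i j t "s - t"] s by simp
          moreover have "?q t + (s - t) < u" using s True False k by linarith
          ultimately show ?thesis using u(3)[of "?q t + (s - t)"] by simp
        next
          case False
          have "s - (t + ?k) \<le> v - i" using s by linarith
          moreover have "t + ?k + (s - (t + ?k)) = s" using False by linarith
          ultimately have "?q s = i + (s - (t + ?k))" using q[of "s - (t + ?k)"] by simp
          moreover have "i + (s - (t + ?k)) < v" using s False v by linarith
          ultimately show ?thesis using v(4)[of "i + (s - (t + ?k))"] by simp
        qed
      qed simp
    qed
  qed
  moreover have "ltl (\<lambda>t. w (?q t)) t (Until \<psi> \<chi>) \<longleftrightarrow>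
      (\<exists>t'\<ge>t. ltl w (?q t') \<chi> \<and> (\<forall>s. t \<le> s \<and> s < t' \<longrightarrow> ltl w (?q s) \<psi>))"
    using Until.IH sub(2,3) by simp
  ultimately show ?case by simp
qed auto

lemma infinite_constant_subset:
  assumes "infinite (S :: nat set)" and "finite (f ` S)"
  obtains S' where "S' \<subseteq> S" "infinite S'" "\<And>s t. s \<in> S' \<Longrightarrow> t \<in> S' \<Longrightarrow> f s = f t"
proof -
  obtain a where "a \<in> S" "infinite {s \<in> S. f s = f a}"
    using pigeonhole_infinite[OF assms] by blast
  then show ?thesis by (intro that[of "{s \<in> S. f s = f a}"]) simp_all
qed

text \<open>There are finitely many sets of true subformulas, so one of them recurs infinitely often
  within \<open>S\<close>; \<open>i\<close> is such a time, and \<open>j\<close> a later one beyond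
  all fulfilment times for \<open>i\<close>. The order of the quantifiers matters: \<open>j\<close>
  may still be pushed beyond bounds that depend on \<open>i\<close>.\<close>

lemma lasso_exists:
  assumes "infinite S"
  shows "\<exists>i \<in> S. \<forall>N. \<exists>j \<in> S. N < j \<and> i < j \<and> ltl (\<lambda>t. w (lasso i j t)) 0 \<phi> = ltl w 0 \<phi>"
proof -
  let ?f = "\<lambda>t. {\<psi> \<in> subformulas \<phi>. ltl w t \<psi>}"
  have "?f ` S \<subseteq> Pow (subformulas \<phi>)" by auto
  then have "finite (?f ` S)" using finite_subformulas by (meson finite_Pow_iff finite_subset)
  then obtain S' where S': "S' \<subseteq> S" "infinite S'" "\<And>s t. s \<in> S' \<Longrightarrow> t \<in> S' \<Longrightarrow> ?f s = ?f t"
    using infinite_constant_subset[OF assms] by blast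
  obtain i where i: "i \<in> S'" using S'(2) by (metis ex_in_conv finite.emptyI)
  let ?U = "{\<psi> \<in> subformulas \<phi>. ltl w i \<psi>}"
  \<comment> \<open>For formulas other than until the condition is void, so that one choice function
    covers all of \<open>?U\<close>.\<close>
  have "\<forall>\<psi> \<in> ?U. \<exists>t\<ge>i. \<forall>\<psi>1 \<psi>2. \<psi> = Until \<psi>1 \<psi>2 \<longrightarrow>
    ltl w t \<psi>2 \<and> (\<forall>s. i \<le> s \<and> s < t \<longrightarrow> ltl w s \<psi>1)"
  proof
    fix \<psi> assume "\<psi> \<in> ?U"
    then have "ltl w i \<psi>" by simp
    then show "\<exists>t\<ge>i. \<forall>\<psi>1 \<psi>2. \<psi> = Until \<psi>1 \<psi>2 \<longrightarrow>
      ltl w t \<psi>2 \<and> (\<forall>s. i \<le> s \<and> s < t \<longrightarrow> ltl w s \<psi>1)"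
      by (cases \<psi>) auto
  qed
  from bchoice[OF this] obtain T where T: "\<forall>\<psi> \<in> ?U. i \<le> T \<psi> \<and> (\<forall>\<psi>1 \<psi>2. \<psi> = Until \<psi>1 \<psi>2 \<longrightarrow>
    ltl w (T \<psi>) \<psi>2 \<and> (\<forall>s. i \<le> s \<and> s < T \<psi> \<longrightarrow> ltl w s \<psi>1))"
    by blast
  have fin: "finite (T ` ?U)" using finite_subformulas by simp
  have "\<exists>j \<in> S. N < j \<and> i < j \<and> ltl (\<lambda>t. w (lasso i j t)) 0 \<phi> = ltl w 0 \<phi>" for N
  proof -
    obtain j where j: "j \<in> S'" "j > Max (insert N (insert i (T ` ?U)))"
      using S'(2) unfolding finite_nat_set_iff_bounded_le by (meson not_le)
    then have j: "j \<in> S'" "N < j" "i < j" "\<And>\<psi>. \<psi> \<in> ?U \<Longrightarrow> T \<psi> < j"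
      using fin by (auto simp: Max_less_iff)
    have "ltl (\<lambda>t. w (lasso i j t)) 0 \<phi> = ltl w (lasso i j 0) \<phi>"
    proof (rule ltl_lasso[OF j(3)])
      show "ltl w i \<psi> = ltl w j \<psi>" if "\<psi> \<in> subformulas \<phi>" for \<psi>
        using S'(3)[OF i j(1)] that by blast
      show "\<exists>t<j. i \<le> t \<and> ltl w t \<chi> \<and> (\<forall>s. i \<le> s \<and> s < t \<longrightarrow> ltl w s \<psi>)"
        if "Until \<psi> \<chi> \<in> subformulas \<phi>" "ltl w i (Until \<psi> \<chi>)" for \<psi> \<chi>
      proof -
        have "Until \<psi> \<chi> \<in> ?U" using that by simp
        then show ?thesis using T j(4)[of "Until \<psi> \<chi>"] by blast
      qed
    qed simp
    then show ?thesis using j S'(1) by auto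
  qed
  then show ?thesis using i S'(1) by blast
qed

section \<open>Finite lassos as certificates\<close>

fun lasso_table :: "(nat \<Rightarrow> formula \<Rightarrow> bool) \<Rightarrow> nat \<Rightarrow> nat \<Rightarrow> formula \<Rightarrow> bool list" where
  "lasso_table w i j TrueF = map (\<lambda>s. True) [0..<j]"
| "lasso_table w i j (Neg \<phi>) = map (\<lambda>s. \<not> nth_default False (lasso_table w i j \<phi>) s) [0..<j]"
| "lasso_table w i j (Conj \<phi> \<psi>) = map (\<lambda>s. nth_default False (lasso_table w i j \<phi>) s \<and>
     nth_default False (lasso_table w i j \<psi>) s) [0..<j]"
| "lasso_table w i j (Next \<phi>) =
     map (\<lambda>s. nth_default False (lasso_table w i j \<phi>) (lasso i j (Suc s))) [0..<j]"
| "lasso_table w i j (Until \<phi> \<psi>) =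
     map (\<lambda>s. \<exists>m<j. nth_default False (lasso_table w i j \<psi>) (lasso i j (s + m)) \<and>
       (\<forall>n<m. nth_default False (lasso_table w i j \<phi>) (lasso i j (s + n)))) [0..<j]"
| "lasso_table w i j (Pred p ts) = map (\<lambda>s. w s (Pred p ts)) [0..<j]"
| "lasso_table w i j (Update c \<tau>) = map (\<lambda>s. w s (Update c \<tau>)) [0..<j]"

lemma lasso_lasso: "i < j \<Longrightarrow> lasso i j (lasso i j t + s) = lasso i j (t + s)"
  by (induction s) (simp_all add: lasso_id lasso_less)

lemma ltl_lasso_word:
  assumes "i < j"
  shows "ltl (\<lambda>t. w (lasso i j t)) (lasso i j t) \<phi> = ltl (\<lambda>t. w (lasso i j t)) t \<phi>"
  using ltl_shift[of "\<lambda>t. w (lasso i j t)" t 0 \<phi>] ltl_shift[of "\<lambda>t. w (lasso i j t)" "lasso i j t" 0 \<phi>]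
  by (simp add: lasso_lasso[OF assms])

lemma nth_default_map_upt: "nth_default d (map f [0..<j]) s = (if s < j then f s else d)"
  by (simp add: nth_default_def)

text \<open>Looking \<open>j\<close> steps ahead suffices for until: a first witness at distance
  \<open>j\<close> or more would still lie in the loop after removing one period, which gives an
  earlier witness.\<close>

lemma lasso_table_eq:
  assumes "i < j" "s < j"
  shows "nth_default False (lasso_table w i j \<phi>) s = ltl (\<lambda>t. w (lasso i j t)) s \<phi>"
  using assms(2)
proof (induction \<phi> arbitrary: s)
  case (Next \<phi>)
  have "lasso i j (Suc s) < j" using lasso_less[OF assms(1)] .
  then show ?case using Next.IH ltl_lasso_word[OF assms(1), of w "Suc s" \<phi>] Next.prems
    by (simp add: nth_default_map_upt del: lasso.simps)
next
  case (Until \<phi> \<psi>)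
  let ?w = "\<lambda>t. w (lasso i j t)"
  have IH: "nth_default False (lasso_table w i j \<phi>) (lasso i j t) = ltl ?w t \<phi>"
    "nth_default False (lasso_table w i j \<psi>) (lasso i j t) = ltl ?w t \<psi>" for t
    using Until.IH lasso_less[OF assms(1)] ltl_lasso_word[OF assms(1)] by simp_all
  have "ltl ?w s (Until \<phi> \<psi>) \<longleftrightarrow> (\<exists>m<j. ltl ?w (s + m) \<psi> \<and> (\<forall>n<m. ltl ?w (s + n) \<phi>))"
    (is "?L \<longleftrightarrow> ?R")
  proof
    assume ?L
    then obtain t' where t': "s \<le> t'" "ltl ?w t' \<psi>" "\<And>r. s \<le> r \<Longrightarrow> r < t' \<Longrightarrow> ltl ?w r \<phi>" by auto
    define P where "P m \<longleftrightarrow> ltl ?w (s + m) \<psi> \<and> (\<forall>n<m. ltl ?w (s + n) \<phi>)" for m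
    have "P (t' - s)" using t' by (simp add: P_def)
    then obtain m where m: "P m" and least: "\<And>m'. m' < m \<Longrightarrow> \<not> P m'"
      using exists_least_iff[of P] by blast
    have "m < j"
    proof (rule ccontr)
      assume "\<not> m < j"
      then have m': "m - (j - i) < m" "i \<le> s + (m - (j - i))" "s + m = s + (m - (j - i)) + (j - i)"
        using assms(1) by auto
      have "lasso i j (s + m) = lasso i j (s + (m - (j - i)))"
        by (subst m'(3)) (rule lasso_periodic[OF assms(1) m'(2)])
      then have "ltl ?w (s + (m - (j - i))) \<psi>"
        using m ltl_lasso_word[OF assms(1), of w "s + m" \<psi>]
          ltl_lasso_word[OF assms(1), of w "s + (m - (j - i))" \<psi>] by (simp add: P_def)
      moreover have "\<forall>n<m - (j - i). ltl ?w (s + n) \<phi>"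
        using m m'(1) unfolding P_def by (meson less_trans)
      ultimately show False using least[OF m'(1)] unfolding P_def by blast
    qed
    with m show ?R unfolding P_def by blast
  next
    assume ?R
    then obtain m where m: "ltl ?w (s + m) \<psi>" "\<forall>n<m. ltl ?w (s + n) \<phi>" by blast
    have "ltl ?w r \<phi>" if "s \<le> r" "r < s + m" for r using m(2)[rule_format, of "r - s"] that by simp
    then show ?L using m(1) by (auto intro!: exI[of _ "s + m"])
  qed
  then show ?case using Until.prems by (simp add: IH nth_default_map_upt del: ltl.simps)
qed (auto simp: nth_default_map_upt lasso_id)

text \<open>The default makes a short or missing row behave as the update that keeps the
  cell.\<close>

definition lookup :: "fterm list \<Rightarrow> nat \<Rightarrow> fterm" where
  "lookup e c = nth_default (Cell c) e c"

definition row_env :: "nat \<Rightarrow> fterm list list \<Rightarrow> fterm list" where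
  "row_env k rows = foldl (\<lambda>e r. map (subst (lookup e)) r) (map Cell [0..<k]) rows"

text \<open>\<open>Q\<close> lists the true predicate terms after substitution, hence over the
  initial contents. A finite list suffices since finitely many instances occur along the
  rows.\<close>

definition row_obs :: "nat \<Rightarrow> fterm list list \<Rightarrow> (nat \<times> fterm list) list \<Rightarrow> nat \<Rightarrow> formula \<Rightarrow> bool" where
  "row_obs k rows Q s \<phi> = (case \<phi> of
     Pred p ts \<Rightarrow> (p, map (subst (lookup (row_env k (take s rows)))) ts) \<in> set Q
   | Update c \<tau> \<Rightarrow> lookup (nth_default [] rows s) c = \<tau>
   | _ \<Rightarrow> False)"

definition wf_rows :: "signature \<Rightarrow> fterm list list \<Rightarrow> bool" where
  "wf_rows \<Sigma> rows \<longleftrightarrow> (\<forall>r \<in> set rows. length r = num_cells \<Sigma> \<and> (\<forall>\<tau> \<in> set r. wf_term \<Sigma> \<tau>))"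

definition lasso_check :: "signature \<Rightarrow> formula \<Rightarrow> fterm list list \<Rightarrow> nat \<Rightarrow> (nat \<times> fterm list) list \<Rightarrow> bool" where
  "lasso_check \<Sigma> \<phi> rows i Q \<longleftrightarrow> i < length rows \<and> wf_rows \<Sigma> rows \<and>
     nth_default False (lasso_table (row_obs (num_cells \<Sigma>) rows Q) i (length rows) \<phi>) 0"

definition row_comp :: "fterm list list \<Rightarrow> computation" where
  "row_comp rows s = lookup (nth_default [] rows s)"

lemma lookup_beyond: "length e \<le> c \<Longrightarrow> lookup e c = Cell c"
  by (simp add: lookup_def nth_default_beyond)

lemma lookup_nth: "c < length e \<Longrightarrow> lookup e c = e ! c"
  by (simp add: lookup_def nth_default_nth)

lemma length_row_env: "wf_rows \<Sigma> rows \<Longrightarrow> length (row_env (num_cells \<Sigma>) rows) = num_cells \<Sigma>"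
  by (cases rows rule: rev_cases) (auto simp: row_env_def wf_rows_def)

lemma wf_rows_take: "wf_rows \<Sigma> rows \<Longrightarrow> wf_rows \<Sigma> (take t rows)"
  by (auto simp: wf_rows_def dest: in_set_takeD)

lemma env_row_comp:
  assumes wf: "wf_rows \<Sigma> rows" and "t \<le> length rows"
  shows "env (row_comp rows) t = lookup (row_env (num_cells \<Sigma>) (take t rows))"
  using assms(2)
proof (induction t)
  case 0
  show ?case
    by (rule ext) (auto simp: row_env_def lookup_def nth_default_def)
next
  case (Suc t)
  let ?k = "num_cells \<Sigma>"
  have row: "length (rows ! t) = ?k" using wf Suc.prems by (auto simp: wf_rows_def)
  have take: "take (Suc t) rows = take t rows @ [rows ! t]" using Suc.prems by (simp add: take_Suc_conv_app_nth)
  have nth: "nth_default [] rows t = rows ! t" using Suc.prems by (simp add: nth_default_def)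
  show ?case
  proof
    fix c
    show "env (row_comp rows) (Suc t) c = lookup (row_env ?k (take (Suc t) rows)) c"
    proof (cases "c < ?k")
      case True
      then have "row_comp rows t c = rows ! t ! c" using row by (simp add: row_comp_def nth lookup_nth)
      then show ?thesis using Suc row True by (simp add: take row_env_def lookup_nth)
    next
      case False
      then have "env (row_comp rows) (Suc t) c = env (row_comp rows) t c"
        by (simp add: row_comp_def nth lookup_beyond row)
      also have "\<dots> = Cell c"
        using Suc False length_row_env[OF wf_rows_take[OF wf], of t] by (simp add: lookup_beyond)
      finally show ?thesis
        using False length_row_env[OF wf_rows_take[OF wf], of "Suc t"] by (simp add: lookup_beyond)
    qed
  qed
qed

lemma row_obs_eq_obs:
  assumes "wf_rows \<Sigma> rows" and "s < length rows"
  shows "agree \<phi> (row_obs (num_cells \<Sigma>) rows Q s) (obs (row_comp rows) (\<lambda>p us. (p, us) \<in> set Q) s)"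
  using assms by (auto simp: agree_def row_obs_def env_row_comp row_comp_def)

lemma row_comp_wf:
  assumes "wf_rows \<Sigma> rows" "c < num_cells \<Sigma>"
  shows "wf_term \<Sigma> (row_comp rows s c)"
proof (cases "s < length rows")
  case True
  then have "rows ! s \<in> set rows" by simp
  then have "length (rows ! s) = num_cells \<Sigma>" "\<forall>\<tau> \<in> set (rows ! s). wf_term \<Sigma> \<tau>"
    using assms(1) by (simp_all add: wf_rows_def)
  moreover have "row_comp rows s c = rows ! s ! c"
    using True assms(2) calculation(1) by (simp add: row_comp_def lookup_nth nth_default_nth)
  ultimately show ?thesis using assms(2) by simp
next
  case False
  then show ?thesis using assms(2) by (simp add: row_comp_def lookup_def nth_default_def)
qed

text \<open>
  The word of observations along the lasso is induced by an actual execution only if the unrolled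
  computation can be given an interpretation with the same observations.
\<close>

lemma lasso_check_ltl:
  assumes "lasso_check \<Sigma> \<phi> rows i Q"
  shows "ltl (\<lambda>t. obs (row_comp rows) (\<lambda>p us. (p, us) \<in> set Q) (lasso i (length rows) t)) 0 \<phi>"
proof -
  have i: "i < length rows" and wf: "wf_rows \<Sigma> rows" using assms by (simp_all add: lasso_check_def)
  have "ltl (\<lambda>t. row_obs (num_cells \<Sigma>) rows Q (lasso i (length rows) t)) 0 \<phi>"
    using assms lasso_table_eq[OF i le_less_trans[OF le0 i]] by (simp add: lasso_check_def)
  moreover have "ltl (\<lambda>t. row_obs (num_cells \<Sigma>) rows Q (lasso i (length rows) t)) 0 \<phi> =
    ltl (\<lambda>t. obs (row_comp rows) (\<lambda>p us. (p, us) \<in> set Q) (lasso i (length rows) t)) 0 \<phi>"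
    by (rule ltl_cong) (rule row_obs_eq_obs[OF wf lasso_less[OF i]])
  ultimately show ?thesis by blast
qed

definition rows_of :: "computation \<Rightarrow> nat \<Rightarrow> nat \<Rightarrow> fterm list list" where
  "rows_of \<sigma> k j = map (\<lambda>s. map (\<sigma> s) [0..<k]) [0..<j]"

definition row_atoms :: "nat \<Rightarrow> fterm list list \<Rightarrow> formula \<Rightarrow> (nat \<times> fterm list) list" where
  "row_atoms k rows \<phi> = concat (map (\<lambda>s. map (\<lambda>a.
     (fst a, map (subst (lookup (row_env k (take s rows)))) (snd a))) (preds \<phi>)) [0..<length rows])"

lemma length_rows_of [simp]: "length (rows_of \<sigma> k j) = j"
  by (simp add: rows_of_def)

lemma wf_rows_rows_of: "computation_over \<Sigma> \<sigma> \<Longrightarrow> wf_rows \<Sigma> (rows_of \<sigma> (num_cells \<Sigma>) j)"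
  by (auto simp: wf_rows_def rows_of_def computation_over_def)

lemma row_comp_rows_of: "s < j \<Longrightarrow> c < k \<Longrightarrow> row_comp (rows_of \<sigma> k j) s c = \<sigma> s c"
  by (simp add: row_comp_def rows_of_def lookup_def nth_default_def)

lemma env_cong:
  assumes "computation_over \<Sigma> \<sigma>" and "\<And>s c. s < t \<Longrightarrow> c < num_cells \<Sigma> \<Longrightarrow> \<sigma>' s c = \<sigma> s c"
    and "c < num_cells \<Sigma>"
  shows "env \<sigma>' t c = env \<sigma> t c"
  using assms(2,3)
proof (induction t arbitrary: c)
  case (Suc t)
  have "wf_term \<Sigma> (\<sigma> t c)" using assms(1) Suc.prems by (simp add: computation_over_def)
  then have "subst (env \<sigma>' t) (\<sigma> t c) = subst (env \<sigma> t) (\<sigma> t c)"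
    using Suc wf_term_cells by (intro subst_cong) auto
  then show ?case using Suc.prems by simp
qed simp

lemma wf_formula_preds:
  "wf_formula \<Sigma> \<phi> \<Longrightarrow> (p, ts) \<in> set (preds \<phi>) \<Longrightarrow> \<tau> \<in> set ts \<Longrightarrow> wf_term \<Sigma> \<tau>"
  by (induction \<phi>) auto

lemma wf_formula_updates:
  "wf_formula \<Sigma> \<phi> \<Longrightarrow> (c, \<tau>) \<in> set (updates \<phi>) \<Longrightarrow> c < num_cells \<Sigma> \<and> wf_term \<Sigma> \<tau>"
  by (induction \<phi>) auto

lemma row_env_rows_of:
  assumes \<sigma>: "computation_over \<Sigma> \<sigma>" and "s \<le> j" "c < num_cells \<Sigma>"
  shows "lookup (row_env (num_cells \<Sigma>) (take s (rows_of \<sigma> (num_cells \<Sigma>) j))) c = env \<sigma> s c"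
proof -
  have "env (row_comp (rows_of \<sigma> (num_cells \<Sigma>) j)) s c = env \<sigma> s c"
    using assms by (intro env_cong[OF \<sigma>]) (simp_all add: row_comp_rows_of)
  then show ?thesis using env_row_comp[OF wf_rows_rows_of[OF \<sigma>]] assms(2) by simp
qed

text \<open>Only the instances in \<open>row_atoms\<close> are ever looked up, so \<open>Q\<close>
  has to reflect \<open>P\<close> on those and is otherwise arbitrary. This freedom is used when a
  certificate needs further predicate terms in \<open>Q\<close>.\<close>

lemma lasso_check_complete:
  assumes \<sigma>: "computation_over \<Sigma> \<sigma>" and wf: "wf_formula \<Sigma> \<phi>" and ij: "i < j"
    and ltl: "ltl (\<lambda>t. obs \<sigma> P (lasso i j t)) 0 \<phi>"
    and Q: "\<And>a. a \<in> set (row_atoms (num_cells \<Sigma>) (rows_of \<sigma> (num_cells \<Sigma>) j) \<phi>) \<Longrightarrow>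
      a \<in> set Q \<longleftrightarrow> P (fst a) (snd a)"
  shows "lasso_check \<Sigma> \<phi> (rows_of \<sigma> (num_cells \<Sigma>) j) i Q"
proof -
  let ?k = "num_cells \<Sigma>" and ?rows = "rows_of \<sigma> (num_cells \<Sigma>) j"
  have "agree \<phi> (row_obs ?k ?rows Q s) (obs \<sigma> P s)" if s: "s < j" for s
    unfolding agree_def
  proof (intro conjI ballI; clarify)
    fix p ts assume pts: "(p, ts) \<in> set (preds \<phi>)"
    let ?us = "map (subst (lookup (row_env ?k (take s ?rows)))) ts"
    have "subst (env \<sigma> s) \<tau> = subst (lookup (row_env ?k (take s ?rows))) \<tau>" if "\<tau> \<in> set ts" for \<tau>
      using row_env_rows_of[OF \<sigma> less_imp_le[OF s]] wf_term_cells[OF wf_formula_preds[OF wf pts that]]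
      by (intro subst_cong) simp
    then have us: "map (subst (env \<sigma> s)) ts = ?us" by simp
    have "(p, ?us) \<in> set (row_atoms ?k ?rows \<phi>)"
      using pts s unfolding row_atoms_def by force
    then show "row_obs ?k ?rows Q s (Pred p ts) = obs \<sigma> P s (Pred p ts)"
      using Q by (simp add: row_obs_def us)
  next
    fix c \<tau> assume "(c, \<tau>) \<in> set (updates \<phi>)"
    then have "c < ?k" using wf_formula_updates[OF wf] by blast
    then show "row_obs ?k ?rows Q s (Update c \<tau>) = obs \<sigma> P s (Update c \<tau>)"
      using row_comp_rows_of[OF s, of c ?k \<sigma>] by (simp add: row_obs_def row_comp_def)
  qed
  then have "ltl (\<lambda>t. row_obs ?k ?rows Q (lasso i j t)) 0 \<phi>"
    using ltl ltl_cong[of \<phi> "\<lambda>t. row_obs ?k ?rows Q (lasso i j t)" "\<lambda>t. obs \<sigma> P (lasso i j t)"]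
      lasso_less[OF ij] by blast
  then show ?thesis
    using lasso_table_eq[OF ij le_less_trans[OF le0 ij]] ij wf_rows_rows_of[OF \<sigma>]
    by (simp add: lasso_check_def)
qed

definition closed_check :: "signature \<Rightarrow> formula \<Rightarrow> fterm list list \<Rightarrow> nat \<Rightarrow> (nat \<times> fterm list) list \<Rightarrow> bool" where
  "closed_check \<Sigma> \<phi> rows i Q \<longleftrightarrow> lasso_check \<Sigma> \<phi> rows i Q \<and>
     row_env (num_cells \<Sigma>) (take i rows) = row_env (num_cells \<Sigma>) rows"

text \<open>Since the contents at both ends agree, the unrolled computation has at each time exactly
  the content recorded at its lasso position. The recorded observations are then real ones, with the
  same set of true predicate terms.\<close>

lemma closed_check_sound:
  assumes "closed_check \<Sigma> \<phi> rows i Q"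
  shows "herbrand_sat \<Sigma> \<phi>"
proof -
  let ?j = "length rows" and ?P = "\<lambda>p us. (p, us) \<in> set Q"
  let ?q = "lasso i ?j"
  let ?\<sigma> = "\<lambda>t. row_comp rows (?q t)"
  have check: "lasso_check \<Sigma> \<phi> rows i Q"
    and closed: "row_env (num_cells \<Sigma>) (take i rows) = row_env (num_cells \<Sigma>) rows"
    using assms by (simp_all add: closed_check_def)
  have i: "i < ?j" and wf: "wf_rows \<Sigma> rows" using check by (simp_all add: lasso_check_def)
  have ij: "env (row_comp rows) i = env (row_comp rows) ?j"
    using env_row_comp[OF wf] i closed by simp
  have env: "env ?\<sigma> t = env (row_comp rows) (?q t)" for t
  proof (induction t)
    case (Suc t)
    have "env ?\<sigma> (Suc t) = env (row_comp rows) (Suc (?q t))" using Suc by simp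
    also have "\<dots> = env (row_comp rows) (?q (Suc t))" using ij by (simp del: env.simps)
    finally show ?case .
  qed simp
  have "agree \<phi> (obs ?\<sigma> ?P t) (obs (row_comp rows) ?P (?q t))" for t
    by (auto simp: agree_def env)
  then have "ltl (obs ?\<sigma> ?P) 0 \<phi>" using lasso_check_ltl[OF check]
      ltl_cong[of \<phi> "obs ?\<sigma> ?P" "\<lambda>t. obs (row_comp rows) ?P (?q t)"] by blast
  moreover have "computation_over \<Sigma> ?\<sigma>"
    using row_comp_wf[OF wf] by (simp add: computation_over_def)
  ultimately show ?thesis unfolding herbrand_sat_def by blast
qed

lemma closed_check_complete:
  assumes \<sigma>: "computation_over \<Sigma> \<sigma>" and wf: "wf_formula \<Sigma> \<phi>" and ij: "i < j"
    and ltl: "ltl (\<lambda>t. obs \<sigma> P (lasso i j t)) 0 \<phi>"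
    and closed: "\<And>c. c < num_cells \<Sigma> \<Longrightarrow> env \<sigma> i c = env \<sigma> j c"
  defines "rows \<equiv> rows_of \<sigma> (num_cells \<Sigma>) j"
  shows "closed_check \<Sigma> \<phi> rows i (filter (\<lambda>a. P (fst a) (snd a)) (row_atoms (num_cells \<Sigma>) rows \<phi>))"
proof -
  let ?k = "num_cells \<Sigma>"
  have wf_rows: "wf_rows \<Sigma> rows" unfolding rows_def by (rule wf_rows_rows_of[OF \<sigma>])
  have env: "lookup (row_env ?k (take s rows)) c = env \<sigma> s c" if "s \<le> j" "c < ?k" for s c
    unfolding rows_def using row_env_rows_of[OF \<sigma> that] .
  have len: "length (row_env ?k (take i rows)) = ?k" "length (row_env ?k (take j rows)) = ?k"
    using length_row_env[OF wf_rows_take[OF wf_rows]] by blast+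
  have "row_env ?k (take i rows) = row_env ?k (take j rows)"
  proof (rule nth_equalityI)
    fix c assume "c < length (row_env ?k (take i rows))"
    then have c: "c < ?k" using len by simp
    then have "lookup (row_env ?k (take i rows)) c = lookup (row_env ?k (take j rows)) c"
      using env[of i c] env[of j c] closed[OF c] ij by simp
    then show "row_env ?k (take i rows) ! c = row_env ?k (take j rows) ! c"
      using c len by (simp add: lookup_def nth_default_def)
  qed (simp add: len)
  moreover have "take j rows = rows" by (simp add: rows_def)
  ultimately show ?thesis
    using lasso_check_complete[OF \<sigma> wf ij ltl] by (simp add: closed_check_def rows_def)
qed

section \<open>Freezing the cells after a finite prefix\<close>

definition freeze :: "nat \<Rightarrow> computation \<Rightarrow> computation" where
  "freeze n \<sigma> s = (if s < n then \<sigma> s else Cell)"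

lemma freeze_over: "computation_over \<Sigma> \<sigma> \<Longrightarrow> computation_over \<Sigma> (freeze n \<sigma>)"
  by (simp add: computation_over_def freeze_def)

lemma env_freeze: "s \<le> n \<Longrightarrow> env (freeze n \<sigma>) s = env \<sigma> s"
  by (induction s) (auto simp: freeze_def)

lemma obs_freeze: "s < n \<Longrightarrow> agree \<phi> (obs (freeze n \<sigma>) P s) (obs \<sigma> P s)"
  by (auto simp: agree_def env_freeze) (auto simp: freeze_def)

lemma lasso_Suc: "lasso n (Suc n) t = min t n"
  by (induction t) auto

text \<open>The loop consists of position \<open>n\<close> alone. Its row keeps all cells, so the
  contents at both ends agree. Observations at \<open>n\<close> itself may differ from the original
  ones, which is why the premise looks at times below \<open>n\<close> only.\<close>

lemma freeze_check:
  assumes "computation_over \<Sigma> \<sigma>" "wf_formula \<Sigma> \<phi>"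
    and ltl: "\<And>w. (\<And>s. s < n \<Longrightarrow> agree \<phi> (obs \<sigma> P s) (w s)) \<Longrightarrow> ltl w 0 \<phi>"
  defines "rows \<equiv> rows_of (freeze n \<sigma>) (num_cells \<Sigma>) (Suc n)"
  shows "closed_check \<Sigma> \<phi> rows n (filter (\<lambda>a. P (fst a) (snd a)) (row_atoms (num_cells \<Sigma>) rows \<phi>))"
  unfolding rows_def
proof (rule closed_check_complete[OF freeze_over[OF assms(1)] assms(2)])
  show "ltl (\<lambda>t. obs (freeze n \<sigma>) P (lasso n (Suc n) t)) 0 \<phi>"
  proof (rule ltl)
    fix s assume "s < n"
    then show "agree \<phi> (obs \<sigma> P s) (obs (freeze n \<sigma>) P (lasso n (Suc n) s))"
      using obs_freeze[of s n \<phi> \<sigma> P] by (simp add: lasso_Suc agree_def) fastforce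
  qed
qed (simp_all add: freeze_def)

lemma reachability_complete:
  assumes "reachability_fragment \<phi>" "wf_formula \<Sigma> \<phi>" "herbrand_sat \<Sigma> \<phi>"
  shows "\<exists>rows i Q. closed_check \<Sigma> \<phi> rows i Q"
proof -
  obtain \<sigma> P where \<sigma>: "computation_over \<Sigma> \<sigma>" "ltl (obs \<sigma> P) 0 \<phi>"
    using assms(3) unfolding herbrand_sat_def by blast
  obtain n where "\<forall>w'. (\<forall>s<n. agree \<phi> (obs \<sigma> P s) (w' s)) \<longrightarrow> ltl w' 0 \<phi> = True"
    using reach_pol_finite[of True \<phi> "obs \<sigma> P" 0] assms(1) \<sigma>(2)
    unfolding reachability_fragment_def by blast
  then show ?thesis using freeze_check[OF \<sigma>(1) assms(2), of n P] by blast
qed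

section \<open>Fresh updates\<close>

fun tsize :: "fterm \<Rightarrow> nat" where
  "tsize (Cell c) = 1"
| "tsize (FApp f ts) = Suc (sum_list (map tsize ts))"

text \<open>The length of the leftmost branch. Substitution adds to it the spine of at most one
  content. A constant counts 1, so that every compound term has positive spine and is distinguished
  from a cell modulo a large number.\<close>

fun spine :: "fterm \<Rightarrow> nat" where
  "spine (Cell c) = 0"
| "spine (FApp f []) = 1"
| "spine (FApp f (t # ts)) = Suc (spine t)"

lemma tsize_pos: "0 < tsize \<tau>"
  by (cases \<tau>) auto

lemma spine_le_tsize: "spine \<tau> \<le> tsize \<tau>"
  by (induction \<tau> rule: spine.induct) auto

lemma spine_subst_mod:
  "(\<And>c. c \<in> cells \<tau> \<Longrightarrow> m dvd spine (e c)) \<Longrightarrow> spine (subst e \<tau>) mod m = spine \<tau> mod m"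
proof (induction \<tau> rule: spine.induct)
  case (3 f t ts)
  then have "Suc (spine (subst e t) mod m) mod m = Suc (spine t mod m) mod m" by simp
  then show ?case by (simp only: mod_Suc_eq subst.simps list.map spine.simps)
qed simp_all

lemma spine_subst_le:
  "(\<And>c. c \<in> cells \<tau> \<Longrightarrow> spine (e c) \<le> b) \<Longrightarrow> spine (subst e \<tau>) \<le> tsize \<tau> + b"
proof (induction \<tau> rule: spine.induct)
  case (3 f t ts)
  then have "spine (subst e t) \<le> tsize t + b" by simp
  then show ?case by simp
qed simp_all

lemma tsize_mem: "t \<in> set ts \<Longrightarrow> tsize t < tsize (FApp f ts)"
  by (simp add: le_imp_less_Suc member_le_sum_list)

text \<open>
  Fresh contents have spines that are distinct multiples of some \<open>m\<close>, where all terms in which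
  they are substituted have size below \<open>m\<close>. This makes the substitution injective, since the image
  of a cell and that of a compound term then have spines with different remainders.
\<close>

lemma spine_subst_FApp:
  assumes "\<And>v. v \<in> cells (FApp f us) \<Longrightarrow> m dvd spine (e v)" and "tsize (FApp f us) < m"
  shows "\<not> m dvd spine (subst e (FApp f us))"
proof -
  have "0 < spine (FApp f us)" by (cases us) auto
  moreover have "spine (FApp f us) < m" using spine_le_tsize[of "FApp f us"] assms(2) by linarith
  ultimately have "spine (subst e (FApp f us)) mod m \<noteq> 0"
    using spine_subst_mod[of "FApp f us" m e] assms(1) by simp
  then show ?thesis by (simp only: dvd_eq_mod_eq_0 not_False_eq_True)
qed

lemma subst_inj:
  assumes "\<And>v. v \<in> cells A \<union> cells B \<Longrightarrow> m dvd spine (e v)"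
    and "inj_on e (cells A \<union> cells B)" and "tsize A < m" "tsize B < m"
    and "subst e A = subst e B"
  shows "A = B"
  using assms
proof (induction A arbitrary: B)
  case A: (Cell v)
  show ?case
  proof (cases B)
    case (Cell v')
    have "e v = e v'" using A.prems(5) Cell by simp
    then have "v = v'" by (rule inj_onD[OF A.prems(2)]) (simp_all add: Cell)
    then show ?thesis using Cell by simp
  next
    case (FApp f us)
    have "\<not> m dvd spine (subst e (FApp f us))"
      by (rule spine_subst_FApp) (use A.prems(1,4) in \<open>simp_all add: FApp\<close>)
    moreover have "m dvd spine (subst e (FApp f us))" using A.prems(1)[of v] A.prems(5) FApp by simp
    ultimately show ?thesis by blast
  qed
next
  case A: (FApp f ts)
  show ?case
  proof (cases B)
    case (Cell v')
    have "\<not> m dvd spine (subst e (FApp f ts))"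
      by (rule spine_subst_FApp) (use A.prems(1,3) in simp_all)
    moreover have "m dvd spine (subst e (FApp f ts))"
      using A.prems(1)[of v'] A.prems(5) Cell by simp
    ultimately show ?thesis by blast
  next
    case B: (FApp g us)
    have eq: "f = g" "map (subst e) ts = map (subst e) us" using A.prems(5) B by simp_all
    have "ts = us"
    proof (rule nth_equalityI)
      show len: "length ts = length us" using eq(2) by (rule map_eq_imp_length_eq)
      fix n assume n: "n < length ts"
      then have mem: "ts ! n \<in> set ts" "us ! n \<in> set us" using len by simp_all
      have sub: "cells (ts ! n) \<union> cells (us ! n) \<subseteq> cells (FApp f ts) \<union> cells B"
        using mem B by auto
      show "ts ! n = us ! n"
      proof (rule A.IH[OF mem(1)])
        show "m dvd spine (e v)" if "v \<in> cells (ts ! n) \<union> cells (us ! n)" for v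
          using A.prems(1) sub that by blast
        show "inj_on e (cells (ts ! n) \<union> cells (us ! n))"
          using A.prems(2) sub by (rule inj_on_subset)
        show "tsize (ts ! n) < m" using A.prems(3) tsize_mem[OF mem(1), of f] by linarith
        show "tsize (us ! n) < m" using A.prems(4) tsize_mem[OF mem(2), of g] B by simp
        have "map (subst e) ts ! n = map (subst e) us ! n" using eq(2) by simp
        then show "subst e (ts ! n) = subst e (us ! n)" using n len by simp
      qed
    qed
    then show ?thesis using eq(1) B by simp
  qed
qed

text \<open>All argument places receive the same term. Each layer then lengthens the leftmost branch
  by exactly one, whatever the positive arity of \<open>f\<close> is.\<close>

definition pump :: "nat \<Rightarrow> nat \<Rightarrow> nat \<Rightarrow> fterm \<Rightarrow> fterm" where
  "pump f a n x = rec_nat x (\<lambda>_ y. FApp f (replicate (Suc a) y)) n"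

lemma pump_simps [simp]:
  "pump f a 0 x = x"
  "pump f a (Suc n) x = FApp f (replicate (Suc a) (pump f a n x))"
  by (simp_all add: pump_def)

lemma spine_pump: "spine (pump f a n x) = n + spine x"
  by (induction n) auto

lemma subst_pump: "subst e (pump f a n x) = pump f a n (subst e x)"
  by (induction n) auto

lemma wf_pump:
  "f < length (fun_arities \<Sigma>) \<Longrightarrow> fun_arities \<Sigma> ! f = Suc a \<Longrightarrow> wf_term \<Sigma> x \<Longrightarrow>
    wf_term \<Sigma> (pump f a n x)"
  by (induction n) auto

text \<open>
  Cells from \<open>k\<close> on act as variables: \<open>k + (t * k + c)\<close> stands for the result of the update
  of cell \<open>c\<close> at time \<open>t\<close> if the choice of that update is left open.
\<close>

primrec sym_env :: "nat \<Rightarrow> computation \<Rightarrow> (nat \<Rightarrow> nat) \<Rightarrow> (nat \<Rightarrow> nat \<Rightarrow> bool) \<Rightarrow> nat \<Rightarrow> nat \<Rightarrow> fterm" where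
  "sym_env k \<sigma> q free 0 = Cell"
| "sym_env k \<sigma> q free (Suc t) = (\<lambda>c. if free t c then Cell (k + (t * k + c))
     else subst (sym_env k \<sigma> q free t) (\<sigma> (q t) c))"

lemma cells_subst: "cells (subst e \<tau>) = (\<Union>c \<in> cells \<tau>. cells (e c))"
  by (induction \<tau>) auto

text \<open>Covers two uses: \<open>q\<close> is the identity on a bounded range \<open>R\<close> of
  times, or \<open>q\<close> runs through a lasso for all times. By \<open>step\<close>,
  \<open>q\<close> may jump only at times when every cell is free, so that no content has to be
  carried across the jump. \<open>M\<close> bounds the contents as symbolic terms, the predicate
  terms over them, and the mentioned updates.\<close>

locale fresh_updates =
  fixes \<Sigma> :: signature and \<phi> :: formula and \<sigma> :: computation
    and P :: "nat \<Rightarrow> fterm list \<Rightarrow> bool" and q :: "nat \<Rightarrow> nat"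
    and free :: "nat \<Rightarrow> nat \<Rightarrow> bool" and R :: "nat \<Rightarrow> bool" and M f a k :: nat
  assumes k: "k = num_cells \<Sigma>"
    and wf: "wf_formula \<Sigma> \<phi>" and over: "computation_over \<Sigma> \<sigma>"
    and f: "f < length (fun_arities \<Sigma>)" "fun_arities \<Sigma> ! f = Suc a"
    and q0: "q 0 = 0" and R_Suc: "R (Suc t) \<Longrightarrow> R t"
    and step: "R (Suc t) \<Longrightarrow> c < k \<Longrightarrow> \<not> free t c \<Longrightarrow> q (Suc t) = Suc (q t)"
    and free: "R t \<Longrightarrow> c < k \<Longrightarrow> free t c \<Longrightarrow> (c, \<sigma> (q t) c) \<notin> set (updates \<phi>)"
    and M_env: "R t \<Longrightarrow> c < k \<Longrightarrow> tsize (sym_env k \<sigma> q free t c) \<le> M"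
    and M_pred: "R t \<Longrightarrow> (p, ts) \<in> set (preds \<phi>) \<Longrightarrow> \<tau> \<in> set ts \<Longrightarrow>
      tsize (subst (sym_env k \<sigma> q free t) \<tau>) \<le> M"
    and M_update: "(c, \<tau>) \<in> set (updates \<phi>) \<Longrightarrow> tsize \<tau> \<le> M"
begin

abbreviation "E \<equiv> sym_env k \<sigma> q free"

text \<open>The prescribed spine of the fresh content: a different multiple of \<open>M + 1\<close>
  for each time and cell. The factor 2 leaves room to reach it from the content of cell 0, whose
  spine is at most \<open>M + (M + 1) * (2 * (t * k))\<close>, by more than \<open>M\<close> layers,
  so that the update itself is too deep to be a mentioned one.\<close>

definition target :: "nat \<Rightarrow> nat \<Rightarrow> nat" where
  "target t c = (M + 1) * (2 * (t * k + c + 1))"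

primrec fresh_env :: "nat \<Rightarrow> nat \<Rightarrow> fterm" where
  "fresh_env 0 = Cell"
| "fresh_env (Suc t) = (\<lambda>c. if free t c
     then pump f a (target t c - spine (fresh_env t 0)) (fresh_env t 0)
     else subst (fresh_env t) (\<sigma> (q t) c))"

definition fresh_comp :: computation where
  "fresh_comp t c = (if free t c then pump f a (target t c - spine (fresh_env t 0)) (Cell 0)
     else \<sigma> (q t) c)"

lemma env_fresh_comp: "env fresh_comp t = fresh_env t"
  by (induction t) (auto simp: fresh_comp_def subst_pump)

lemma fresh_comp_over: "computation_over \<Sigma> fresh_comp"
  using over unfolding computation_over_def fresh_comp_def by (auto intro!: wf_pump f)

text \<open>Time and cell of a variable are recovered by division. \<open>old\<close> and
  \<open>new\<close> are two instances of the same symbolic contents: they lead to the original and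
  to the fresh execution.\<close>

definition old :: "nat \<Rightarrow> fterm" where
  "old v = (if v < k then Cell v else env \<sigma> (q (Suc ((v - k) div k))) ((v - k) mod k))"

definition new :: "nat \<Rightarrow> fterm" where
  "new v = (if v < k then Cell v else fresh_env (Suc ((v - k) div k)) ((v - k) mod k))"

text \<open>Only variables introduced by a free update have the spine prescribed by
  \<open>target\<close>; these and the initial cells are the ones that symbolic contents
  contain.\<close>

definition live :: "nat \<Rightarrow> nat \<Rightarrow> bool" where
  "live t v \<longleftrightarrow> v < k \<or> (\<exists>s c. s < t \<and> c < k \<and> free s c \<and> v = k + (s * k + c))"

lemma old_var: "c < k \<Longrightarrow> old (k + (t * k + c)) = env \<sigma> (q (Suc t)) c"
  by (simp add: old_def)

lemma new_var: "c < k \<Longrightarrow> new (k + (t * k + c)) = fresh_env (Suc t) c"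
  by (simp add: new_def del: fresh_env.simps)

lemma update_cells: "c < k \<Longrightarrow> v \<in> cells (\<sigma> t c) \<Longrightarrow> v < k"
  using over wf_term_cells k unfolding computation_over_def by blast

lemma live_Suc: "live t v \<Longrightarrow> live (Suc t) v"
  unfolding live_def using less_SucI by blast

lemma live_E: "c < k \<Longrightarrow> v \<in> cells (E t c) \<Longrightarrow> live t v"
proof (induction t arbitrary: c v)
  case (Suc t)
  show ?case
  proof (cases "free t c")
    case True
    then show ?thesis using Suc.prems by (auto simp: live_def)
  next
    case False
    then obtain c' where "c' \<in> cells (\<sigma> (q t) c)" "v \<in> cells (E t c')"
      using Suc.prems by (auto simp: cells_subst)
    then show ?thesis using Suc.IH[of c' v] update_cells Suc.prems live_Suc by blast
  qed
qed (simp add: live_def)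

text \<open>A free update yields a variable whose original value is by definition the content at
  \<open>q (Suc t)\<close>, so a jump of \<open>q\<close> does no harm. If the update is kept,
  \<open>q\<close> advances by one and the original computation performs the same update.\<close>

lemma subst_old: "R t \<Longrightarrow> c < k \<Longrightarrow> subst old (E t c) = env \<sigma> (q t) c"
proof (induction t arbitrary: c)
  case 0
  then show ?case by (simp add: old_def q0)
next
  case (Suc t)
  show ?case
  proof (cases "free t c")
    case True
    then show ?thesis using old_var Suc.prems by simp
  next
    case False
    have "subst old (E (Suc t) c) = subst (\<lambda>c. subst old (E t c)) (\<sigma> (q t) c)"
      using False by (simp add: subst_subst)
    also have "\<dots> = subst (env \<sigma> (q t)) (\<sigma> (q t) c)"
      using Suc.IH R_Suc[OF Suc.prems(1)] update_cells[OF Suc.prems(2)] by (intro subst_cong) blast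
    also have "\<dots> = env \<sigma> (q (Suc t)) c" using step[OF Suc.prems False] by simp
    finally show ?thesis .
  qed
qed

lemma subst_new: "c < k \<Longrightarrow> subst new (E t c) = fresh_env t c"
proof (induction t arbitrary: c)
  case 0
  then show ?case by (simp add: new_def)
next
  case (Suc t)
  show ?case
  proof (cases "free t c")
    case True
    then show ?thesis using new_var Suc.prems by simp
  next
    case False
    have "subst new (E (Suc t) c) = subst (\<lambda>c. subst new (E t c)) (\<sigma> (q t) c)"
      using False by (simp add: subst_subst)
    also have "\<dots> = subst (fresh_env t) (\<sigma> (q t) c)"
      using Suc.IH update_cells[OF Suc.prems] by (intro subst_cong) blast
    also have "\<dots> = fresh_env (Suc t) c" using False by simp
    finally show ?thesis .
  qed
qed

lemma live_index: "live t v \<Longrightarrow> \<not> v < k \<Longrightarrow> v - k + 1 \<le> t * k"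
proof -
  assume "live t v" "\<not> v < k"
  then obtain s c where *: "s < t" "c < k" "v = k + (s * k + c)" by (auto simp: live_def)
  have "s * k + c + 1 \<le> Suc s * k" using * by simp
  also have "\<dots> \<le> t * k" using * by (intro mult_right_mono) auto
  finally show ?thesis using * by simp
qed

text \<open>The two claims need each other. Pumping hits its target only if cell 0 is not yet too
  deep, and the depth of cell 0 is bounded by its symbolic size, at most \<open>M\<close>, plus the
  largest spine of a live variable.\<close>

lemma spine_new_aux:
  assumes "R t"
  shows "(\<forall>v. live t v \<longrightarrow> spine (new v) = (if v < k then 0 else (M + 1) * (2 * (v - k + 1)))) \<and>
    (0 < k \<longrightarrow> spine (fresh_env t 0) \<le> M + (M + 1) * (2 * (t * k)))"
  using assms
proof (induction t)
  case 0
  show ?case by (auto simp: live_def new_def)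
next
  case (Suc t)
  have R: "R t" using Suc.prems R_Suc by blast
  have new: "spine (new v) = (if v < k then 0 else (M + 1) * (2 * (v - k + 1)))"
    if live: "live (Suc t) v" for v
  proof (cases "live t v")
    case True
    then show ?thesis using Suc.IH R by blast
  next
    case False
    then obtain c where c: "c < k" "free t c" "v = k + (t * k + c)"
      using live by (auto simp: live_def less_Suc_eq)
    have "spine (fresh_env t 0) \<le> M + (M + 1) * (2 * (t * k))" using Suc.IH R c by simp
    also have "\<dots> \<le> target t c" by (simp add: target_def algebra_simps)
    finally have "spine (fresh_env (Suc t) c) = target t c" using c by (simp add: spine_pump)
    then show ?thesis using c new_var[OF c(1), of t] by (simp add: target_def)
  qed
  have "spine (fresh_env (Suc t) 0) \<le> M + (M + 1) * (2 * (Suc t * k))" if "0 < k"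
  proof -
    have "spine (new v) \<le> (M + 1) * (2 * (Suc t * k))" if "live (Suc t) v" for v
    proof (cases "v < k")
      case False
      have "(M + 1) * (2 * (v - k + 1)) \<le> (M + 1) * (2 * (Suc t * k))"
        using live_index[OF that False] by (intro mult_left_mono) simp_all
      then show ?thesis using new[OF that] False by simp
    qed (use new[OF that] in simp)
    then have "spine (subst new (E (Suc t) 0)) \<le> tsize (E (Suc t) 0) + (M + 1) * (2 * (Suc t * k))"
      using live_E[OF that] by (intro spine_subst_le) blast
    then have "spine (fresh_env (Suc t) 0) \<le> tsize (E (Suc t) 0) + (M + 1) * (2 * (Suc t * k))"
      using subst_new[OF that, of "Suc t"] by (simp only:)
    also have "\<dots> \<le> M + (M + 1) * (2 * (Suc t * k))"
      using M_env[OF Suc.prems that] by (rule add_right_mono)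
    finally show ?thesis .
  qed
  with new show ?case by blast
qed

lemma spine_new: "R t \<Longrightarrow> live t v \<Longrightarrow> spine (new v) = (if v < k then 0 else (M + 1) * (2 * (v - k + 1)))"
  and spine_fresh_env: "R t \<Longrightarrow> 0 < k \<Longrightarrow> spine (fresh_env t 0) \<le> M + (M + 1) * (2 * (t * k))"
  using spine_new_aux by blast+

lemma dvd_spine_new: "R t \<Longrightarrow> live t v \<Longrightarrow> M + 1 dvd spine (new v)"
  by (cases "v < k") (simp_all only: spine_new if_True if_False dvd_triv_left dvd_0_right)

lemma new_inject:
  assumes "R t" "live t v" "R s" "live s w" "new v = new w"
  shows "v = w"
proof -
  have eq: "(if v < k then 0 else (M + 1) * (2 * (v - k + 1))) =
      (if w < k then 0 else (M + 1) * (2 * (w - k + 1)))"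
    using spine_new[OF assms(1,2)] spine_new[OF assms(3,4)] assms(5) by simp
  consider "v < k" "w < k" | "\<not> v < k" "\<not> w < k" using eq by (cases "v < k"; cases "w < k") auto
  then show ?thesis
  proof cases
    case 1
    then show ?thesis using assms(5) by (simp add: new_def)
  next
    case 2
    then have "(M + 1) * (2 * (v - k + 1)) = (M + 1) * (2 * (w - k + 1))" using eq by simp
    then have "2 * (v - k + 1) = 2 * (w - k + 1)" by (subst (asm) nat_mult_eq_cancel1) simp_all
    then have "v - k = w - k" by simp
    then show ?thesis using 2 by linarith
  qed
qed

text \<open>Equal fresh instances come from equal symbolic terms, because \<open>new\<close> is
  injective on live variables and the symbolic terms are smaller than \<open>M + 1\<close>.
  Instantiating the common symbolic terms by \<open>old\<close> gives the original equality, so the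
  truth values can be copied.\<close>

lemma pred_consistent:
  assumes R: "R t" "R s" and ts: "(p, ts) \<in> set (preds \<phi>)" "(p, us) \<in> set (preds \<phi>)"
    and eq: "map (subst (fresh_env t)) ts = map (subst (fresh_env s)) us"
  shows "map (subst (env \<sigma> (q t))) ts = map (subst (env \<sigma> (q s))) us"
proof -
  have cells: "c < k" if "(p, ts) \<in> set (preds \<phi>)" "\<tau> \<in> set ts" "c \<in> cells \<tau>" for ts \<tau> c
    using wf_term_cells[OF wf_formula_preds[OF wf that(1,2)] that(3)] k by simp
  have new: "subst (fresh_env t) \<tau> = subst new (subst (E t) \<tau>)"
    if "(p, ts) \<in> set (preds \<phi>)" "\<tau> \<in> set ts" for t \<tau> ts
    unfolding subst_subst using cells[OF that] subst_new by (intro subst_cong) simp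
  have old: "subst (env \<sigma> (q t)) \<tau> = subst old (subst (E t) \<tau>)"
    if "R t" "(p, ts) \<in> set (preds \<phi>)" "\<tau> \<in> set ts" for t \<tau> ts
    unfolding subst_subst using cells[OF that(2,3)] subst_old[OF that(1)] by (intro subst_cong) simp
  have live: "live t v" if "(p, ts) \<in> set (preds \<phi>)" "\<tau> \<in> set ts" "v \<in> cells (subst (E t) \<tau>)" for t \<tau> ts v
    using that(3) cells[OF that(1,2)] live_E by (auto simp: cells_subst)
  have len: "length ts = length us" using eq by (rule map_eq_imp_length_eq)
  show ?thesis
  proof (rule nth_equalityI)
    fix n assume "n < length (map (subst (env \<sigma> (q t))) ts)"
    then have n: "n < length ts" by simp
    then have mem: "ts ! n \<in> set ts" "us ! n \<in> set us" using len by auto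
    have "subst (E t) (ts ! n) = subst (E s) (us ! n)"
    proof (rule subst_inj[where m = "M + 1" and e = new])
      show "M + 1 dvd spine (new v)" if "v \<in> cells (subst (E t) (ts ! n)) \<union> cells (subst (E s) (us ! n))" for v
        using that live[OF ts(1) mem(1)] live[OF ts(2) mem(2)] dvd_spine_new R by blast
      show "inj_on new (cells (subst (E t) (ts ! n)) \<union> cells (subst (E s) (us ! n)))"
        using live[OF ts(1) mem(1)] live[OF ts(2) mem(2)] new_inject R by (intro inj_onI) blast
      show "tsize (subst (E t) (ts ! n)) < M + 1" using M_pred[OF R(1) ts(1) mem(1)] by simp
      show "tsize (subst (E s) (us ! n)) < M + 1" using M_pred[OF R(2) ts(2) mem(2)] by simp
      have "map (subst (fresh_env t)) ts ! n = map (subst (fresh_env s)) us ! n" using eq by simp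
      then show "subst new (subst (E t) (ts ! n)) = subst new (subst (E s) (us ! n))"
        using n len new[OF ts(1) mem(1)] new[OF ts(2) mem(2)] by simp
    qed
    then show "map (subst (env \<sigma> (q t))) ts ! n = map (subst (env \<sigma> (q s))) us ! n"
      using n len old[OF R(1) ts(1) mem(1)] old[OF R(2) ts(2) mem(2)] by simp
  qed (simp add: len)
qed

lemma fresh_comp_agree:
  "\<exists>P'. \<forall>t. R t \<longrightarrow> agree \<phi> (obs fresh_comp P' t) (obs \<sigma> P (q t))"
proof -
  \<comment> \<open>A predicate term is made true if some occurrence of it is true in the original;
    \<open>pred_consistent\<close> makes this independent of the occurrence.\<close>
  define P' where "P' p us \<longleftrightarrow> (\<exists>t ts. R t \<and> (p, ts) \<in> set (preds \<phi>) \<and>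
    us = map (subst (fresh_env t)) ts \<and> P p (map (subst (env \<sigma> (q t))) ts))" for p us
  have "agree \<phi> (obs fresh_comp P' t) (obs \<sigma> P (q t))" if R: "R t" for t
    unfolding agree_def
  proof (intro conjI ballI; clarify)
    fix p ts assume ts: "(p, ts) \<in> set (preds \<phi>)"
    have "P' p (map (subst (fresh_env t)) ts) \<longleftrightarrow> P p (map (subst (env \<sigma> (q t))) ts)"
    proof
      assume "P' p (map (subst (fresh_env t)) ts)"
      then obtain s us where *: "R s" "(p, us) \<in> set (preds \<phi>)"
        "map (subst (fresh_env t)) ts = map (subst (fresh_env s)) us"
        "P p (map (subst (env \<sigma> (q s))) us)" unfolding P'_def by blast
      then show "P p (map (subst (env \<sigma> (q t))) ts)" using pred_consistent[OF R *(1) ts *(2,3)] by simp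
    qed (use R ts in \<open>unfold P'_def, blast\<close>)
    then show "obs fresh_comp P' t (Pred p ts) = obs \<sigma> P (q t) (Pred p ts)"
      by (simp add: env_fresh_comp)
  next
    fix c \<tau> assume u: "(c, \<tau>) \<in> set (updates \<phi>)"
    then have c: "c < k" using wf_formula_updates[OF wf] k by blast
    show "obs fresh_comp P' t (Update c \<tau>) = obs \<sigma> P (q t) (Update c \<tau>)"
    proof (cases "free t c")
      case True
      have "spine (fresh_env t 0) \<le> M + (M + 1) * (2 * (t * k))" using spine_fresh_env[OF R] c by simp
      \<comment> \<open>This depth keeps the replacement different from every mentioned update. The
        replaced update was unmentioned as well, so all update atoms keep their values.\<close>
      then have "M < target t c - spine (fresh_env t 0)" by (simp add: target_def algebra_simps)
      then have "M < spine (fresh_comp t c)" using True by (simp add: fresh_comp_def spine_pump)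
      then have "fresh_comp t c \<noteq> \<tau>" using M_update[OF u] spine_le_tsize[of \<tau>] by auto
      then show ?thesis using free[OF R c True] u by auto
    qed (simp add: fresh_comp_def)
  qed
  then show ?thesis by blast
qed

end

section \<open>Size bounds and lassos with a fresh content in each round\<close>

lemma tsize_subst_le:
  assumes "\<And>c. c \<in> cells \<tau> \<Longrightarrow> tsize (e c) \<le> b" "1 \<le> b"
  shows "tsize (subst e \<tau>) \<le> tsize \<tau> * b"
  using assms
proof (induction \<tau>)
  case (FApp f ts)
  have "tsize (subst e t) \<le> tsize t * b" if "t \<in> set ts" for t
    using FApp that by auto
  then have "sum_list (map (\<lambda>t. tsize (subst e t)) ts) \<le> sum_list (map (\<lambda>t. tsize t * b) ts)"
    by (intro sum_list_mono)
  also have "\<dots> = sum_list (map tsize ts) * b" by (simp add: sum_list_mult_const)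
  finally show ?case using FApp.prems by (simp add: comp_def)
qed auto

definition fsize :: "formula \<Rightarrow> nat" where
  "fsize \<phi> = Suc (sum_list (map (\<lambda>a. tsize (snd a)) (updates \<phi>)) +
     sum_list (map (\<lambda>a. sum_list (map tsize (snd a))) (preds \<phi>)))"

lemma fsize_update: "(c, \<tau>) \<in> set (updates \<phi>) \<Longrightarrow> tsize \<tau> \<le> fsize \<phi>"
  using member_le_sum_list[of "tsize \<tau>" "map (\<lambda>a. tsize (snd a)) (updates \<phi>)"]
  by (force simp: fsize_def)

lemma fsize_pred: "(p, ts) \<in> set (preds \<phi>) \<Longrightarrow> sum_list (map tsize ts) < fsize \<phi>"
  using member_le_sum_list[of "sum_list (map tsize ts)" "map (\<lambda>a. sum_list (map tsize (snd a))) (preds \<phi>)"]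
  by (force simp: fsize_def)

lemma fsize_pred_mem: "(p, ts) \<in> set (preds \<phi>) \<Longrightarrow> \<tau> \<in> set ts \<Longrightarrow> tsize \<tau> \<le> fsize \<phi>"
  using fsize_pred[of p ts \<phi>] member_le_sum_list[of "tsize \<tau>" "map tsize ts"] by force

lemma sym_env_size:
  assumes over: "computation_over \<Sigma> \<sigma>" and b: "1 \<le> b"
    and le: "\<And>s c. s < t \<Longrightarrow> c < num_cells \<Sigma> \<Longrightarrow> \<not> free s c \<Longrightarrow> tsize (\<sigma> (q s) c) \<le> b"
    and "c < num_cells \<Sigma>"
  shows "tsize (sym_env (num_cells \<Sigma>) \<sigma> q free t c) \<le> b ^ t"
  using le assms(4)
proof (induction t arbitrary: c)
  case (Suc t)
  show ?case
  proof (cases "free t c")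
    case True
    then show ?thesis using b by simp
  next
    case False
    have "wf_term \<Sigma> (\<sigma> (q t) c)" using over Suc.prems by (simp add: computation_over_def)
    then have "tsize (subst (sym_env (num_cells \<Sigma>) \<sigma> q free t) (\<sigma> (q t) c)) \<le> tsize (\<sigma> (q t) c) * b ^ t"
      using Suc wf_term_cells b by (intro tsize_subst_le) auto
    also have "\<dots> \<le> b * b ^ t" using Suc.prems False by (intro mult_right_mono) auto
    finally show ?thesis using False by simp
  qed
qed simp

text \<open>The row at \<open>length rows - 1\<close> is the update that leads back to the start of
  the loop; being unmentioned, it may be replaced in each round by a new fresh update.\<close>

definition fresh_check :: "signature \<Rightarrow> formula \<Rightarrow> fterm list list \<Rightarrow> nat \<Rightarrow> (nat \<times> fterm list) list \<Rightarrow> bool" where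
  "fresh_check \<Sigma> \<phi> rows i Q \<longleftrightarrow> lasso_check \<Sigma> \<phi> rows i Q \<and> num_cells \<Sigma> = 1 \<and>
     (\<exists>a \<in> set (fun_arities \<Sigma>). 0 < a) \<and>
     (0, lookup (nth_default [] rows (length rows - 1)) 0) \<notin> set (updates \<phi>)"

lemma fsize_pos: "1 \<le> fsize \<phi>"
  by (simp add: fsize_def)

lemma positive_arity:
  assumes "\<exists>a \<in> set ns. 0 < (a :: nat)"
  obtains f a where "f < length ns" "ns ! f = Suc a"
proof -
  obtain n where n: "n \<in> set ns" "0 < n" using assms by blast
  then obtain f where "f < length ns" "ns ! f = n" by (auto simp: in_set_conv_nth)
  then show ?thesis using that[of f "n - 1"] n(2) by simp
qed

lemma wf_term_constant:
  assumes "\<not> (\<exists>a \<in> set (fun_arities \<Sigma>). 0 < a)" and \<tau>: "wf_term \<Sigma> \<tau>"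
  shows "\<tau> \<in> Cell ` {..<num_cells \<Sigma>} \<union> (\<lambda>f. FApp f []) ` {..<length (fun_arities \<Sigma>)}"
proof (cases \<tau>)
  case (Cell c)
  then show ?thesis using \<tau> by simp
next
  case (FApp f ts)
  have "wf_term \<Sigma> (FApp f ts)" using \<tau> FApp by (simp only:)
  then have f: "f < length (fun_arities \<Sigma>)" "length ts = fun_arities \<Sigma> ! f" by simp_all
  have "\<not> 0 < fun_arities \<Sigma> ! f" using assms(1) nth_mem[OF f(1)] by (meson bexI)
  then have "length ts = 0" unfolding f(2) by (simp only: not_gr0)
  then show ?thesis using FApp f(1) by simp
qed

lemma agree_trans: "agree \<phi> x y \<Longrightarrow> agree \<phi> x z \<Longrightarrow> agree \<phi> y z"
  unfolding agree_def case_prod_unfold by blast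

text \<open>The locale is used with \<open>q\<close> the lasso and the update at the wrap as the
  only free one. With a single cell all cells are free there, so the jump of \<open>q\<close> is
  permitted.\<close>

lemma fresh_check_sound:
  assumes wf: "wf_formula \<Sigma> \<phi>" and check: "fresh_check \<Sigma> \<phi> rows i Q"
  shows "herbrand_sat \<Sigma> \<phi>"
proof -
  define j where "j = length rows"
  define \<sigma> where "\<sigma> = row_comp rows"
  define q where "q = lasso i j"
  define free where "free t c \<longleftrightarrow> c = 0 \<and> Suc (q t) = j" for t c :: nat
  define b where "b = fsize \<phi> + (\<Sum>s<j. tsize (\<sigma> s 0))"
  define P where "P = (\<lambda>p us. (p, us) \<in> set Q)"
  have lc: "lasso_check \<Sigma> \<phi> rows i Q" and one: "num_cells \<Sigma> = 1"
    and fresh: "(0, \<sigma> (j - 1) 0) \<notin> set (updates \<phi>)"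
    using check by (simp_all add: fresh_check_def \<sigma>_def row_comp_def j_def)
  have ij: "i < j" and wfr: "wf_rows \<Sigma> rows" using lc by (simp_all add: lasso_check_def j_def)
  obtain f a where f: "f < length (fun_arities \<Sigma>)" "fun_arities \<Sigma> ! f = Suc a"
    using check positive_arity[of "fun_arities \<Sigma>"] unfolding fresh_check_def by blast
  have over: "computation_over \<Sigma> \<sigma>"
    using row_comp_wf[OF wfr] by (simp add: computation_over_def \<sigma>_def)
  have b1: "1 \<le> b" using fsize_pos[of \<phi>] by (simp add: b_def)
  have b_le: "tsize (\<sigma> s 0) \<le> b" if "s < j" for s
    using member_le_sum[of s "{..<j}" "\<lambda>s. tsize (\<sigma> s 0)"] that by (simp add: b_def)
  \<comment> \<open>Each wrap restarts the symbolic content at a variable. The bound thus depends on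
    the lasso position and not on the time, and one \<open>M\<close> serves for infinitely many
    rounds.\<close>
  have size: "tsize (sym_env 1 \<sigma> q free t 0) \<le> b ^ q t" for t
  proof (induction t)
    case (Suc t)
    show ?case
    proof (cases "free t 0")
      case True
      then show ?thesis using b1 by simp
    next
      case False
      have lt: "q t < j" unfolding q_def by (rule lasso_less[OF ij])
      have "cells (\<sigma> (q t) 0) \<subseteq> {0}"
        using over one wf_term_cells[of \<Sigma> "\<sigma> (q t) 0"] by (auto simp: computation_over_def)
      then have "tsize (subst (sym_env 1 \<sigma> q free t) (\<sigma> (q t) 0)) \<le> tsize (\<sigma> (q t) 0) * b ^ q t"
        using Suc b1 by (intro tsize_subst_le) auto
      also have "\<dots> \<le> b * b ^ q t" using b_le[OF lt] by (rule mult_right_mono) simp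
      also have "\<dots> = b ^ q (Suc t)" using False by (simp add: free_def q_def)
      finally show ?thesis using False by simp
    qed
  qed (simp add: q_def)
  have size_j: "tsize (sym_env 1 \<sigma> q free t 0) \<le> b ^ j" for t
  proof -
    have "b ^ q t \<le> b ^ j" using b1 lasso_less[OF ij, of t] by (intro power_increasing) (auto simp: q_def)
    then show ?thesis using size[of t] by linarith
  qed
  have pow: "b ^ j \<le> b ^ Suc j" "b \<le> b ^ Suc j" using b1 by simp_all
  \<comment> \<open>The additional factor \<open>b\<close> pays for substituting the content into
    the predicate terms of the formula.\<close>
  interpret fresh_updates \<Sigma> \<phi> \<sigma> P q free "\<lambda>_. True" "b ^ Suc j" f a 1
  proof
    show "q 0 = 0" by (simp add: q_def)
    show "q (Suc t) = Suc (q t)" if "c < 1" "\<not> free t c" for t c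
      using that by (simp add: free_def q_def)
    show "(c, \<sigma> (q t) c) \<notin> set (updates \<phi>)" if "c < 1" "free t c" for t c
    proof -
      have "q t = j - 1" "c = 0" using that by (simp_all add: free_def)
      then show ?thesis using fresh by simp
    qed
    show "tsize (sym_env 1 \<sigma> q free t c) \<le> b ^ Suc j" if "c < 1" for t c
      using order_trans[OF size_j[of t] pow(1)] that by simp
    show "tsize (subst (sym_env 1 \<sigma> q free t) \<tau>) \<le> b ^ Suc j"
      if "(p, ts) \<in> set (preds \<phi>)" "\<tau> \<in> set ts" for t p ts \<tau>
    proof -
      have "cells \<tau> \<subseteq> {0}" using wf_term_cells[OF wf_formula_preds[OF wf that]] one by auto
      then have "tsize (subst (sym_env 1 \<sigma> q free t) \<tau>) \<le> tsize \<tau> * b ^ j"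
        using size_j[of t] b1 by (intro tsize_subst_le) auto
      also have "\<dots> \<le> b * b ^ j"
        using fsize_pred_mem[OF that] by (intro mult_right_mono) (auto simp: b_def)
      finally show ?thesis by simp
    qed
    show "tsize \<tau> \<le> b ^ Suc j" if "(c, \<tau>) \<in> set (updates \<phi>)" for c \<tau>
    proof -
      have "tsize \<tau> \<le> b" using fsize_update[OF that] by (simp add: b_def)
      then show ?thesis using pow(2) by (rule order_trans)
    qed
  qed (use one wf over f in simp_all)
  obtain P' where P': "\<And>t. agree \<phi> (obs fresh_comp P' t) (obs \<sigma> P (q t))"
    using fresh_comp_agree by blast
  have "ltl (\<lambda>t. obs \<sigma> P (q t)) 0 \<phi>"
    using lasso_check_ltl[OF lc] by (simp add: \<sigma>_def P_def q_def j_def)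
  moreover have "ltl (obs fresh_comp P') 0 \<phi> = ltl (\<lambda>t. obs \<sigma> P (q t)) 0 \<phi>"
    using P' by (rule ltl_cong)
  ultimately show ?thesis using fresh_comp_over unfolding herbrand_sat_def by blast
qed

lemma fresh_check_complete:
  assumes over: "computation_over \<Sigma> \<sigma>" and wf: "wf_formula \<Sigma> \<phi>" and ltl: "ltl (obs \<sigma> P) 0 \<phi>"
    and one: "num_cells \<Sigma> = 1" and a: "\<exists>a \<in> set (fun_arities \<Sigma>). 0 < a"
    and inf: "infinite {t. (0, \<sigma> t 0) \<notin> set (updates \<phi>)}"
  shows "\<exists>rows i Q. fresh_check \<Sigma> \<phi> rows i Q"
proof -
  let ?S = "{t. (0, \<sigma> t 0) \<notin> set (updates \<phi>)}"
  \<comment> \<open>The end of the loop is sought right after an unmentioned update, so that the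
    last update of the loop is unmentioned.\<close>
  have "infinite (Suc ` ?S)" using inf by (simp add: finite_image_iff)
  then obtain i where i: "\<forall>N. \<exists>j \<in> Suc ` ?S. N < j \<and> i < j \<and>
      ltl (\<lambda>t. obs \<sigma> P (lasso i j t)) 0 \<phi> = ltl (obs \<sigma> P) 0 \<phi>"
    using lasso_exists[of "Suc ` ?S" "obs \<sigma> P" \<phi>] by blast
  from i[rule_format, of 0] obtain s where s: "(0, \<sigma> s 0) \<notin> set (updates \<phi>)" "i < Suc s"
    "ltl (\<lambda>t. obs \<sigma> P (lasso i (Suc s) t)) 0 \<phi>" using ltl by blast
  have "lookup (nth_default [] (rows_of \<sigma> 1 (Suc s)) s) 0 = \<sigma> s 0"
    using row_comp_rows_of[of s "Suc s" 0 1 \<sigma>] by (simp add: row_comp_def)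
  then have "fresh_check \<Sigma> \<phi> (rows_of \<sigma> 1 (Suc s)) i
      (filter (\<lambda>a. P (fst a) (snd a)) (row_atoms 1 (rows_of \<sigma> 1 (Suc s)) \<phi>))"
    using lasso_check_complete[OF over wf s(2,3)] s(1) one a by (simp add: fresh_check_def)
  then show ?thesis by blast
qed

lemma closed_check_recurrent:
  assumes over: "computation_over \<Sigma> \<sigma>" and wf: "wf_formula \<Sigma> \<phi>" and ltl: "ltl (obs \<sigma> P) 0 \<phi>"
    and one: "num_cells \<Sigma> = 1" and inf: "infinite {t. env \<sigma> t 0 = x}"
  shows "\<exists>rows i Q. closed_check \<Sigma> \<phi> rows i Q"
proof -
  let ?S = "{t. env \<sigma> t 0 = x}"
  obtain i where i: "i \<in> ?S" "\<forall>N. \<exists>j \<in> ?S. N < j \<and> i < j \<and>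
      ltl (\<lambda>t. obs \<sigma> P (lasso i j t)) 0 \<phi> = ltl (obs \<sigma> P) 0 \<phi>"
    using lasso_exists[OF inf, of "obs \<sigma> P" \<phi>] by blast
  from i(2)[rule_format, of 0] obtain j where j: "j \<in> ?S" "i < j" "ltl (\<lambda>t. obs \<sigma> P (lasso i j t)) 0 \<phi>"
    using ltl by blast
  have "env \<sigma> i c = env \<sigma> j c" if "c < num_cells \<Sigma>" for c using that i(1) j(1) one by simp
  then show ?thesis using closed_check_complete[OF over wf j(2,3)] by blast
qed

section \<open>Formulas with at most one top-level eventually\<close>

text \<open>The power is the \<open>M\<close> used in \<open>small_model\<close>; the rest bounds
  \<open>target\<close> for all times up to \<open>next_depth \<phi>\<close> and all cells.\<close>

definition fresh_bound :: "signature \<Rightarrow> formula \<Rightarrow> nat" where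
  "fresh_bound \<Sigma> \<phi> = (fsize \<phi> ^ (next_depth \<phi> + 2) + 1) *
     (2 * (next_depth \<phi> * num_cells \<Sigma> + num_cells \<Sigma> + 1))"

text \<open>Cells and constants exhaust the terms if no function symbol has an argument; otherwise
  mentioned updates and pumped cells suffice. For a constant symbol the truncated arity makes
  \<open>pump\<close> ill-formed, which is harmless since the rows are checked for
  well-formedness.\<close>

definition candidates :: "signature \<Rightarrow> formula \<Rightarrow> fterm list" where
  "candidates \<Sigma> \<phi> = map snd (updates \<phi>) @ map Cell [0..<num_cells \<Sigma>] @
     map (\<lambda>f. FApp f []) [0..<length (fun_arities \<Sigma>)] @
     concat (map (\<lambda>f. map (\<lambda>n. pump f (nth_default 0 (fun_arities \<Sigma>) f - 1) n (Cell 0))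
       [0..<Suc (fresh_bound \<Sigma> \<phi>)]) [0..<length (fun_arities \<Sigma>)])"

text \<open>The appended row keeps all cells and is the whole loop. Sublists of
  \<open>row_atoms\<close> exhaust the relevant choices for \<open>Q\<close>, so the search is
  finite.\<close>

definition next_check :: "signature \<Rightarrow> formula \<Rightarrow> bool" where
  "next_check \<Sigma> \<phi> \<longleftrightarrow> (\<exists>rows \<in> set (List.n_lists (Suc (next_depth \<phi>))
       (List.n_lists (num_cells \<Sigma>) (candidates \<Sigma> \<phi>))).
     \<exists>Q \<in> set (subseqs (row_atoms (num_cells \<Sigma>) (rows @ [map Cell [0..<num_cells \<Sigma>]]) \<phi>)).
       closed_check \<Sigma> \<phi> (rows @ [map Cell [0..<num_cells \<Sigma>]]) (Suc (next_depth \<phi>)) Q)"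

lemma next_check_sound: "next_check \<Sigma> \<phi> \<Longrightarrow> herbrand_sat \<Sigma> \<phi>"
  unfolding next_check_def using closed_check_sound by blast

lemma filter_in_subseqs: "filter p xs \<in> set (subseqs xs)"
  by (induction xs) (auto simp: Let_def)

text \<open>With a function symbol of positive arity, exactly the unmentioned updates are declared
  free and replaced, time being unchanged. Only times up to \<open>next_depth \<phi>\<close> matter,
  which bounds the symbolic contents and hence the amount of pumping.\<close>

lemma small_model:
  assumes over: "computation_over \<Sigma> \<sigma>" and wf: "wf_formula \<Sigma> \<phi>"
  shows "\<exists>\<sigma>' P'. computation_over \<Sigma> \<sigma>' \<and>
    (\<forall>t \<le> next_depth \<phi>. agree \<phi> (obs \<sigma>' P' t) (obs \<sigma> P t)) \<and>
    (\<forall>t \<le> next_depth \<phi>. \<forall>c < num_cells \<Sigma>. \<sigma>' t c \<in> set (candidates \<Sigma> \<phi>))"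
proof (cases "\<exists>a \<in> set (fun_arities \<Sigma>). 0 < a")
  case False
  have "\<tau> \<in> set (candidates \<Sigma> \<phi>)" if "wf_term \<Sigma> \<tau>" for \<tau>
    using wf_term_constant[OF False that] by (auto simp: candidates_def)
  then have "\<sigma> t c \<in> set (candidates \<Sigma> \<phi>)" if "c < num_cells \<Sigma>" for t c
    using over that by (simp add: computation_over_def)
  then show ?thesis using over by (intro exI[of _ \<sigma>] exI[of _ P]) simp
next
  case True
  then obtain f a where f: "f < length (fun_arities \<Sigma>)" "fun_arities \<Sigma> ! f = Suc a"
    by (rule positive_arity)
  define k where "k = num_cells \<Sigma>"
  define b where "b = fsize \<phi>"
  define d where "d = next_depth \<phi>"
  define free where "free t c \<longleftrightarrow> c < k \<and> (c, \<sigma> t c) \<notin> set (updates \<phi>)" for t c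
  have b1: "1 \<le> b" using fsize_pos[of \<phi>] by (simp add: b_def)
  have size: "tsize (sym_env k \<sigma> (\<lambda>t. t) free t c) \<le> b ^ t" if "c < k" for t c
    unfolding k_def
  proof (rule sym_env_size[OF over b1])
    show "tsize (\<sigma> s c) \<le> b" if "c < num_cells \<Sigma>" "\<not> free s c" for s c
      using that fsize_update[of c "\<sigma> s c" \<phi>] by (simp add: free_def k_def b_def)
  qed (use that in \<open>simp add: k_def\<close>)
  define M where "M = b ^ (d + 2)"
  have pow: "b ^ t \<le> M" if "t \<le> d + 2" for t
    unfolding M_def using b1 that by (intro power_increasing) simp_all
  interpret fresh_updates \<Sigma> \<phi> \<sigma> P "\<lambda>t. t" free "\<lambda>t. t \<le> d" "M" f a k
  proof
    show "(c, \<sigma> t c) \<notin> set (updates \<phi>)" if "free t c" for t c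
      using that by (simp add: free_def)
    show "tsize (sym_env k \<sigma> (\<lambda>t. t) free t c) \<le> M" if "t \<le> d" "c < k" for t c
      using size[OF that(2), of t] pow[of t] that(1) by linarith
    show "tsize (subst (sym_env k \<sigma> (\<lambda>t. t) free t) \<tau>) \<le> M"
      if "t \<le> d" "(p, ts) \<in> set (preds \<phi>)" "\<tau> \<in> set ts" for t p ts \<tau>
    proof -
      have "tsize (subst (sym_env k \<sigma> (\<lambda>t. t) free t) \<tau>) \<le> tsize \<tau> * b ^ t"
        using size wf_term_cells[OF wf_formula_preds[OF wf that(2,3)]] b1
        by (intro tsize_subst_le) (auto simp: k_def)
      also have "\<dots> \<le> b * b ^ t"
        using fsize_pred_mem[OF that(2,3)] by (intro mult_right_mono) (auto simp: b_def)
      also have "\<dots> \<le> M" using pow[of "Suc t"] that(1) by simp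
      finally show ?thesis .
    qed
    show "tsize \<tau> \<le> M" if "(c, \<tau>) \<in> set (updates \<phi>)" for c \<tau>
    proof -
      have "tsize \<tau> \<le> b ^ 1" using fsize_update[OF that] by (simp add: b_def)
      also have "\<dots> \<le> M" by (rule pow) simp
      finally show ?thesis .
    qed
  qed (use wf over f in \<open>simp_all add: k_def\<close>)
  obtain P' where P': "\<And>t. t \<le> d \<Longrightarrow> agree \<phi> (obs fresh_comp P' t) (obs \<sigma> P t)"
    using fresh_comp_agree by blast
  have "fresh_comp t c \<in> set (candidates \<Sigma> \<phi>)" if t: "t \<le> d" and c: "c < k" for t c
  proof (cases "free t c")
    case True
    let ?n = "target t c - spine (fresh_env t 0)"
    have "t * k + c + 1 \<le> d * k + k + 1" using t c by (intro add_mono mult_right_mono) simp_all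
    moreover have bound: "fresh_bound \<Sigma> \<phi> = (M + 1) * (2 * (d * k + k + 1))"
      by (simp add: fresh_bound_def M_def b_def d_def k_def)
    ultimately have "target t c \<le> fresh_bound \<Sigma> \<phi>"
      unfolding target_def bound by (intro mult_left_mono) simp_all
    then have n: "?n \<le> fresh_bound \<Sigma> \<phi>" by linarith
    have "?n \<in> set [0..<Suc (fresh_bound \<Sigma> \<phi>)]"
      using n by (simp only: set_upt atLeastLessThan_iff less_Suc_eq_le le0 simp_thms)
    moreover have "nth_default 0 (fun_arities \<Sigma>) f - 1 = a" using f by (simp add: nth_default_nth)
    ultimately have "pump f a ?n (Cell 0) \<in>
        (\<lambda>n. pump f (nth_default 0 (fun_arities \<Sigma>) f - 1) n (Cell 0)) ` set [0..<Suc (fresh_bound \<Sigma> \<phi>)]"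
      by (simp only: image_eqI)
    then have "pump f a ?n (Cell 0) \<in> set (concat (map (\<lambda>f. map (\<lambda>n. pump f
        (nth_default 0 (fun_arities \<Sigma>) f - 1) n (Cell 0)) [0..<Suc (fresh_bound \<Sigma> \<phi>)])
        [0..<length (fun_arities \<Sigma>)]))"
      using f(1) unfolding set_concat set_map set_upt
      by (intro UN_I[OF imageI[of f]]) (simp_all only: set_map set_upt atLeastLessThan_iff le0 simp_thms)
    then have "pump f a ?n (Cell 0) \<in> set (candidates \<Sigma> \<phi>)"
      unfolding candidates_def set_append by (intro UnI2)
    then show ?thesis using True by (simp add: fresh_comp_def)
  next
    case False
    then have "(c, \<sigma> t c) \<in> set (updates \<phi>)" using c by (simp add: free_def)
    then have "\<sigma> t c \<in> set (map snd (updates \<phi>))" using imageI[of "(c, \<sigma> t c)" "set (updates \<phi>)" snd] by simp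
    then show ?thesis using False by (simp add: fresh_comp_def candidates_def)
  qed
  then show ?thesis using P' fresh_comp_over unfolding d_def k_def by blast
qed

text \<open>The premise asks only that the formula be forced by the observations up to its depth, a
  form that also fits a top-level eventually fulfilled at time 0.\<close>

lemma next_check_complete_aux:
  assumes over: "computation_over \<Sigma> \<sigma>" and wf: "wf_formula \<Sigma> \<phi>"
    and ltl: "\<And>w. (\<And>t. t \<le> next_depth \<phi> \<Longrightarrow> agree \<phi> (obs \<sigma> P t) (w t)) \<Longrightarrow> ltl w 0 \<phi>"
  shows "next_check \<Sigma> \<phi>"
proof -
  let ?k = "num_cells \<Sigma>" and ?d = "next_depth \<phi>"
  obtain \<sigma>' P' where over': "computation_over \<Sigma> \<sigma>'"
    and agree: "\<And>t. t \<le> ?d \<Longrightarrow> agree \<phi> (obs \<sigma>' P' t) (obs \<sigma> P t)"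
    and cand: "\<And>t c. t \<le> ?d \<Longrightarrow> c < ?k \<Longrightarrow> \<sigma>' t c \<in> set (candidates \<Sigma> \<phi>)"
    using small_model[OF over wf, of P] by blast
  let ?rows = "rows_of \<sigma>' ?k (Suc ?d)"
  have rows: "rows_of (freeze (Suc ?d) \<sigma>') ?k (Suc (Suc ?d)) = ?rows @ [map Cell [0..<?k]]"
    by (simp add: rows_of_def freeze_def)
  have "ltl w 0 \<phi>" if "\<And>s. s < Suc ?d \<Longrightarrow> agree \<phi> (obs \<sigma>' P' s) (w s)" for w
    using agree_trans[OF agree] that by (intro ltl) (simp add: less_Suc_eq_le)
  from freeze_check[OF over' wf, of "Suc ?d" P', OF this]
  have "closed_check \<Sigma> \<phi> (?rows @ [map Cell [0..<?k]]) (Suc ?d)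
      (filter (\<lambda>a. P' (fst a) (snd a)) (row_atoms ?k (?rows @ [map Cell [0..<?k]]) \<phi>))"
    unfolding rows by blast
  moreover have "?rows \<in> set (List.n_lists (Suc ?d) (List.n_lists ?k (candidates \<Sigma> \<phi>)))"
    using cand unfolding set_n_lists rows_of_def by auto
  ultimately show ?thesis unfolding next_check_def using filter_in_subseqs by blast
qed

lemma env_shift: 
  assumes "computation_over \<Sigma> \<sigma>" "c < num_cells \<Sigma>"
  shows "env \<sigma> (t + s) c = subst (env \<sigma> t) (env (\<lambda>s. \<sigma> (t + s)) s c)"
  using assms(2)
proof (induction s arbitrary: c)
  case (Suc s)
  have "wf_term \<Sigma> (\<sigma> (t + s) c)" using assms(1) Suc.prems by (simp add: computation_over_def)
  then have "subst (env \<sigma> (t + s)) (\<sigma> (t + s) c) =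
      subst (\<lambda>c. subst (env \<sigma> t) (env (\<lambda>s. \<sigma> (t + s)) s c)) (\<sigma> (t + s) c)"
    using Suc.IH wf_term_cells by (intro subst_cong) blast
  then show ?case by (simp add: subst_subst)
qed simp

text \<open>The shifted computation starts from bare cells instead of the contents reached at time
  \<open>t\<close>. Composing \<open>P\<close> with the substitution of these contents gives back
  all observations; terms that become equal under it simply share their truth value.\<close>

lemma herbrand_sat_Eventually:
  assumes wf: "wf_formula \<Sigma> \<psi>" and sat: "herbrand_sat \<Sigma> (Eventually \<psi>)"
  shows "herbrand_sat \<Sigma> \<psi>"
proof -
  obtain \<sigma> P t where over: "computation_over \<Sigma> \<sigma>" and t: "ltl (obs \<sigma> P) t \<psi>"
    using sat unfolding herbrand_sat_def by auto
  let ?\<sigma> = "\<lambda>s. \<sigma> (t + s)" and ?P = "\<lambda>p us. P p (map (subst (env \<sigma> t)) us)"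
  have "agree \<psi> (obs ?\<sigma> ?P s) (obs \<sigma> P (t + s))" for s
    unfolding agree_def
  proof (intro conjI ballI; clarify)
    fix p ts assume ts: "(p, ts) \<in> set (preds \<psi>)"
    have "subst (env \<sigma> t) (subst (env ?\<sigma> s) \<tau>) = subst (env \<sigma> (t + s)) \<tau>" if "\<tau> \<in> set ts" for \<tau>
      unfolding subst_subst
      using wf_term_cells[OF wf_formula_preds[OF wf ts that]]
      by (intro subst_cong env_shift[OF over, symmetric])
    then have "map (subst (env \<sigma> t)) (map (subst (env ?\<sigma> s)) ts) = map (subst (env \<sigma> (t + s))) ts"
      by simp
    then show "obs ?\<sigma> ?P s (Pred p ts) = obs \<sigma> P (t + s) (Pred p ts)" by (simp only: obs.simps)
  qed simp
  then have "ltl (obs ?\<sigma> ?P) 0 \<psi> = ltl (\<lambda>s. obs \<sigma> P (t + s)) 0 \<psi>" by (rule ltl_cong)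
  also have "\<dots>" using t ltl_shift[of "obs \<sigma> P" t 0 \<psi>] by simp
  finally have "ltl (obs ?\<sigma> ?P) 0 \<psi>" by simp
  moreover have "computation_over \<Sigma> ?\<sigma>" using over by (simp add: computation_over_def)
  ultimately show ?thesis unfolding herbrand_sat_def by blast
qed

lemma next_check_iff:
  assumes frag: "top_eventually_fragment \<phi>" and wf: "wf_formula \<Sigma> \<phi>"
  shows "next_check \<Sigma> \<phi> \<longleftrightarrow> herbrand_sat \<Sigma> \<phi>"
proof
  assume sat: "herbrand_sat \<Sigma> \<phi>"
  obtain \<psi> where \<psi>: "next_fragment \<psi>" "herbrand_sat \<Sigma> \<psi>" "next_depth \<phi> = next_depth \<psi>"
    "\<And>x y. agree \<phi> x y = agree \<psi> x y" "\<And>w. ltl w 0 \<psi> \<Longrightarrow> ltl w 0 \<phi>"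
  proof -
    consider "next_fragment \<phi>" | \<psi> where "\<phi> = Eventually \<psi>" "next_fragment \<psi>"
      using frag unfolding top_eventually_fragment_def by blast
    then show ?thesis
    proof cases
      case 1
      then show ?thesis using that[of \<phi>] sat by blast
    next
      case (2 \<psi>)
      have "herbrand_sat \<Sigma> \<psi>" using herbrand_sat_Eventually[of \<Sigma> \<psi>] wf sat 2(1) by simp
      moreover have "agree \<phi> x y = agree \<psi> x y" for x y by (simp add: 2(1) agree_def)
      moreover have "ltl w 0 \<psi> \<Longrightarrow> ltl w 0 \<phi>" for w by (auto simp: 2(1))
      ultimately show ?thesis using that[of \<psi>] 2 by simp
    qed
  qed
  obtain \<sigma> P where over: "computation_over \<Sigma> \<sigma>" and ltl: "ltl (obs \<sigma> P) 0 \<psi>"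
    using \<psi>(2) unfolding herbrand_sat_def by blast
  show "next_check \<Sigma> \<phi>"
  proof (rule next_check_complete_aux[OF over wf])
    fix w assume "\<And>t. t \<le> next_depth \<phi> \<Longrightarrow> agree \<phi> (obs \<sigma> P t) (w t)"
    then have "ltl (obs \<sigma> P) 0 \<psi> = ltl w 0 \<psi>"
      using \<psi>(3,4) by (intro next_fragment_finite[OF \<psi>(1)]) simp
    then show "ltl w 0 \<phi>" using ltl \<psi>(5) by blast
  qed
qed (rule next_check_sound)

section \<open>Growing lassos with a single cell\<close>

abbreviation sub1 :: "fterm \<Rightarrow> fterm \<Rightarrow> fterm" where
  "sub1 x \<equiv> subst (\<lambda>_. x)"

definition asize :: "fterm list \<Rightarrow> nat" where
  "asize ts = sum_list (map tsize ts)"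

fun has_cell :: "fterm \<Rightarrow> bool" where
  "has_cell (Cell c) \<longleftrightarrow> True"
| "has_cell (FApp f ts) \<longleftrightarrow> (\<exists>t \<in> set ts. has_cell t)"

lemma subst_sub1: "cells \<tau> \<subseteq> {0} \<Longrightarrow> subst e \<tau> = sub1 (e 0) \<tau>"
  by (intro subst_cong) blast

lemma sub1_Cell: "cells \<tau> \<subseteq> {0} \<Longrightarrow> sub1 (Cell 0) \<tau> = \<tau>"
  using subst_sub1[of \<tau> Cell] by simp

lemma sub1_ground: "\<not> has_cell \<tau> \<Longrightarrow> sub1 y \<tau> = \<tau>"
  by (induction \<tau>) (auto simp: map_idI)

lemma has_cell_sub1: "has_cell (sub1 v \<tau>) \<longleftrightarrow> has_cell \<tau> \<and> has_cell v"
  by (induction \<tau>) auto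

lemma tsize_le_asize: "\<tau> \<in> set ts \<Longrightarrow> tsize \<tau> \<le> asize ts"
  by (simp add: asize_def member_le_sum_list)

lemma tsize_sub1_ge: "tsize \<tau> \<le> tsize (sub1 v \<tau>)"
proof (induction \<tau>)
  case (Cell c)
  then show ?case using tsize_pos[of v] by simp
next
  case (FApp f ts)
  then have "sum_list (map tsize ts) \<le> sum_list (map (\<lambda>t. tsize (sub1 v t)) ts)"
    by (intro sum_list_mono)
  then show ?case by (simp add: comp_def)
qed

lemma asize_sub1_ge: "asize ts \<le> asize (map (sub1 v) ts)"
  unfolding asize_def map_map comp_def by (intro sum_list_mono tsize_sub1_ge)

lemma tsize_le_sub1: "has_cell \<tau> \<Longrightarrow> tsize y \<le> tsize (sub1 y \<tau>)"
proof (induction \<tau>)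
  case (FApp f ts)
  then obtain t where t: "t \<in> set ts" "has_cell t" by auto
  have "tsize y \<le> tsize (sub1 y t)" using FApp t by blast
  also have "\<dots> < tsize (FApp f (map (sub1 y) ts))" using t by (intro tsize_mem) simp
  finally show ?case by simp
qed simp

lemma tsize_less_sub1:
  assumes "has_cell (FApp f ts)" shows "tsize y < tsize (sub1 y (FApp f ts))"
proof -
  obtain t where t: "t \<in> set ts" "has_cell t" using assms by auto
  have "tsize y \<le> tsize (sub1 y t)" using tsize_le_sub1[OF t(2)] .
  also have "\<dots> < tsize (FApp f (map (sub1 y) ts))" using t by (intro tsize_mem) simp
  finally show ?thesis by simp
qed

lemma asize_sub1_cell:
  assumes "\<tau> \<in> set ts" "has_cell \<tau>" shows "tsize y \<le> asize (map (sub1 y) ts)"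
  using tsize_le_sub1[OF assms(2), of y] tsize_le_asize[of "sub1 y \<tau>" "map (sub1 y) ts"] assms(1)
  by simp

text \<open>The property that makes a term recoverable after substituting a content of size at least
  \<open>n\<close>: no ground part of it can be mistaken for that content.\<close>

fun small_ground :: "nat \<Rightarrow> fterm \<Rightarrow> bool" where
  "small_ground n (Cell c) \<longleftrightarrow> True"
| "small_ground n (FApp f ts) \<longleftrightarrow>
     (\<not> has_cell (FApp f ts) \<longrightarrow> tsize (FApp f ts) < n) \<and> (\<forall>t \<in> set ts. small_ground n t)"

lemma small_groundI: "tsize \<tau> < n \<Longrightarrow> small_ground n \<tau>"
proof (induction \<tau>)
  case (FApp f ts)
  have "small_ground n t" if "t \<in> set ts" for t
    using FApp.IH[OF that] FApp.prems tsize_mem[OF that, of f] by linarith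
  then show ?case using FApp.prems by simp
qed simp

lemma small_ground_sub1:
  assumes "small_ground n v" "has_cell v" shows "small_ground n \<tau> \<Longrightarrow> small_ground n (sub1 v \<tau>)"
proof (induction \<tau>)
  case (FApp f ts)
  have "tsize (sub1 v (FApp f ts)) < n" if "\<not> has_cell (sub1 v (FApp f ts))"
  proof -
    have g: "\<not> has_cell (FApp f ts)" using that assms(2) has_cell_sub1[of v "FApp f ts"] by blast
    then show ?thesis using FApp.prems sub1_ground[OF g, of v] by (simp only: small_ground.simps simp_thms)
  qed
  moreover have "\<forall>t \<in> set ts. small_ground n (sub1 v t)" using FApp by simp
  ultimately show ?case by simp
qed (simp add: assms)

text \<open>The only danger is that a cell in one term faces a compound term in the other. After
  substitution the latter is larger than \<open>y\<close> if it contains a cell, and smaller than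
  \<open>y\<close> if it is ground, so it never equals \<open>y\<close>.\<close>

lemma sub1_inj:
  assumes y: "n \<le> tsize y"
    and "small_ground n A" "small_ground n B" "cells A \<subseteq> {0}" "cells B \<subseteq> {0}" "sub1 y A = sub1 y B"
  shows "A = B"
  using assms(2-)
proof (induction A arbitrary: B)
  have no: False if "small_ground n (FApp f us)" "y = sub1 y (FApp f us)" for f us
  proof (cases "has_cell (FApp f us)")
    case True
    then have "tsize y < tsize (sub1 y (FApp f us))" by (rule tsize_less_sub1)
    with that(2)[symmetric] have "tsize y < tsize y" by (simp only:)
    then show False by simp
  next
    case False
    have "tsize (FApp f us) < n" using that(1) False by (simp only: small_ground.simps simp_thms)
    then have "tsize y < n" by (subst trans[OF that(2) sub1_ground[OF False]])
    then show False using y by linarith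
  qed
  {
    case A: (Cell v)
    show ?case
    proof (cases B)
      case (Cell w)
      then show ?thesis using A.prems(3,4) by simp
    next
      case (FApp f us)
      show ?thesis using no[OF A.prems(2)[unfolded FApp] A.prems(5)[unfolded FApp subst.simps(1)]] ..
    qed
  next
    case A: (FApp f ts)
    show ?case
    proof (cases B)
      case (Cell w)
      show ?thesis using no[OF A.prems(1) A.prems(5)[unfolded Cell subst.simps(1), symmetric]] ..
    next
      case B: (FApp g us)
      have eq: "f = g" "map (sub1 y) ts = map (sub1 y) us" using A.prems(5) B by simp_all
      have "ts = us"
      proof (rule nth_equalityI)
        show len: "length ts = length us" using eq(2) by (rule map_eq_imp_length_eq)
        fix m assume m: "m < length ts"
        then have mem: "ts ! m \<in> set ts" "us ! m \<in> set us" using len by simp_all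
        show "ts ! m = us ! m"
        proof (rule A.IH[OF mem(1)])
          show "small_ground n (ts ! m)" using A.prems(1) mem by simp
          show "small_ground n (us ! m)" using A.prems(2) B mem by simp
          show "cells (ts ! m) \<subseteq> {0}" using A.prems(3) mem by auto
          show "cells (us ! m) \<subseteq> {0}" using A.prems(4) B mem by auto
          have "map (sub1 y) ts ! m = map (sub1 y) us ! m" using eq(2) by simp
          then show "sub1 y (ts ! m) = sub1 y (us ! m)" using m len by simp
        qed
      qed
      then show ?thesis using eq(1) B by simp
    qed
  }
qed

text \<open>The same updates are repeated in every round, so from the second round on the contents
  may differ from the recorded ones. \<open>loop\<close> and \<open>deep\<close> keep ground parts
  small relative to the contents, \<open>stem\<close> prevents clashes between the stem and later
  rounds, and \<open>As_same\<close> carries truth values across the jump.\<close>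

locale growing =
  fixes \<Sigma> :: signature and \<phi> :: formula and \<sigma> :: computation
    and P :: "nat \<Rightarrow> fterm list \<Rightarrow> bool" and i j D :: nat and As :: "(nat \<times> fterm list) set"
  assumes one: "num_cells \<Sigma> = 1" and wf: "wf_formula \<Sigma> \<phi>" and over: "computation_over \<Sigma> \<sigma>"
    and ij: "i < j"
    and As_pred: "(p, ts) \<in> set (preds \<phi>) \<Longrightarrow> (p, ts) \<in> As \<and> asize ts \<le> D"
    and As_closed: "(p, ts) \<in> As \<Longrightarrow> i \<le> s \<Longrightarrow> s < j \<Longrightarrow> asize (map (sub1 (\<sigma> s 0)) ts) \<le> D \<Longrightarrow>
      (p, map (sub1 (\<sigma> s 0)) ts) \<in> As"
    and As_same: "(p, ts) \<in> As \<Longrightarrow>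
      P p (map (sub1 (env \<sigma> i 0)) ts) = P p (map (sub1 (env \<sigma> j 0)) ts)"
    and loop: "i \<le> s \<Longrightarrow> s < j \<Longrightarrow> has_cell (\<sigma> s 0) \<and> tsize (\<sigma> s 0) < tsize (env \<sigma> i 0)"
    and deep: "D < tsize (env \<sigma> i 0)"
    and stem: "s < i \<Longrightarrow> (p, ts) \<in> set (preds \<phi>) \<Longrightarrow>
      asize (map (sub1 (env \<sigma> s 0)) ts) < tsize (env \<sigma> j 0)"
begin

abbreviation "q \<equiv> lasso i j"
abbreviation "x s \<equiv> env \<sigma> s 0"
abbreviation "u s \<equiv> \<sigma> s 0"

definition unrolled :: computation where "unrolled t = \<sigma> (q t)"

abbreviation "y t \<equiv> env unrolled t 0"

lemma cells_u: "cells (u s) \<subseteq> {0}"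
  using over one wf_term_cells[of \<Sigma> "u s"] by (auto simp: computation_over_def)

lemma cells_pred: "(p, ts) \<in> set (preds \<phi>) \<Longrightarrow> \<tau> \<in> set ts \<Longrightarrow> cells \<tau> \<subseteq> {0}"
  using wf_term_cells[OF wf_formula_preds[OF wf]] one by fastforce

lemma x_Suc: "x (Suc s) = sub1 (x s) (u s)"
  using subst_sub1[OF cells_u] by simp

lemma y_Suc: "y (Suc t) = sub1 (y t) (u (q t))"
  using subst_sub1[OF cells_u] by (simp add: unrolled_def)

lemma y_eq_x: "t \<le> j \<Longrightarrow> y t = x t"
  by (induction t) (simp_all add: y_Suc x_Suc lasso_id del: env.simps(2))

lemma loop_q: "i \<le> t \<Longrightarrow> has_cell (u (q t)) \<and> tsize (u (q t)) < tsize (x i)"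
  using loop lasso_ge[OF ij] lasso_less[OF ij] by blast

lemma y_mono: "i \<le> s \<Longrightarrow> s \<le> t \<Longrightarrow> tsize (y s) \<le> tsize (y t)"
proof (induction t)
  case (Suc t)
  show ?case
  proof (cases "s = Suc t")
    case False
    then have "tsize (y s) \<le> tsize (y t)" "i \<le> t" using Suc by simp_all
    then show ?thesis using tsize_le_sub1[of "u (q t)" "y t"] loop_q[of t] unfolding y_Suc by linarith
  qed simp
qed simp

lemma y_ge: "i \<le> t \<Longrightarrow> tsize (x i) \<le> tsize (y t)" "j \<le> t \<Longrightarrow> tsize (x j) \<le> tsize (y t)"
  using y_mono[of i t] y_mono[of j t] y_eq_x[of i] y_eq_x[of j] ij by simp_all

text \<open>The content after \<open>m\<close> further steps, relative to the content at time
  \<open>s\<close>. It is unrolled at the early end, which suits rewinding a predicate term step by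
  step to earlier times.\<close>

primrec ctxt :: "nat \<Rightarrow> nat \<Rightarrow> fterm" where
  "ctxt 0 s = Cell 0"
| "ctxt (Suc m) s = sub1 (u (q s)) (ctxt m (Suc s))"

lemma y_ctxt: "y (s + m) = sub1 (y s) (ctxt m s)"
proof (induction m arbitrary: s)
  case (Suc m)
  have "y (s + Suc m) = sub1 (y (Suc s)) (ctxt m (Suc s))" using Suc[of "Suc s"] by simp
  then show ?case by (simp add: y_Suc subst_subst del: env.simps(2))
qed simp

lemma cells_ctxt: "cells (ctxt m s) \<subseteq> {0}"
  using cells_u by (induction m arbitrary: s) (auto simp: cells_subst)

lemma ctxt_shape: "i \<le> s \<Longrightarrow> has_cell (ctxt m s) \<and> small_ground (tsize (x i)) (ctxt m s)"
proof (induction m arbitrary: s)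
  case (Suc m)
  then have "has_cell (ctxt m (Suc s))" "small_ground (tsize (x i)) (ctxt m (Suc s))" by simp_all
  then show ?case
    using loop_q[OF Suc.prems] small_ground_sub1[of "tsize (x i)" "u (q s)"] small_groundI
    by (simp add: has_cell_sub1)
qed simp

text \<open>Rewinding never shrinks a term, so if the final result has size at most
  \<open>D\<close>, all intermediate ones do and stay in \<open>As\<close>. Within the loop a
  rewinding step only rewrites the same recorded term; at the jump from \<open>j\<close> to
  \<open>i\<close> the truth value is kept by \<open>As_same\<close>.\<close>

lemma transport:
  assumes "(p, ts) \<in> As" and cells: "\<And>\<tau>. \<tau> \<in> set ts \<Longrightarrow> cells \<tau> \<subseteq> {0}"
    and "i \<le> s" and "asize (map (sub1 (ctxt m s)) ts) \<le> D"
  shows "(p, map (sub1 (ctxt m s)) ts) \<in> As \<and>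
    P p (map (sub1 (x (q s))) (map (sub1 (ctxt m s)) ts)) = P p (map (sub1 (x (q (s + m)))) ts)"
  using assms(3,4)
proof (induction m arbitrary: s)
  case 0
  have "map (sub1 (ctxt 0 s)) ts = ts" using sub1_Cell[OF cells] by (simp add: map_idI)
  then show ?case using assms(1) by simp
next
  case (Suc m)
  let ?A = "map (sub1 (ctxt m (Suc s))) ts"
  have A: "map (sub1 (ctxt (Suc m) s)) ts = map (sub1 (u (q s))) ?A"
    by (simp add: subst_subst)
  have "asize ?A \<le> D" using asize_sub1_ge[of ?A "u (q s)"] Suc.prems(2) unfolding A by linarith
  then have IH: "(p, ?A) \<in> As"
    "P p (map (sub1 (x (q (Suc s)))) ?A) = P p (map (sub1 (x (q (Suc s + m)))) ts)"
    using Suc.IH[of "Suc s"] Suc.prems(1) by auto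
  have q: "i \<le> q s" "q s < j" using lasso_ge[OF ij Suc.prems(1)] lasso_less[OF ij] by blast+
  have "(p, map (sub1 (u (q s))) ?A) \<in> As"
    using As_closed[OF IH(1) q] Suc.prems(2)[unfolded A] by blast
  moreover have "map (sub1 (x (q s))) (map (sub1 (u (q s))) ?A) = map (sub1 (x (Suc (q s)))) ?A"
    by (simp add: subst_subst x_Suc del: env.simps(2))
  moreover have "P p (map (sub1 (x (Suc (q s)))) ?A) = P p (map (sub1 (x (q (Suc s)))) ?A)"
    using As_same[OF IH(1)] by (cases "Suc (q s) = j") (simp_all del: env.simps(2))
  ultimately show ?case
    unfolding A add_Suc_right using IH(2)[unfolded add_Suc] by (simp only: simp_thms)
qed

text \<open>Before \<open>j\<close> real and recorded contents coincide. From \<open>j\<close> on, a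
  predicate term containing a cell is too large to equal one from the stem. In the loop, injectivity
  of substitution shows that the earlier term is the later one rewound, and since it belongs to the
  formula its size is at most \<open>D\<close>, so \<open>transport\<close> applies.\<close>

lemma pred_consistent_le:
  assumes "s \<le> t" and ts: "(p, ts) \<in> set (preds \<phi>)" and us: "(p, us) \<in> set (preds \<phi>)"
    and eq: "map (sub1 (y s)) ts = map (sub1 (y t)) us"
  shows "P p (map (sub1 (x (q s))) ts) = P p (map (sub1 (x (q t))) us)"
proof (cases "t < j")
  case True
  then show ?thesis using eq assms(1) y_eq_x[of s] y_eq_x[of t] by (simp add: lasso_id)
next
  case t: False
  show ?thesis
  proof (cases "\<exists>\<tau> \<in> set us. has_cell \<tau>")
    case False
    then have ground: "map (sub1 z) us = us" for z using sub1_ground by (simp add: map_idI)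
    show ?thesis
    proof (cases "s < j")
      case True
      then show ?thesis using eq y_eq_x[of s] by (simp add: lasso_id ground)
    next
      case s: False
      \<comment> \<open>The common instance is ground and of size at most \<open>D\<close>, whereas
        a cell in \<open>ts\<close> would bring in a content larger than \<open>D\<close>.\<close>
      have "\<not> has_cell \<tau>" if "\<tau> \<in> set ts" for \<tau>
      proof
        assume "has_cell \<tau>"
        then have "tsize (y s) \<le> asize us" using asize_sub1_cell[OF that, of "y s"] eq ground by simp
        moreover have "asize us \<le> D" using As_pred[OF us] by blast
        moreover have "tsize (x i) \<le> tsize (y s)" using y_ge(1)[of s] s ij by simp
        ultimately show False using deep by linarith
      qed
      then have "map (sub1 z) ts = ts" for z using sub1_ground by (simp add: map_idI)
      then show ?thesis using eq ground by simp
    qed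
  next
    case True
    then obtain \<tau> where \<tau>: "\<tau> \<in> set us" "has_cell \<tau>" by blast
    have big: "tsize (x j) \<le> asize (map (sub1 (y t)) us)"
      using asize_sub1_cell[OF \<tau>, of "y t"] y_ge(2)[of t] t by linarith
    have s: "i \<le> s"
    proof (rule ccontr)
      assume "\<not> i \<le> s"
      then have "asize (map (sub1 (y s)) ts) < tsize (x j)"
        using stem[OF _ ts, of s] y_eq_x[of s] ij by simp
      then show False using big eq by simp
    qed
    define m where "m = t - s"
    have m: "t = s + m" using assms(1) by (simp add: m_def)
    let ?us = "map (sub1 (ctxt m s)) us"
    \<comment> \<open>Both sides are now written relative to the same content \<open>y s\<close>,
      which injectivity allows to be cancelled.\<close>
    have eq': "map (sub1 (y s)) ts = map (sub1 (y s)) ?us"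
      using eq by (simp add: m y_ctxt subst_subst)
    have "ts = ?us"
    proof (rule nth_equalityI)
      show len: "length ts = length ?us" using eq' by (rule map_eq_imp_length_eq)
      fix n assume n: "n < length ts"
      then have mem: "ts ! n \<in> set ts" "us ! n \<in> set us" using len by simp_all
      have small: "small_ground (tsize (x i)) \<tau>" if "(p, ts) \<in> set (preds \<phi>)" "\<tau> \<in> set ts" for ts \<tau>
        using As_pred[OF that(1)] tsize_le_asize[OF that(2)] deep by (intro small_groundI) linarith
      have "ts ! n = sub1 (ctxt m s) (us ! n)"
      proof (rule sub1_inj[OF y_ge(1)[OF s]])
        show "small_ground (tsize (x i)) (ts ! n)" by (rule small[OF ts mem(1)])
        show "small_ground (tsize (x i)) (sub1 (ctxt m s) (us ! n))"
          using ctxt_shape[OF s, of m] small[OF us mem(2)] by (intro small_ground_sub1) simp_all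
        show "cells (ts ! n) \<subseteq> {0}" by (rule cells_pred[OF ts mem(1)])
        show "cells (sub1 (ctxt m s) (us ! n)) \<subseteq> {0}" using cells_ctxt by (auto simp: cells_subst)
        have "map (sub1 (y s)) ts ! n = map (sub1 (y s)) ?us ! n" using eq' by (simp only:)
        then show "sub1 (y s) (ts ! n) = sub1 (y s) (sub1 (ctxt m s) (us ! n))"
          using n len by simp
      qed
      then show "ts ! n = ?us ! n" using n len by simp
    qed
    moreover have "asize ts \<le> D" using As_pred[OF ts] by blast
    ultimately show ?thesis
      using transport[of p us s m] As_pred[OF us] cells_pred[OF us] s m by simp
  qed
qed

lemma unrolled_agree: "\<exists>P'. \<forall>t. agree \<phi> (obs unrolled P' t) (obs \<sigma> P (q t))"
proof -
  define P' where "P' p us \<longleftrightarrow> (\<exists>t ts. (p, ts) \<in> set (preds \<phi>) \<and>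
    us = map (sub1 (y t)) ts \<and> P p (map (sub1 (x (q t))) ts))" for p us
  have "agree \<phi> (obs unrolled P' t) (obs \<sigma> P (q t))" for t
    unfolding agree_def
  proof (intro conjI ballI; clarify)
    fix p ts assume ts: "(p, ts) \<in> set (preds \<phi>)"
    have sub: "map (subst e) ts = map (sub1 (e 0)) ts" for e
      by (rule map_cong[OF refl]) (rule subst_sub1[OF cells_pred[OF ts]])
    have "P' p (map (sub1 (y t)) ts) \<longleftrightarrow> P p (map (sub1 (x (q t))) ts)"
    proof
      assume "P' p (map (sub1 (y t)) ts)"
      then obtain s us where *: "(p, us) \<in> set (preds \<phi>)"
        "map (sub1 (y t)) ts = map (sub1 (y s)) us" "P p (map (sub1 (x (q s))) us)"
        unfolding P'_def by blast
      show "P p (map (sub1 (x (q t))) ts)"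
      proof (cases "t \<le> s")
        case True
        then show ?thesis using pred_consistent_le[OF True ts *(1,2)] *(3) by simp
      next
        case False
        then have "s \<le> t" by simp
        then show ?thesis using pred_consistent_le[OF _ *(1) ts *(2)[symmetric]] *(3) by simp
      qed
    qed (use ts in \<open>unfold P'_def, blast\<close>)
    then show "obs unrolled P' t (Pred p ts) = obs \<sigma> P (q t) (Pred p ts)"
      by (simp only: obs.simps sub[of "env unrolled t"] sub[of "env \<sigma> (q t)"])
  qed (simp add: unrolled_def)
  then show ?thesis by blast
qed

end

text \<open>
  The predicate terms in \<open>As\<close> are written relative to the content at some point of the loop, which
  is denoted by the cell. Rewinding a predicate term of the formula through the updates of the loop
  stays within \<open>As\<close> as long as the size is at most \<open>D\<close>.
\<close>

definition grow_check :: "signature \<Rightarrow> formula \<Rightarrow> fterm list list \<Rightarrow> nat \<Rightarrow> (nat \<times> fterm list) list \<Rightarrow>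
    (nat \<times> fterm list) list \<Rightarrow> nat \<Rightarrow> bool" where
  "grow_check \<Sigma> \<phi> rows i Q As D \<longleftrightarrow> lasso_check \<Sigma> \<phi> rows i Q \<and> num_cells \<Sigma> = 1 \<and>
     (\<forall>A \<in> set (preds \<phi>). A \<in> set As \<and> asize (snd A) \<le> D) \<and>
     (\<forall>A \<in> set As. \<forall>s<length rows. i \<le> s \<longrightarrow>
        asize (map (sub1 (lookup (nth_default [] rows s) 0)) (snd A)) \<le> D \<longrightarrow>
        (fst A, map (sub1 (lookup (nth_default [] rows s) 0)) (snd A)) \<in> set As) \<and>
     (\<forall>A \<in> set As. ((fst A, map (sub1 (lookup (row_env 1 (take i rows)) 0)) (snd A)) \<in> set Q) =
        ((fst A, map (sub1 (lookup (row_env 1 rows) 0)) (snd A)) \<in> set Q)) \<and>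
     (\<forall>s<length rows. i \<le> s \<longrightarrow> has_cell (lookup (nth_default [] rows s) 0) \<and>
        tsize (lookup (nth_default [] rows s) 0) < tsize (lookup (row_env 1 (take i rows)) 0)) \<and>
     D < tsize (lookup (row_env 1 (take i rows)) 0) \<and>
     (\<forall>s<i. \<forall>A \<in> set (preds \<phi>). asize (map (sub1 (lookup (row_env 1 (take s rows)) 0)) (snd A)) <
        tsize (lookup (row_env 1 rows) 0))"

lemma grow_check_sound:
  assumes wf: "wf_formula \<Sigma> \<phi>" and check: "grow_check \<Sigma> \<phi> rows i Q As D"
  shows "herbrand_sat \<Sigma> \<phi>"
proof -
  have lc: "lasso_check \<Sigma> \<phi> rows i Q" and one: "num_cells \<Sigma> = 1" using check by (simp_all add: grow_check_def)
  have ij: "i < length rows" and wfr: "wf_rows \<Sigma> rows" using lc by (simp_all add: lasso_check_def)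
  have u: "lookup (nth_default [] rows s) 0 = row_comp rows s 0" for s by (simp add: row_comp_def)
  have x: "lookup (row_env 1 (take s rows)) 0 = env (row_comp rows) s 0" if "s \<le> length rows" for s
    using env_row_comp[OF wfr that] one by simp
  have xj: "lookup (row_env 1 rows) 0 = env (row_comp rows) (length rows) 0"
    using x[of "length rows"] by simp
  note c = check[unfolded grow_check_def u xj x[OF less_imp_le[OF ij]], THEN conjunct2, THEN conjunct2]
  note c = c[THEN conjunct1] c[THEN conjunct2, THEN conjunct1]
    c[THEN conjunct2, THEN conjunct2, THEN conjunct1]
    c[THEN conjunct2, THEN conjunct2, THEN conjunct2, THEN conjunct1]
    c[THEN conjunct2, THEN conjunct2, THEN conjunct2, THEN conjunct2, THEN conjunct1]
    c[THEN conjunct2, THEN conjunct2, THEN conjunct2, THEN conjunct2, THEN conjunct2]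
  interpret growing \<Sigma> \<phi> "row_comp rows" "\<lambda>p us. (p, us) \<in> set Q" i "length rows" D "set As"
  proof
    show "computation_over \<Sigma> (row_comp rows)"
      using row_comp_wf[OF wfr] by (simp add: computation_over_def)
    show "(p, ts) \<in> set As \<and> asize ts \<le> D" if "(p, ts) \<in> set (preds \<phi>)" for p ts
      using bspec[OF c(1) that] by simp
    show "(p, map (sub1 (row_comp rows s 0)) ts) \<in> set As"
      if "(p, ts) \<in> set As" "i \<le> s" "s < length rows" "asize (map (sub1 (row_comp rows s 0)) ts) \<le> D"
      for p ts s
      using bspec[OF c(2) that(1)] that(2-) by simp
    show "((p, map (sub1 (env (row_comp rows) i 0)) ts) \<in> set Q) =
        ((p, map (sub1 (env (row_comp rows) (length rows) 0)) ts) \<in> set Q)"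
      if "(p, ts) \<in> set As" for p ts
      using bspec[OF c(3) that] by simp
    show "has_cell (row_comp rows s 0) \<and> tsize (row_comp rows s 0) < tsize (env (row_comp rows) i 0)"
      if "i \<le> s" "s < length rows" for s
      using c(4) that by blast
    show "asize (map (sub1 (env (row_comp rows) s 0)) ts) < tsize (env (row_comp rows) (length rows) 0)"
      if "s < i" "(p, ts) \<in> set (preds \<phi>)" for s p ts
      using c(6)[rule_format, OF that] x[of s] that(1) ij by simp
  qed (fact one wf ij c(5))+
  obtain P' where P': "\<And>t. agree \<phi> (obs unrolled P' t) (obs (row_comp rows) (\<lambda>p us. (p, us) \<in> set Q) (q t))"
    using unrolled_agree by blast
  have "ltl (obs unrolled P') 0 \<phi> = ltl (\<lambda>t. obs (row_comp rows) (\<lambda>p us. (p, us) \<in> set Q) (q t)) 0 \<phi>"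
    using P' by (rule ltl_cong)
  then have "ltl (obs unrolled P') 0 \<phi>" using lasso_check_ltl[OF lc] by simp
  moreover have "computation_over \<Sigma> unrolled" using over by (simp add: computation_over_def unrolled_def)
  ultimately show ?thesis unfolding herbrand_sat_def by blast
qed

section \<open>Existence of growing lassos and the case distinction for one cell\<close>

lemma length_le_asize: "length ts \<le> asize ts"
proof (induction ts)
  case (Cons t ts)
  then show ?case using tsize_pos[of t] by (simp add: asize_def)
qed simp

lemma finite_terms: "finite {\<tau>. wf_term \<Sigma> \<tau> \<and> tsize \<tau> \<le> n}"
proof (induction n)
  case 0
  have "{\<tau>. wf_term \<Sigma> \<tau> \<and> tsize \<tau> \<le> 0} = {}" using tsize_pos not_le by blast
  then show ?case by (simp only: finite.emptyI)
next
  case (Suc n)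
  let ?W = "{\<tau>. wf_term \<Sigma> \<tau> \<and> tsize \<tau> \<le> n}"
  let ?B = "Cell ` {..<num_cells \<Sigma>} \<union> (\<lambda>(f, ts). FApp f ts) `
    ({..<length (fun_arities \<Sigma>)} \<times> {ts. set ts \<subseteq> ?W \<and> length ts \<le> n})"
  have "\<tau> \<in> ?B" if \<tau>: "wf_term \<Sigma> \<tau>" "tsize \<tau> \<le> Suc n" for \<tau>
  proof (cases \<tau>)
    case (Cell c)
    then show ?thesis using \<tau> by simp
  next
    case (FApp f ts)
    have "asize ts \<le> n" using \<tau>(2) FApp by (simp add: asize_def)
    then have "length ts \<le> n" "\<forall>t \<in> set ts. tsize t \<le> n"
      using length_le_asize[of ts] tsize_le_asize[of _ ts] by (auto intro: order_trans)
    then have "(f, ts) \<in> {..<length (fun_arities \<Sigma>)} \<times> {ts. set ts \<subseteq> ?W \<and> length ts \<le> n}"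
      using \<tau>(1) FApp by auto
    then have "FApp f ts \<in> (\<lambda>(f, ts). FApp f ts) `
        ({..<length (fun_arities \<Sigma>)} \<times> {ts. set ts \<subseteq> ?W \<and> length ts \<le> n})"
      by (rule rev_image_eqI) simp
    then show ?thesis unfolding FApp by (rule UnI2)
  qed
  then have "{\<tau>. wf_term \<Sigma> \<tau> \<and> tsize \<tau> \<le> Suc n} \<subseteq> ?B" by blast
  moreover have "finite ?B" using finite_lists_length_le[OF Suc, of n] by simp
  ultimately show ?case by (rule finite_subset)
qed

lemma infinite_nat_obtain:
  assumes "infinite (S :: nat set)" obtains t where "t \<in> S" "N \<le> t"
  using assms unfolding finite_nat_set_iff_bounded by (meson not_le)

text \<open>From \<open>T\<close> on every update contains the cell, so contents never shrink, and
  updates other than the identity recur and enlarge them. Contents therefore eventually exceed any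
  bound, first \<open>D\<close> and then everything seen on the stem.\<close>

lemma grow_check_complete:
  assumes over: "computation_over \<Sigma> \<sigma>" and wf: "wf_formula \<Sigma> \<phi>" and ltl: "ltl (obs \<sigma> P) 0 \<phi>"
    and one: "num_cells \<Sigma> = 1"
    and T: "\<And>t. T \<le> t \<Longrightarrow> (0, \<sigma> t 0) \<in> set (updates \<phi>) \<and> has_cell (\<sigma> t 0)"
    and inf: "infinite {t. \<sigma> t 0 \<noteq> Cell 0}"
  shows "\<exists>rows i Q As D. grow_check \<Sigma> \<phi> rows i Q As D"
proof -
  let ?x = "\<lambda>t. env \<sigma> t 0"
  define D where "D = fsize \<phi>"
  have wf_u: "wf_term \<Sigma> (\<sigma> t 0)" for t using over one by (simp add: computation_over_def)
  have cells_u: "cells (\<sigma> t 0) \<subseteq> {0}" for t using wf_term_cells[OF wf_u] one by auto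
  have x_Suc: "?x (Suc t) = sub1 (?x t) (\<sigma> t 0)" for t using subst_sub1[OF cells_u] by simp
  have mono: "tsize (?x s) \<le> tsize (?x t)" if "T \<le> s" "s \<le> t" for s t
    using that(2)
  proof (induction t rule: dec_induct)
    case (step t)
    have "tsize (?x t) \<le> tsize (?x (Suc t))"
      unfolding x_Suc using T[of t] step that(1) by (intro tsize_le_sub1) simp
    then show ?case using step by linarith
  qed simp
  have strict: "tsize (?x t) < tsize (?x (Suc t))" if "T \<le> t" "\<sigma> t 0 \<noteq> Cell 0" for t
  proof (cases "\<sigma> t 0")
    case (Cell c)
    then show ?thesis using that(2) cells_u[of t] by simp
  next
    case (FApp f ts)
    have "has_cell (FApp f ts)" using T[OF that(1)] FApp by simp
    then show ?thesis unfolding x_Suc FApp by (rule tsize_less_sub1)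
  qed
  have unbounded: "\<exists>T'\<ge>T. \<forall>t\<ge>T'. N < tsize (?x t)" for N
  proof (induction N)
    case 0
    show ?case using tsize_pos by blast
  next
    case (Suc N)
    then obtain T' where T': "T' \<ge> T" "\<forall>t\<ge>T'. N < tsize (?x t)" by blast
    obtain t0 where "t0 \<in> {t. \<sigma> t 0 \<noteq> Cell 0}" "T' \<le> t0" using inf by (rule infinite_nat_obtain)
    then have t0: "\<sigma> t0 0 \<noteq> Cell 0" "T' \<le> t0" "T \<le> t0" using T' by simp_all
    have "Suc N < tsize (?x t)" if "Suc t0 \<le> t" for t
    proof -
      have "N < tsize (?x t0)" using T'(2) t0(2) by blast
      moreover have "tsize (?x (Suc t0)) \<le> tsize (?x t)" using mono[of "Suc t0" t] that t0(3) by simp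
      ultimately show ?thesis using strict[OF t0(3,1)] by linarith
    qed
    then show ?case using t0(3) by (intro exI[of _ "Suc t0"]) simp
  qed
  let ?W = "{\<tau>. wf_term \<Sigma> \<tau> \<and> tsize \<tau> \<le> D}"
  \<comment> \<open>All argument tuples of total size at most \<open>D\<close> for the predicates of
    the formula: a finite set, closed under rewinding up to that size. It does not depend on the
    loop, so it can be fixed before \<open>i\<close> and \<open>j\<close> are chosen.\<close>
  define X where "X = {A \<in> fst ` set (preds \<phi>) \<times> {ts. set ts \<subseteq> ?W \<and> length ts \<le> D}. asize (snd A) \<le> D}"
  have "finite X" unfolding X_def using finite_lists_length_le[OF finite_terms] by simp
  then obtain As where As: "set As = X" using finite_list by blast
  have XI: "(p, ts) \<in> X" if "p \<in> fst ` set (preds \<phi>)" "\<forall>\<tau> \<in> set ts. wf_term \<Sigma> \<tau>" "asize ts \<le> D" for p ts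
  proof -
    have "tsize \<tau> \<le> D" if "\<tau> \<in> set ts" for \<tau> using tsize_le_asize[OF that] \<open>asize ts \<le> D\<close> by linarith
    moreover have "length ts \<le> D" using length_le_asize[of ts] that(3) by linarith
    ultimately show ?thesis using that by (auto simp: X_def)
  qed
  obtain T' where T': "T \<le> T'" "\<And>t. T' \<le> t \<Longrightarrow> D < tsize (?x t)" using unbounded[of D] by blast
  let ?f = "\<lambda>t. {A \<in> X. P (fst A) (map (sub1 (?x t)) (snd A))}"
  have "?f ` {T'..} \<subseteq> Pow X" by blast
  then have "finite (?f ` {T'..})" using \<open>finite X\<close> by (meson finite_Pow_iff finite_subset)
  \<comment> \<open>Restricting to times with the same true members of \<open>X\<close> makes any
    two of them suitable as ends of the loop.\<close>
  then obtain S where S: "S \<subseteq> {T'..}" "infinite S" "\<And>s t. s \<in> S \<Longrightarrow> t \<in> S \<Longrightarrow> ?f s = ?f t"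
    using infinite_constant_subset[OF infinite_Ici] by blast
  obtain i where i: "i \<in> S" "\<forall>N. \<exists>j \<in> S. N < j \<and> i < j \<and>
      ltl (\<lambda>t. obs \<sigma> P (lasso i j t)) 0 \<phi> = ltl (obs \<sigma> P) 0 \<phi>"
    using lasso_exists[OF S(2), of "obs \<sigma> P" \<phi>] by blast
  \<comment> \<open>Dominates the size of every predicate term seen on the stem. It depends on
    \<open>i\<close>, so \<open>j\<close> has to be chosen after it.\<close>
  define B where "B = (\<Sum>s<i. \<Sum>A \<in> set (preds \<phi>). asize (map (sub1 (?x s)) (snd A)))"
  obtain T2 where T2: "\<And>t. T2 \<le> t \<Longrightarrow> B < tsize (?x t)" using unbounded[of B] by blast
  obtain j where j: "j \<in> S" "T2 < j" "i < j" "ltl (\<lambda>t. obs \<sigma> P (lasso i j t)) 0 \<phi>"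
    using i(2)[rule_format, of T2] ltl by blast
  have iT: "T \<le> i" "D < tsize (?x i)" using S(1) i(1) T' by auto
  let ?rows = "rows_of \<sigma> 1 j"
  let ?inst = "\<lambda>t A. (fst A, map (sub1 (?x t)) (snd A))"
  \<comment> \<open>The instances of \<open>As\<close> at both ends are included, because agreement
    of the two ends is tested through membership in \<open>Q\<close>.\<close>
  define Q where "Q = filter (\<lambda>a. P (fst a) (snd a))
    (row_atoms 1 ?rows \<phi> @ map (?inst i) As @ map (?inst j) As)"
  have "lasso_check \<Sigma> \<phi> ?rows i Q"
    unfolding one[symmetric]
    by (rule lasso_check_complete[OF over wf j(3,4)]) (simp add: Q_def one, blast)
  moreover have u: "lookup (nth_default [] ?rows s) 0 = \<sigma> s 0" if "s < j" for s
    using row_comp_rows_of[of s j 0 1 \<sigma>] that by (simp add: row_comp_def)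
  moreover have x: "lookup (row_env 1 (take s ?rows)) 0 = ?x s" if "s \<le> j" for s
    using row_env_rows_of[OF over that, of 0] one by simp
  moreover have xj: "lookup (row_env 1 ?rows) 0 = ?x j" using x[of j] by simp
  moreover have "A \<in> set As \<and> asize (snd A) \<le> D" if "A \<in> set (preds \<phi>)" for A
  proof -
    have A: "(fst A, snd A) \<in> set (preds \<phi>)" using that by simp
    have "asize (snd A) \<le> D" using fsize_pred[OF A] by (simp add: D_def asize_def)
    moreover have "(fst A, snd A) \<in> X"
      using that wf_formula_preds[OF wf A] calculation by (intro XI) simp_all
    ultimately show ?thesis using As by simp
  qed
  moreover have "(fst A, map (sub1 (\<sigma> s 0)) (snd A)) \<in> set As"
    if "A \<in> set As" "asize (map (sub1 (\<sigma> s 0)) (snd A)) \<le> D" for A s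
  proof -
    have A: "fst A \<in> fst ` set (preds \<phi>)" "\<forall>\<tau> \<in> set (snd A). wf_term \<Sigma> \<tau>"
      using that(1) unfolding As X_def by (simp_all add: mem_Times_iff subset_eq)
    have "\<forall>\<tau> \<in> set (map (sub1 (\<sigma> s 0)) (snd A)). wf_term \<Sigma> \<tau>"
      using A(2) by (auto intro!: wf_term_subst wf_u)
    then show ?thesis unfolding As using A(1) that(2) by (intro XI)
  qed
  moreover have "(?inst i A \<in> set Q) = (?inst j A \<in> set Q)" if "A \<in> set As" for A
  proof -
    have "?inst t A \<in> set Q \<longleftrightarrow> P (fst A) (map (sub1 (?x t)) (snd A))" if "t = i \<or> t = j" for t
      using that \<open>A \<in> set As\<close> unfolding Q_def by auto
    moreover have "P (fst A) (map (sub1 (?x i)) (snd A)) = P (fst A) (map (sub1 (?x j)) (snd A))"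
      using S(3)[OF i(1) j(1)] that As by blast
    ultimately show ?thesis by blast
  qed
  moreover have "has_cell (\<sigma> s 0) \<and> tsize (\<sigma> s 0) < tsize (?x i)" if "i \<le> s" for s
    using T[of s] fsize_update[of 0 "\<sigma> s 0" \<phi>] iT that by (simp add: D_def)
  moreover have "asize (map (sub1 (?x s)) (snd A)) < tsize (?x j)" if "s < i" "A \<in> set (preds \<phi>)" for s A
  proof -
    have "asize (map (sub1 (?x s)) (snd A)) \<le> (\<Sum>A \<in> set (preds \<phi>). asize (map (sub1 (?x s)) (snd A)))"
      using that(2) by (intro member_le_sum) simp_all
    also have "\<dots> \<le> B" unfolding B_def using that(1)
      by (intro member_le_sum[of s "{..<i}" "\<lambda>s. \<Sum>A \<in> set (preds \<phi>). asize (map (sub1 (?x s)) (snd A))"]) simp_all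
    also have "\<dots> < tsize (?x j)" using T2 j(2) by simp
    finally show ?thesis .
  qed
  ultimately have "grow_check \<Sigma> \<phi> ?rows i Q As D"
    using one iT(2) j(3) x[OF less_imp_le[OF j(3)]] unfolding grow_check_def by simp
  then show ?thesis by blast
qed

definition one_cell_check :: "signature \<Rightarrow> formula \<Rightarrow> fterm list list \<Rightarrow> nat \<Rightarrow> (nat \<times> fterm list) list \<Rightarrow>
    (nat \<times> fterm list) list \<Rightarrow> nat \<Rightarrow> bool" where
  "one_cell_check \<Sigma> \<phi> rows i Q As D \<longleftrightarrow> num_cells \<Sigma> = 1 \<and>
     (closed_check \<Sigma> \<phi> rows i Q \<or> fresh_check \<Sigma> \<phi> rows i Q \<or> grow_check \<Sigma> \<phi> rows i Q As D)"

lemma recurrent_of_finite: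
  assumes "infinite S" "finite ((\<lambda>t. env \<sigma> t 0) ` S)"
  shows "\<exists>x. infinite {t. env \<sigma> t 0 = x}"
proof -
  obtain a where "infinite {t \<in> S. env \<sigma> t 0 = env \<sigma> a 0}"
    using pigeonhole_infinite[OF assms] by blast
  then have "infinite {t. env \<sigma> t 0 = env \<sigma> a 0}" by (rule contrapos_nn) (simp add: finite_subset[rotated] subset_eq)
  then show ?thesis by blast
qed

lemma wf_env: "computation_over \<Sigma> \<sigma> \<Longrightarrow> c < num_cells \<Sigma> \<Longrightarrow> wf_term \<Sigma> (env \<sigma> t c)"
  by (induction t arbitrary: c) (simp_all add: computation_over_def wf_term_subst)

lemma finite_terms_constants:
  assumes "\<not> (\<exists>a \<in> set (fun_arities \<Sigma>). 0 < a)"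
  shows "finite {\<tau>. wf_term \<Sigma> \<tau>}"
proof (rule finite_subset)
  show "{\<tau>. wf_term \<Sigma> \<tau>} \<subseteq> Cell ` {..<num_cells \<Sigma>} \<union> (\<lambda>f. FApp f []) ` {..<length (fun_arities \<Sigma>)}"
    using wf_term_constant[OF assms] by blast
qed simp

text \<open>Every way in which the content could fail to grow forever either makes some content
  recur, giving a closed lasso, or uses unmentioned updates infinitely often, giving a fresh
  lasso.\<close>

lemma one_cell_complete:
  assumes wf: "wf_formula \<Sigma> \<phi>" and one: "num_cells \<Sigma> = 1" and sat: "herbrand_sat \<Sigma> \<phi>"
  shows "\<exists>rows i Q As D. one_cell_check \<Sigma> \<phi> rows i Q As D"
proof -
  obtain \<sigma> P where over: "computation_over \<Sigma> \<sigma>" and ltl: "ltl (obs \<sigma> P) 0 \<phi>"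
    using sat unfolding herbrand_sat_def by blast
  have wf_u: "wf_term \<Sigma> (\<sigma> t 0)" for t using over one by (simp add: computation_over_def)
  show ?thesis
  proof (cases "\<exists>x. infinite {t. env \<sigma> t 0 = x}")
    case True
    then show ?thesis
      using closed_check_recurrent[OF over wf ltl one] one unfolding one_cell_check_def by blast
  next
    case norec: False
    let ?F = "{t. (0, \<sigma> t 0) \<notin> set (updates \<phi>)}"
    \<comment> \<open>With constants only there are finitely many terms, so some content would
      recur.\<close>
    have a: "\<exists>a \<in> set (fun_arities \<Sigma>). 0 < a"
    proof (rule ccontr)
      assume "\<not> (\<exists>a \<in> set (fun_arities \<Sigma>). 0 < a)"
      then have "finite {\<tau>. wf_term \<Sigma> \<tau>}" by (rule finite_terms_constants)
      moreover have "range (\<lambda>t. env \<sigma> t 0) \<subseteq> {\<tau>. wf_term \<Sigma> \<tau>}" using wf_env[OF over] one by auto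
      ultimately have "finite (range (\<lambda>t. env \<sigma> t 0))" by (rule rev_finite_subset)
      then show False using recurrent_of_finite[OF infinite_UNIV_nat] norec by blast
    qed
    show ?thesis
    proof (cases "finite ?F")
      case False
      then show ?thesis
        using fresh_check_complete[OF over wf ltl one a] one unfolding one_cell_check_def by blast
    next
      case fin: True
      \<comment> \<open>A mentioned ground update puts one of finitely many terms into the cell;
        infinitely many of them would make a content recur.\<close>
      let ?G = "{t. \<not> has_cell (\<sigma> t 0)}"
      have "finite ?G"
      proof (rule ccontr)
        assume "infinite ?G"
        then have S: "infinite (Suc ` (?G - ?F))" using fin by (simp add: finite_image_iff)
        have "env \<sigma> (Suc t) 0 \<in> snd ` set (updates \<phi>)" if "t \<in> ?G - ?F" for t
        proof -
          have "cells (\<sigma> t 0) \<subseteq> {0}" using wf_term_cells[OF wf_u] one by auto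
          then have "env \<sigma> (Suc t) 0 = \<sigma> t 0"
            using subst_sub1[of "\<sigma> t 0" "env \<sigma> t"] sub1_ground[of "\<sigma> t 0"] that by simp
          then show ?thesis using that imageI[of "(0, \<sigma> t 0)" "set (updates \<phi>)" snd] by simp
        qed
        then have "(\<lambda>t. env \<sigma> t 0) ` (Suc ` (?G - ?F)) \<subseteq> snd ` set (updates \<phi>)" by blast
        then have "finite ((\<lambda>t. env \<sigma> t 0) ` (Suc ` (?G - ?F)))" by (rule finite_subset) simp
        then show False using recurrent_of_finite[OF S] norec by blast
      qed
      then have "finite (?F \<union> ?G)" using fin by simp
      then obtain N where N: "\<forall>t \<in> ?F \<union> ?G. t < N" unfolding finite_nat_set_iff_bounded by blast
      \<comment> \<open>Otherwise the content would be constant from some time on, and hence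
        recur.\<close>
      have "infinite {t. \<sigma> t 0 \<noteq> Cell 0}"
      proof
        assume "finite {t. \<sigma> t 0 \<noteq> Cell 0}"
        then obtain M where M: "\<forall>t \<in> {t. \<sigma> t 0 \<noteq> Cell 0}. t < M" unfolding finite_nat_set_iff_bounded by blast
        have "env \<sigma> (M + m) 0 = env \<sigma> M 0" for m
        proof (induction m)
          case (Suc m)
          have "\<sigma> (M + m) 0 = Cell 0" using M by fastforce
          then show ?case using Suc by simp
        qed simp
        then have "(\<lambda>t. env \<sigma> t 0) ` {M..} \<subseteq> {env \<sigma> M 0}" by (auto simp: le_iff_add)
        then have "finite ((\<lambda>t. env \<sigma> t 0) ` {M..})" by (rule finite_subset) simp
        then show False using recurrent_of_finite[OF infinite_Ici] norec by blast
      qed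
      moreover have "(0, \<sigma> t 0) \<in> set (updates \<phi>) \<and> has_cell (\<sigma> t 0)" if "N \<le> t" for t
      proof -
        have "t \<notin> ?F \<union> ?G" using N that not_le by blast
        then show ?thesis by simp
      qed
      ultimately show ?thesis
        using grow_check_complete[OF over wf ltl one, of N] one unfolding one_cell_check_def by blast
    qed
  qed
qed

lemma one_cell_sound:
  "wf_formula \<Sigma> \<phi> \<Longrightarrow> one_cell_check \<Sigma> \<phi> rows i Q As D \<Longrightarrow> herbrand_sat \<Sigma> \<phi>"
  unfolding one_cell_check_def using closed_check_sound fresh_check_sound grow_check_sound by blast

section \<open>Computability of the checks\<close>

lemma computable_replicate [comp]:
  assumes "computable n" "computable f" shows "computable (\<lambda>x. replicate (n x) (f x))"
proof -
  have "computable (\<lambda>x. map (\<lambda>_. f x) [0..<n x])" by (intro comp assms computable_comp[OF assms(2)])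
  then show ?thesis by (simp add: map_replicate_const)
qed

lemma computable_lookup [comp]:
  assumes "computable e" "computable c" shows "computable (\<lambda>x. lookup (e x) (c x))"
  unfolding lookup_def by (intro comp assms)

lemma computable_subst_lookup [comp]:
  assumes "computable e" "computable \<tau>" shows "computable (\<lambda>x. subst (lookup (e x)) (\<tau> x))"
  by (rule computable_fterm_rec[where F = "\<lambda>e. subst (lookup e)" and g = lookup and
        h = "\<lambda>e f ts rs. FApp f rs"])
    (intro comp assms; fail | simp; fail)+

lemma computable_sub1 [comp]:
  assumes "computable v" "computable \<tau>" shows "computable (\<lambda>x. sub1 (v x) (\<tau> x))"
  by (rule computable_fterm_rec[where F = sub1 and g = "\<lambda>v c. v" and h = "\<lambda>v f ts rs. FApp f rs"])
    (intro comp assms; fail | simp; fail)+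

lemma computable_tsize [comp]:
  assumes "computable \<tau>" shows "computable (\<lambda>x. tsize (\<tau> x))"
  by (rule computable_fterm_rec[where F = "\<lambda>_ :: nat. tsize" and p = "\<lambda>_. 0" and
        g = "\<lambda>_ _. 1" and h = "\<lambda>_ f ts rs. Suc (sum_list rs)"])
    (intro comp assms; fail | simp; fail)+

lemma computable_has_cell [comp]:
  assumes "computable \<tau>" shows "computable (\<lambda>x. has_cell (\<tau> x))"
  by (rule computable_fterm_rec[where F = "\<lambda>_ :: nat. has_cell" and p = "\<lambda>_. 0" and
        g = "\<lambda>_ _. True" and h = "\<lambda>_ f ts rs. \<exists>r \<in> set rs. r"])
    (intro comp assms; fail | simp; fail)+

text \<open>\<open>nth_default\<close> stands in for \<open>!\<close>, which is unspecified beyond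
  the end of the list; the preceding range test makes the two agree.\<close>

lemma computable_wf_term [comp]:
  assumes "computable \<Sigma>" "computable \<tau>" shows "computable (\<lambda>x. wf_term (\<Sigma> x) (\<tau> x))"
  by (rule computable_fterm_rec[where F = wf_term and g = "\<lambda>\<Sigma> c. c < num_cells \<Sigma>" and
        h = "\<lambda>\<Sigma> f ts rs. f < length (fun_arities \<Sigma>) \<and>
          length ts = nth_default 0 (fun_arities \<Sigma>) f \<and> (\<forall>r \<in> set rs. r)"])
    (intro comp assms; fail | simp add: nth_default_nth cong: conj_cong; fail)+

lemma computable_wf_formula [comp]:
  assumes "computable \<Sigma>" "computable \<phi>" shows "computable (\<lambda>x. wf_formula (\<Sigma> x) (\<phi> x))"
  by (rule computable_formula_rec[where F = wf_formula and fT = "\<lambda>_. True" and fN = "\<lambda>_ r. r" and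
        fC = "\<lambda>_ r s. r \<and> s" and fX = "\<lambda>_ r. r" and fU = "\<lambda>_ r s. r \<and> s" and
        fP = "\<lambda>\<Sigma> p ts. p < length (pred_arities \<Sigma>) \<and>
          length ts = nth_default 0 (pred_arities \<Sigma>) p \<and> (\<forall>t \<in> set ts. wf_term \<Sigma> t)" and
        fA = "\<lambda>\<Sigma> c \<tau>. c < num_cells \<Sigma> \<and> wf_term \<Sigma> \<tau>"])
    (intro comp assms; fail | simp add: nth_default_nth cong: conj_cong; fail)+

lemma computable_preds [comp]:
  assumes "computable \<phi>" shows "computable (\<lambda>x. preds (\<phi> x))"
  by (rule computable_formula_rec[where F = "\<lambda>_ :: nat. preds" and p = "\<lambda>_. 0" and fT = "\<lambda>_. []" and
        fN = "\<lambda>_ r. r" and fC = "\<lambda>_ r s. r @ s" and fX = "\<lambda>_ r. r" and fU = "\<lambda>_ r s. r @ s" and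
        fP = "\<lambda>_ p ts. [(p, ts)]" and fA = "\<lambda>_ _ _. []"])
    (intro comp assms; fail | simp; fail)+

lemma computable_updates [comp]:
  assumes "computable \<phi>" shows "computable (\<lambda>x. updates (\<phi> x))"
  by (rule computable_formula_rec[where F = "\<lambda>_ :: nat. updates" and p = "\<lambda>_. 0" and fT = "\<lambda>_. []" and
        fN = "\<lambda>_ r. r" and fC = "\<lambda>_ r s. r @ s" and fX = "\<lambda>_ r. r" and fU = "\<lambda>_ r s. r @ s" and
        fP = "\<lambda>_ _ _. []" and fA = "\<lambda>_ c \<tau>. [(c, \<tau>)]"])
    (intro comp assms; fail | simp; fail)+

lemma computable_next_depth [comp]:
  assumes "computable \<phi>" shows "computable (\<lambda>x. next_depth (\<phi> x))"
  by (rule computable_formula_rec[where F = "\<lambda>_ :: nat. next_depth" and p = "\<lambda>_. 0" and fT = "\<lambda>_. 0" and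
        fN = "\<lambda>_ r. r" and fC = "\<lambda>_ r s. r + s" and fX = "\<lambda>_ r. Suc r" and fU = "\<lambda>_ r s. r + s" and
        fP = "\<lambda>_ _ _. 0" and fA = "\<lambda>_ _ _. 0"])
    (intro comp assms; fail | simp; fail)+

text \<open>The recursion scheme keeps its parameter fixed whereas negation flips the polarity. Both
  polarities are therefore computed at once, together with a flag for \<open>TrueF\<close>, which
  the clause for until inspects.\<close>

lemma computable_reachability_fragment [comp]:
  assumes "computable \<phi>" shows "computable (\<lambda>x. reachability_fragment (\<phi> x))"
proof -
  have "computable (\<lambda>x. (\<lambda>_ \<phi>. (\<phi> = TrueF, reach_pol True \<phi>, reach_pol False \<phi>)) (0 :: nat) (\<phi> x))"
    by (rule computable_formula_rec[where p = "\<lambda>_. 0 :: nat" and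
          F = "\<lambda>_ \<phi>. (\<phi> = TrueF, reach_pol True \<phi>, reach_pol False \<phi>)" and
          fT = "\<lambda>_. (True, True, True)" and fN = "\<lambda>_ r. (False, snd (snd r), fst (snd r))" and
          fC = "\<lambda>_ r s. (False, fst (snd r) \<and> fst (snd s), snd (snd r) \<and> snd (snd s))" and
          fX = "\<lambda>_ r. (False, snd r)" and fU = "\<lambda>_ r s. (False, fst r \<and> fst (snd s), False)" and
          fP = "\<lambda>_ _ _. (False, True, True)" and fA = "\<lambda>_ _ _. (False, True, True)"])
      (intro comp assms; fail | simp; fail)+
  then have "computable (\<lambda>x. fst (snd (\<phi> x = TrueF, reach_pol True (\<phi> x), reach_pol False (\<phi> x))))"
    by (intro computable_fst computable_snd)
  then show ?thesis by (simp add: reachability_fragment_def)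
qed

text \<open>The fragment is not closed under subformulas, so \<open>next_fragment\<close> is carried
  along, and again a flag for \<open>TrueF\<close>.\<close>

lemma computable_top_eventually_fragment [comp]:
  assumes "computable \<phi>" shows "computable (\<lambda>x. top_eventually_fragment (\<phi> x))"
proof -
  have "computable (\<lambda>x. (\<lambda>_ \<phi>. (\<phi> = TrueF, next_fragment \<phi>, top_eventually_fragment \<phi>)) (0 :: nat) (\<phi> x))"
    by (rule computable_formula_rec[where p = "\<lambda>_. 0 :: nat" and
          F = "\<lambda>_ \<phi>. (\<phi> = TrueF, next_fragment \<phi>, top_eventually_fragment \<phi>)" and
          fT = "\<lambda>_. (True, True, True)" and fN = "\<lambda>_ r. (False, fst (snd r), fst (snd r))" and
          fC = "\<lambda>_ r s. (False, fst (snd r) \<and> fst (snd s), fst (snd r) \<and> fst (snd s))" and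
          fX = "\<lambda>_ r. (False, fst (snd r), fst (snd r))" and
          fU = "\<lambda>_ r s. (False, False, fst r \<and> fst (snd s))" and
          fP = "\<lambda>_ _ _. (False, True, True)" and fA = "\<lambda>_ _ _. (False, True, True)"])
      (intro comp assms; fail | simp add: top_eventually_fragment_def; fail)+
  then have "computable (\<lambda>x. snd (snd (\<phi> x = TrueF, next_fragment (\<phi> x), top_eventually_fragment (\<phi> x))))"
    by (intro computable_snd)
  then show ?thesis by simp
qed

lemma computable_lasso [comp]:
  assumes "computable i" "computable j" "computable t" shows "computable (\<lambda>x. lasso (i x) (j x) (t x))"
proof -
  have "computable (\<lambda>x. rec_nat 0 (\<lambda>_ r. if Suc r = j x then i x else Suc r) (t x))"
    by (intro comp assms computable_comp[OF assms(1)] computable_comp[OF assms(2)])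
  moreover have "rec_nat 0 (\<lambda>_ r. if Suc r = j then i else Suc r) t = lasso i j t" for i j t
    by (induction t) auto
  ultimately show ?thesis by simp
qed

lemma computable_row_env [comp]:
  assumes "computable k" "computable rows" shows "computable (\<lambda>x. row_env (k x) (rows x))"
  unfolding row_env_def by (intro comp assms)

text \<open>The table is recursive in the formula only; everything else is packed into one tuple
  that serves as the fixed parameter.\<close>

lemma computable_lasso_table [comp]:
  assumes "computable k" "computable rows" "computable Q" "computable i" "computable j" "computable \<phi>"
  shows "computable (\<lambda>x. lasso_table (row_obs (k x) (rows x) (Q x)) (i x) (j x) (\<phi> x))"
proof -
  let ?k = fst and ?rows = "\<lambda>p. fst (snd p)" and ?Q = "\<lambda>p. fst (snd (snd p))"
    and ?i = "\<lambda>p. fst (snd (snd (snd p)))" and ?j = "\<lambda>p. snd (snd (snd (snd p)))"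
  let ?p = "\<lambda>x. (k x, rows x, Q x, i x, j x)"
  have "computable (\<lambda>x. (\<lambda>p. lasso_table (row_obs (?k p) (?rows p) (?Q p)) (?i p) (?j p)) (?p x) (\<phi> x))"
    by (rule computable_formula_rec[where p = ?p and
          F = "\<lambda>p. lasso_table (row_obs (?k p) (?rows p) (?Q p)) (?i p) (?j p)" and
          fT = "\<lambda>p. map (\<lambda>s. True) [0..<?j p]" and
          fN = "\<lambda>p r. map (\<lambda>s. \<not> nth_default False r s) [0..<?j p]" and
          fC = "\<lambda>p r r'. map (\<lambda>s. nth_default False r s \<and> nth_default False r' s) [0..<?j p]" and
          fX = "\<lambda>p r. map (\<lambda>s. nth_default False r (lasso (?i p) (?j p) (Suc s))) [0..<?j p]" and
          fU = "\<lambda>p r r'. map (\<lambda>s. \<exists>m<?j p. nth_default False r' (lasso (?i p) (?j p) (s + m)) \<and>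
            (\<forall>n<m. nth_default False r (lasso (?i p) (?j p) (s + n)))) [0..<?j p]" and
          fP = "\<lambda>p a ts. map (\<lambda>s. (a, map (\<lambda>t. subst (lookup (row_env (?k p) (take s (?rows p)))) t) ts)
            \<in> set (?Q p)) [0..<?j p]" and
          fA = "\<lambda>p c \<tau>. map (\<lambda>s. lookup (nth_default [] (?rows p) s) c = \<tau>) [0..<?j p]"])
      (intro comp assms; fail | simp add: row_obs_def del: lasso.simps; fail)+
  then show ?thesis by simp
qed

lemma computable_wf_rows [comp]:
  assumes "computable \<Sigma>" "computable rows" shows "computable (\<lambda>x. wf_rows (\<Sigma> x) (rows x))"
  unfolding wf_rows_def by (intro comp assms computable_comp[OF assms(1)])

lemma computable_lasso_check [comp]:
  assumes "computable \<Sigma>" "computable \<phi>" "computable rows" "computable i" "computable Q"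
  shows "computable (\<lambda>x. lasso_check (\<Sigma> x) (\<phi> x) (rows x) (i x) (Q x))"
  unfolding lasso_check_def by (intro comp assms)

lemma computable_closed_check [comp]:
  assumes "computable \<Sigma>" "computable \<phi>" "computable rows" "computable i" "computable Q"
  shows "computable (\<lambda>x. closed_check (\<Sigma> x) (\<phi> x) (rows x) (i x) (Q x))"
  unfolding closed_check_def by (intro comp assms)

lemma computable_fresh_check [comp]:
  assumes "computable \<Sigma>" "computable \<phi>" "computable rows" "computable i" "computable Q"
  shows "computable (\<lambda>x. fresh_check (\<Sigma> x) (\<phi> x) (rows x) (i x) (Q x))"
  unfolding fresh_check_def by (intro comp assms)

lemma computable_asize [comp]:
  assumes "computable ts" shows "computable (\<lambda>x. asize (ts x))"
  unfolding asize_def by (intro comp assms)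

lemma computable_grow_check [comp]:
  assumes "computable \<Sigma>" "computable \<phi>" "computable rows" "computable i" "computable Q"
    "computable As" "computable D"
  shows "computable (\<lambda>x. grow_check (\<Sigma> x) (\<phi> x) (rows x) (i x) (Q x) (As x) (D x))"
  unfolding grow_check_def
  by (intro comp assms assms[THEN computable_comp])

lemma computable_row_atoms [comp]:
  assumes "computable k" "computable rows" "computable \<phi>"
  shows "computable (\<lambda>x. row_atoms (k x) (rows x) (\<phi> x))"
  unfolding row_atoms_def by (intro comp assms assms[THEN computable_comp])

lemma computable_fsize [comp]:
  assumes "computable \<phi>" shows "computable (\<lambda>x. fsize (\<phi> x))"
  unfolding fsize_def by (intro comp assms)

lemma computable_fresh_bound [comp]:
  assumes "computable \<Sigma>" "computable \<phi>" shows "computable (\<lambda>x. fresh_bound (\<Sigma> x) (\<phi> x))"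
  unfolding fresh_bound_def by (intro comp assms)

lemma computable_pump [comp]:
  assumes "computable f" "computable a" "computable n" "computable y"
  shows "computable (\<lambda>x. pump (f x) (a x) (n x) (y x))"
  unfolding pump_def by (intro comp assms assms[THEN computable_comp])

lemma computable_candidates [comp]:
  assumes "computable \<Sigma>" "computable \<phi>" shows "computable (\<lambda>x. candidates (\<Sigma> x) (\<phi> x))"
proof -
  \<comment> \<open>The mapped functions are eta-expanded so that the rule for \<open>map\<close>
    matches.\<close>
  have "computable (\<lambda>x. map (\<lambda>a. snd a) (updates (\<phi> x)) @ map (\<lambda>c. Cell c) [0..<num_cells (\<Sigma> x)] @
     map (\<lambda>f. FApp f []) [0..<length (fun_arities (\<Sigma> x))] @
     concat (map (\<lambda>f. map (\<lambda>n. pump f (nth_default 0 (fun_arities (\<Sigma> x)) f - 1) n (Cell 0))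
       [0..<Suc (fresh_bound (\<Sigma> x) (\<phi> x))]) [0..<length (fun_arities (\<Sigma> x))]))"
    by (intro comp assms assms[THEN computable_comp])
  then show ?thesis by (simp only: candidates_def)
qed

lemma computable_next_check [comp]:
  assumes "computable \<Sigma>" "computable \<phi>" shows "computable (\<lambda>x. next_check (\<Sigma> x) (\<phi> x))"
  unfolding next_check_def by (intro comp assms assms[THEN computable_comp])

lemma computable_wf_signature [comp]:
  assumes "computable \<Sigma>" shows "computable (\<lambda>x. wf_signature (\<Sigma> x))"
  unfolding wf_signature_def by (intro comp assms)

lemma surj_enc_nat: "surj (enc :: nat \<Rightarrow> nat)"
  by (simp add: surj_def)

lemma surj_enc_list:
  assumes "surj (enc :: 'a::encodable \<Rightarrow> nat)" shows "surj (enc :: 'a list \<Rightarrow> nat)"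
proof (rule surjI)
  show "enc (map (inv (enc :: 'a \<Rightarrow> nat)) (list_decode n)) = n" for n
    by (simp add: enc_list_def map_idI surj_f_inv_f[OF assms])
qed

lemma surj_enc_prod:
  assumes "surj (enc :: 'a::encodable \<Rightarrow> nat)" "surj (enc :: 'b::encodable \<Rightarrow> nat)"
  shows "surj (enc :: 'a \<times> 'b \<Rightarrow> nat)"
proof (rule surjI)
  show "enc (inv (enc :: 'a \<Rightarrow> nat) (fst (prod_decode n)), inv (enc :: 'b \<Rightarrow> nat) (snd (prod_decode n))) = n" for n
    by (simp add: enc_prod_def surj_f_inv_f[OF assms(1)] surj_f_inv_f[OF assms(2)])
qed

section \<open>From certificates to the decision problems\<close>

lemma semi_decidable_reachability:
  "semi_decidable_problem {(\<Sigma>, \<phi>) \<in> tsl_formulas. reachability_fragment \<phi> \<and> herbrand_sat \<Sigma> \<phi>}"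
proof -
  define \<chi> :: "signature \<times> formula \<Rightarrow> fterm list list \<times> nat \<times> (nat \<times> fterm list) list \<Rightarrow> bool" where
    "\<chi> x w \<longleftrightarrow> wf_signature (fst x) \<and> wf_formula (fst x) (snd x) \<and> reachability_fragment (snd x) \<and>
      closed_check (fst x) (snd x) (fst w) (fst (snd w)) (snd (snd w))" for x w
  have "computable (\<lambda>z. \<chi> (fst z) (snd z))" unfolding \<chi>_def by (intro comp)
  then have "semi_decidable_problem {x. \<exists>w. \<chi> x w}"
    by (rule semi_decidable_problemI)
      (intro surj_enc_prod surj_enc_list surj_enc_nat surj_enc_fterm)
  moreover have "{x. \<exists>w. \<chi> x w} =
      {(\<Sigma>, \<phi>) \<in> tsl_formulas. reachability_fragment \<phi> \<and> herbrand_sat \<Sigma> \<phi>}"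
  proof (intro set_eqI iffI; clarify)
    fix \<Sigma> \<phi> rows i Q assume "\<chi> (\<Sigma>, \<phi>) (rows, i, Q)"
    then show "(\<Sigma>, \<phi>) \<in> tsl_formulas \<and> reachability_fragment \<phi> \<and> herbrand_sat \<Sigma> \<phi>"
      using closed_check_sound[of \<Sigma> \<phi> rows i Q] by (simp add: \<chi>_def tsl_formulas_def)
  next
    fix \<Sigma> \<phi> assume *: "(\<Sigma>, \<phi>) \<in> tsl_formulas" "reachability_fragment \<phi>" "herbrand_sat \<Sigma> \<phi>"
    then obtain rows i Q where "closed_check \<Sigma> \<phi> rows i Q"
      using reachability_complete[of \<phi> \<Sigma>] by (auto simp: tsl_formulas_def)
    then have "\<chi> (\<Sigma>, \<phi>) (rows, i, Q)" using * by (simp add: \<chi>_def tsl_formulas_def)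
    then show "\<exists>w. \<chi> (\<Sigma>, \<phi>) w" ..
  qed
  ultimately show ?thesis by simp
qed

lemma decidable_top_eventually:
  "decidable_problem {(\<Sigma>, \<phi>) \<in> tsl_formulas. top_eventually_fragment \<phi> \<and> herbrand_sat \<Sigma> \<phi>}"
proof -
  have "computable (\<lambda>x. wf_signature (fst x) \<and> wf_formula (fst x) (snd x) \<and>
      top_eventually_fragment (snd x) \<and> next_check (fst x) (snd x))"
    by (intro comp)
  then have "decidable_problem {x. wf_signature (fst x) \<and> wf_formula (fst x) (snd x) \<and>
      top_eventually_fragment (snd x) \<and> next_check (fst x) (snd x)}"
    by (rule decidable_problemI)
  moreover have "{x. wf_signature (fst x) \<and> wf_formula (fst x) (snd x) \<and>
      top_eventually_fragment (snd x) \<and> next_check (fst x) (snd x)} =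
      {(\<Sigma>, \<phi>) \<in> tsl_formulas. top_eventually_fragment \<phi> \<and> herbrand_sat \<Sigma> \<phi>}"
    using next_check_iff by (auto simp: tsl_formulas_def)
  ultimately show ?thesis by simp
qed

lemma semi_decidable_one_cell:
  "semi_decidable_problem {(\<Sigma>, \<phi>) \<in> tsl_formulas. num_cells \<Sigma> = 1 \<and> herbrand_sat \<Sigma> \<phi>}"
proof -
  define \<chi> :: "signature \<times> formula \<Rightarrow> fterm list list \<times> nat \<times> (nat \<times> fterm list) list \<times>
      (nat \<times> fterm list) list \<times> nat \<Rightarrow> bool" where
    "\<chi> x w \<longleftrightarrow> wf_signature (fst x) \<and> wf_formula (fst x) (snd x) \<and>
      one_cell_check (fst x) (snd x) (fst w) (fst (snd w)) (fst (snd (snd w)))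
        (fst (snd (snd (snd w)))) (snd (snd (snd (snd w))))" for x w
  have "computable (\<lambda>z. \<chi> (fst z) (snd z))" unfolding \<chi>_def one_cell_check_def by (intro comp)
  then have "semi_decidable_problem {x. \<exists>w. \<chi> x w}"
    by (rule semi_decidable_problemI)
      (intro surj_enc_prod surj_enc_list surj_enc_nat surj_enc_fterm)
  moreover have "{x. \<exists>w. \<chi> x w} = {(\<Sigma>, \<phi>) \<in> tsl_formulas. num_cells \<Sigma> = 1 \<and> herbrand_sat \<Sigma> \<phi>}"
  proof (intro set_eqI iffI; clarify)
    fix \<Sigma> \<phi> rows i Q As D assume "\<chi> (\<Sigma>, \<phi>) (rows, i, Q, As, D)"
    then have "wf_signature \<Sigma>" "wf_formula \<Sigma> \<phi>" "one_cell_check \<Sigma> \<phi> rows i Q As D"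
      by (simp_all add: \<chi>_def)
    then show "(\<Sigma>, \<phi>) \<in> tsl_formulas \<and> num_cells \<Sigma> = 1 \<and> herbrand_sat \<Sigma> \<phi>"
      using one_cell_sound[of \<Sigma> \<phi> rows i Q As D] by (simp add: tsl_formulas_def one_cell_check_def)
  next
    fix \<Sigma> \<phi> assume *: "(\<Sigma>, \<phi>) \<in> tsl_formulas" "num_cells \<Sigma> = 1" "herbrand_sat \<Sigma> \<phi>"
    then obtain rows i Q As D where "one_cell_check \<Sigma> \<phi> rows i Q As D"
      using one_cell_complete[of \<Sigma> \<phi>] by (auto simp: tsl_formulas_def)
    then have "\<chi> (\<Sigma>, \<phi>) (rows, i, Q, As, D)" using * by (simp add: \<chi>_def tsl_formulas_def)
    then show "\<exists>w. \<chi> (\<Sigma>, \<phi>) w" ..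
  qed
  ultimately show ?thesis by simp
qed

theorem theorem7:
  assumes "infinite (UNIV :: 'u set)"
  shows "semi_decidable_problem
           {(\<Sigma>, \<phi>) \<in> tsl_formulas. reachability_fragment \<phi> \<and> satisfiable_TU TYPE('u) \<Sigma> \<phi>}
       \<and> decidable_problem
           {(\<Sigma>, \<phi>) \<in> tsl_formulas. top_eventually_fragment \<phi> \<and> satisfiable_TU TYPE('u) \<Sigma> \<phi>}
       \<and> semi_decidable_problem
           {(\<Sigma>, \<phi>) \<in> tsl_formulas. num_cells \<Sigma> = 1 \<and> satisfiable_TU TYPE('u) \<Sigma> \<phi>}"
  unfolding satisfiable_iff_herbrand[OF assms]
  using semi_decidable_reachability decidable_top_eventually semi_decidable_one_cell by blast

end
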